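(* Let $X$ be a smooth projective complex surface with numerically trivial canonical class. For $i=1,\dots,N$ let $H_i$ be a finite ordered set. Attach to every $a\in H_i$ a homogeneous class $\alpha_a\in H=H^*(X,\mathbb Q)$ and an even integer $d_a\ge0$, and define the normally ordered block $$\mathcal O_i(x_i)=\ :\prod_{a\in H_i}^{\longrightarrow}\mathbf a^{(d_a)}(\alpha_a;x_i):$$ (product in the order of $H_i$). Write $q=e^{2\pi i\tau}$, $x_i=e^{2\pi i z_i}$, $y=x_0=e^{2\pi i z_0}$ with $\Im\tau>0$. Then, in the chamber $0\le\Im z_0<\Im z_1<\cdots<\Im z_N<\Im\tau$, $$\Omega_{q,y}\bigl(\mathcal O_1(x_1)\cdots\mathcal O_N(x_N)\bigr)=\sum_{\Pi}\varepsilon(\Pi)\prod_{\{a\}\in\Pi}M_a\prod_{\substack{\{a,b\}\in\Pi\\ i(a)\ne i(b)}}C_{ab}\prod_{\substack{\{a,b\}\in\Pi\\ i(a)=i(b)}}L_{ab},$$ where $\Pi$ runs over all partitions of $\bigsqcup_i H_i$ into singletons and pairs, $i(a)$ is the index of the set containing $a$, and $$M_a=\Bigl(\int_X\alpha_a\Bigr)\,D_u^{d_a}\widehat Z(u)\Big|_{u=x_{i(a)}/y},$$ $$C_{ab}=-(\alpha_a,\alpha_b)\,D_u^{d_a+d_b}P(u)\Big|_{u=x_j/x_i}\quad\text{if }a\in H_i,\ b\in H_j,\ i<j,$$ $$L_{ab}=-2(\alpha_a,\alpha_b)\,T_{d_a+d_b+2}(q)\quad\text{if }a,b\in H_i,\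 a<b.$$ The sign $\varepsilon(\Pi)$ is the Koszul sign of $\Pi$ for the concatenated order $H_1,\dots,H_N$.
   Context: Fock space. $H=H^*(X,\mathbb Q)$ has parity $|\alpha|=\deg\alpha\bmod 2$ and pairing $(\alpha,\beta)=\int_X\alpha\cup\beta$ (integration is zero on $H^j$, $j\ne4$). $\mathbb H_X=\bigoplus_{n\ge0}H^*(X^{[n]},\mathbb Q)$, with $X^{[n]}$ the Hilbert scheme of $n$ points, vacuum $|0\rangle=1\in H^0(X^{[0]})$, and number operator $\mathfrak n$ acting as $n$ on $H^*(X^{[n]})$. For $m\in\mathbb Z\setminus\{0\}$ and $\alpha\in H$, $\mathfrak a_m(\alpha)$ is the Nakajima operator (linear in $\alpha$, of parity $|\alpha|$, mapping $H^*(X^{[n]})$ to $H^*(X^{[n-m]})$), with negative modes creation operators and positive modes annihilation operators (killing $|0\rangle$), normalized so that $$[\mathfrak a_m(\alpha),\mathfrak a_n(\beta)]_{\mathrm s}=-m\,\delta_{m,-n}(\alpha,\beta)\,\mathrm{Id},\qquad [\mathfrak n,\mathfrak a_m(\alpha)]=-m\,\mathfrak a_m(\alpha),$$ where $[A,B]_{\mathrm s}=AB-(-1)^{|A||B|}BA$; $\mathbb H_X$ is the Fock space generated from $|0\rangle$ by the negative modes. Normalized trace. Let $1_X\in H^0(X)$ be the unit and $$\mathbf W_y=\exp\Bigl(\sum_{n>0}\tfrac{y^n}{n}\mathfrak a_{-n}(1_X)\Bigr)\exp\Bigl(-\sum_{n>0}\tfrac{y^{-n}}{n}\mathfrak a_n(1_X)\Bigr).$$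 The supertrace is $\mathrm{Str}(A)=\sum_{n,j}(-1)^j\mathrm{Tr}(A|_{H^j(X^{[n]})})$, where only the diagonal block in the number grading contributes, and $\Omega_{q,y}(A)=\mathrm{Str}(q^{\mathfrak n}\mathbf W_yA)/\mathrm{Str}(q^{\mathfrak n}\mathbf W_y)$ (with $\mathrm{Str}(q^{\mathfrak n}\mathbf W_y)=\prod_{m\ge1}(1-q^m)^{-\chi(X)}$). For a product of normally ordered blocks of fields, $\Omega_{q,y}$ means the sum over all mode assignments of the normalized traces of the resulting mode monomials, times the corresponding powers of the $x_i$ and coefficients (this converges absolutely in the chamber). Fields and normal ordering. With $D_x=x\frac{\partial}{\partial x}$, $\mathbf a(\alpha;x)=\sum_{m\ne0}\mathfrak a_m(\alpha)x^{-m}$ and $\mathbf a^{(d)}(\alpha;x)=D_x^d\mathbf a(\alpha;x)$. For homogeneous modes, $:A_1\cdots A_r:$ is the product obtained by stably moving the negative modes to the left of the positive modes, multiplied by $(-1)^{|A_i||A_j|}$ for every pair whose relative order is reversed; extended multilinearly to fields. Koszul sign. Given a partition $\Pi$ of a finite ordered set of labels $a$ (carrying homogeneous classes $\alpha_a$) into singletons and pairs, write each pair increasingly and order the parts by their least elements; reading off the parts gives a rearrangement of the labels, and $\varepsilon(\Pi)$ is the product of $(-1)^{|\alpha_a||\alpha_b|}$ over all pairs of labels whose relative order is reversed. Scalar functions. For $|q|<|u|<1$, $$\widehat Z(u)=\sum_{n\ge1}\Bigl(\frac{u^n}{1-q^n}-\frac{q^nu^{-n}}{1-q^n}\Bigr),\qquad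 P(u)=\sum_{n\ge1}n\Bigl(\frac{u^n}{1-q^n}+\frac{q^nu^{-n}}{1-q^n}\Bigr),$$ $D_u=u\frac{\partial}{\partial u}$, and $T_s(q)=\sum_{n\ge1}n^{s-1}\frac{q^n}{1-q^n}$ for $s\ge2$. *)

theory Defs
  imports
    "HOL-Analysis.Analysis"
    "HOL-Library.Disjoint_Sets"
    "HOL-Library.Groups_Big_Fun"
begin

text \<open>
  Neither schemes nor their cohomology are available, so a surface enters through its rational
  cohomology ring and its Hilbert schemes through the Fock space carrying the Nakajima operators.
  The axioms below are the standard properties of these objects and nothing else is assumed.
\<close>

section \<open>Cohomology of the surface\<close>

record 'h surface =
  smul :: "rat \<Rightarrow> 'h \<Rightarrow> 'h"
  coh :: "nat \<Rightarrow> 'h set"            \<comment> \<open>\<open>coh X j\<close> is \<open>H\<close> in degree \<open>j\<close>\<close>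
  cup :: "'h \<Rightarrow> 'h \<Rightarrow> 'h"
  unit :: 'h
  integral\<^sub>X :: "'h \<Rightarrow> rat"
  canonical :: 'h                   \<comment> \<open>first Chern class of the canonical bundle\<close>
  curves :: "'h set"                \<comment> \<open>Poincare duals of the algebraic curves in \<open>X\<close>\<close>

locale surface_cohomology = vector_space "smul X"
  for X :: "'h::ab_group_add surface" +
  assumes coh_subspace: "subspace (coh X j)"
    and coh_finite_dim: "\<exists>B. finite B \<and> span B = coh X j"
    and coh_above: "4 < j \<Longrightarrow> coh X j = {0}"
    and coh_direct_sum:
      "\<exists>!f. (\<forall>j. f j \<in> coh X j) \<and> v = (\<Sum>j\<le>4. f j)"
    and cup_linear_left: "Vector_Spaces.linear (smul X) (smul X) (\<lambda>v. cup X v w)"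
    and cup_linear_right: "Vector_Spaces.linear (smul X) (smul X) (cup X v)"
    and cup_degree: "v \<in> coh X i \<Longrightarrow> w \<in> coh X j \<Longrightarrow> cup X v w \<in> coh X (i + j)"
    and cup_assoc: "cup X (cup X u v) w = cup X u (cup X v w)"
    and cup_commute:
      "v \<in> coh X i \<Longrightarrow> w \<in> coh X j \<Longrightarrow> cup X v w = smul X ((-1) ^ (i * j)) (cup X w v)"
    and unit_degree: "unit X \<in> coh X 0"
    and cup_unit: "cup X (unit X) v = v"
    and integral_linear: "Vector_Spaces.linear (smul X) (*) (integral\<^sub>X X)"
    and integral_degree: "v \<in> coh X j \<Longrightarrow> j \<noteq> 4 \<Longrightarrow> integral\<^sub>X X v = 0"
    and Poincare_duality: "(\<And>w. integral\<^sub>X X (cup X v w) = 0) \<Longrightarrow> v = 0"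
    and canonical_degree: "canonical X \<in> coh X 2"
    and curves_degree: "curves X \<subseteq> coh X 2"

definition pairing :: "'h surface \<Rightarrow> 'h \<Rightarrow> 'h \<Rightarrow> rat" where
  "pairing X v w = integral\<^sub>X X (cup X v w)"

definition numerically_trivial_canonical :: "'h surface \<Rightarrow> bool" where
  "numerically_trivial_canonical X \<longleftrightarrow> (\<forall>C\<in>curves X. pairing X (canonical X) C = 0)"


section \<open>Fock space\<close>

text \<open>
  Since \<open>W\<^sub>y\<close> and \<open>q\<^sup>\<n>\<close> have complex coefficients, the Fock space is taken with
  scalars extended to the complex numbers: \<open>hilb F n j\<close> is the cohomology of the Hilbert scheme
  of \<open>n\<close> points in degree \<open>j\<close> with complex coefficients, and \<open>'f\<close> is the direct sum of all of
  them.  The rational form is the rational span of the vectors obtained by applying the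
  \<open>nak F m v\<close> to the vacuum.  Only nonzero modes are meaningful; \<open>nak F 0\<close> is arbitrary.
\<close>

record ('h, 'f) fock =
  cscale :: "complex \<Rightarrow> 'f \<Rightarrow> 'f"
  hilb :: "nat \<Rightarrow> nat \<Rightarrow> 'f set"
  vac :: 'f
  nak :: "int \<Rightarrow> 'h \<Rightarrow> 'f \<Rightarrow> 'f"

locale nakajima_fock = surface_cohomology X + fock: vector_space "cscale F"
  for X :: "'h::ab_group_add surface" and F :: "('h, 'f::ab_group_add) fock" +
  assumes hilb_subspace: "fock.subspace (hilb F n j)"
    and hilb_finite_dim: "\<exists>B. finite B \<and> fock.span B = hilb F n j"
    and hilb_above: "4 * n < j \<Longrightarrow> hilb F n j = {0}"
    and hilb_direct_sum:
      "\<exists>!f. (\<forall>p. f p \<in> hilb F (fst p) (snd p)) \<and> finite {p. f p \<noteq> 0}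
          \<and> v = (\<Sum>p | f p \<noteq> 0. f p)"
    and vac_nonzero: "vac F \<noteq> 0"
    and hilb_zero: "hilb F 0 0 = fock.span {vac F}"
    and nak_linear: "m \<noteq> 0 \<Longrightarrow> Vector_Spaces.linear (cscale F) (cscale F) (nak F m \<alpha>)"
    and nak_add: "m \<noteq> 0 \<Longrightarrow> nak F m (\<alpha> + \<beta>) v = nak F m \<alpha> v + nak F m \<beta> v"
    and nak_smul: "m \<noteq> 0 \<Longrightarrow> nak F m (smul X r \<alpha>) v = cscale F (of_rat r) (nak F m \<alpha> v)"
    and nak_grading:
      "m \<noteq> 0 \<Longrightarrow> \<alpha> \<in> coh X i \<Longrightarrow> v \<in> hilb F n j \<Longrightarrow> m \<le> int n \<Longrightarrow>
        nak F m \<alpha> v \<in> fock.span (\<Union>k\<in>{k. even (k + i + j)}. hilb F (nat (int n - m)) k)"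
    and nak_kill: "v \<in> hilb F n j \<Longrightarrow> int n < m \<Longrightarrow> nak F m \<alpha> v = 0"
    and nak_commutator:
      "m \<noteq> 0 \<Longrightarrow> l \<noteq> 0 \<Longrightarrow> \<alpha> \<in> coh X i \<Longrightarrow> \<beta> \<in> coh X j \<Longrightarrow>
        nak F m \<alpha> (nak F l \<beta> v) - cscale F ((-1) ^ (i * j)) (nak F l \<beta> (nak F m \<alpha> v))
        = cscale F (if m = - l then - of_int m * of_rat (pairing X \<alpha> \<beta>) else 0) v"
    and fock_generated:
      "fock.span {foldr (\<lambda>(m, \<alpha>). nak F m \<alpha>) ops (vac F) | ops. \<forall>(m, \<alpha>)\<in>set ops. m < 0} = UNIV"

definition component :: "('h, 'f::ab_group_add) fock \<Rightarrow> nat \<Rightarrow> nat \<Rightarrow> 'f \<Rightarrow> 'f" where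
  "component F n j v =
    (THE f. (\<forall>p. f p \<in> hilb F (fst p) (snd p)) \<and> finite {p. f p \<noteq> 0}
        \<and> v = (\<Sum>p | f p \<noteq> 0. f p)) (n, j)"

definition hilb_component :: "('h, 'f::ab_group_add) fock \<Rightarrow> nat \<Rightarrow> 'f \<Rightarrow> 'f" where
  "hilb_component F n v = (\<Sum>j\<le>4 * n. component F n j v)"


section \<open>Vertex operator and supertrace\<close>

text \<open>
  The creation exponential leaves the direct sum, so operators with values in the direct product
  of the \<open>H\<^sup>*(X\<^sup>[\<^sup>n\<^sup>])\<close> are represented by functions \<open>'f \<Rightarrow> nat \<Rightarrow> 'f\<close>, the value at \<open>n\<close> being
  the component in \<open>H\<^sup>*(X\<^sup>[\<^sup>n\<^sup>])\<close>.  The exponential of a sum of operators \<open>B n\<close> over \<open>n > 0\<close> is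
  expanded into the sum of \<open>B n\<^sub>1 \<dots> B n\<^sub>r / r!\<close> over all finite sequences of positive indices.
  By the number grading only finitely many terms contribute to each vector (annihilation) or to
  each component (creation), as \<^const>\<open>Sum_any\<close> requires.
\<close>

definition exp_term ::
  "('h, 'f::ab_group_add) fock \<Rightarrow> (nat \<Rightarrow> 'f \<Rightarrow> 'f) \<Rightarrow> nat list \<Rightarrow> 'f \<Rightarrow> 'f" where
  "exp_term F B ns v = (if 0 \<in> set ns then 0 else cscale F (1 / fact (length ns)) (foldr B ns v))"

definition exp_annihilation ::
  "'h surface \<Rightarrow> ('h, 'f::ab_group_add) fock \<Rightarrow> complex \<Rightarrow> 'f \<Rightarrow> 'f" where
  "exp_annihilation X F y v =
    Sum_any (\<lambda>ns. exp_term F (\<lambda>n w. cscale F (- (1 / (of_nat n * y ^ n))) (nak F (int n) (unit X) w)) ns v)"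

definition exp_creation ::
  "'h surface \<Rightarrow> ('h, 'f::ab_group_add) fock \<Rightarrow> complex \<Rightarrow> 'f \<Rightarrow> nat \<Rightarrow> 'f" where
  "exp_creation X F y v l =
    Sum_any (\<lambda>ns. hilb_component F l
      (exp_term F (\<lambda>n w. cscale F (y ^ n / of_nat n) (nak F (- int n) (unit X) w)) ns v))"

definition vertex_op ::
  "'h surface \<Rightarrow> ('h, 'f::ab_group_add) fock \<Rightarrow> complex \<Rightarrow> 'f \<Rightarrow> nat \<Rightarrow> 'f" where
  "vertex_op X F y v = exp_creation X F y (exp_annihilation X F y v)"

definition q_number :: "('h, 'f::ab_group_add) fock \<Rightarrow> complex \<Rightarrow> (nat \<Rightarrow> 'f) \<Rightarrow> nat \<Rightarrow> 'f" where
  "q_number F q w n = cscale F (q ^ n) (w n)"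

text \<open>Trace of the diagonal block of an operator on \<open>hilb F n j\<close>.\<close>

definition block_trace ::
  "('h, 'f::ab_group_add) fock \<Rightarrow> nat \<Rightarrow> nat \<Rightarrow> ('f \<Rightarrow> 'f) \<Rightarrow> complex" where
  "block_trace F n j g =
    (let B = (SOME B. \<not> module.dependent (cscale F) B \<and> module.span (cscale F) B = hilb F n j)
     in \<Sum>b\<in>B. module.representation (cscale F) B (component F n j (g b)) b)"

definition hilb_supertrace ::
  "('h, 'f::ab_group_add) fock \<Rightarrow> ('f \<Rightarrow> nat \<Rightarrow> 'f) \<Rightarrow> nat \<Rightarrow> complex" where
  "hilb_supertrace F A n = (\<Sum>j\<le>4 * n. (-1) ^ j * block_trace F n j (\<lambda>v. A v n))"

definition supertrace :: "('h, 'f::ab_group_add) fock \<Rightarrow> ('f \<Rightarrow> nat \<Rightarrow> 'f) \<Rightarrow> complex" where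
  "supertrace F A = (\<Sum>\<^sub>\<infinity>n. hilb_supertrace F A n)"

definition weighted_op ::
  "'h surface \<Rightarrow> ('h, 'f::ab_group_add) fock \<Rightarrow> complex \<Rightarrow> complex \<Rightarrow> ('f \<Rightarrow> 'f) \<Rightarrow> 'f \<Rightarrow> nat \<Rightarrow> 'f" where
  "weighted_op X F q y A v = q_number F q (vertex_op X F y (A v))"

definition Omega ::
  "'h surface \<Rightarrow> ('h, 'f::ab_group_add) fock \<Rightarrow> complex \<Rightarrow> complex \<Rightarrow> ('f \<Rightarrow> 'f) \<Rightarrow> complex" where
  "Omega X F q y A =
    supertrace F (weighted_op X F q y A) / supertrace F (weighted_op X F q y (\<lambda>v. v))"


section \<open>Koszul signs and normally ordered blocks\<close>

text \<open>
  The labels of all blocks live in one linearly ordered type, whose order restricted to the union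
  of the \<open>H i\<close> is the concatenated order.  The list \<open>as\<close> below is a rearrangement of labels; the
  sign collects the pairs whose order in \<open>as\<close> is opposite to the order of the labels.
\<close>

definition koszul :: "('l::linorder \<Rightarrow> nat) \<Rightarrow> 'l list \<Rightarrow> complex" where
  "koszul deg as =
    (\<Prod>(k, l) | k < l \<and> l < length as \<and> as ! l < as ! k. (-1) ^ (deg (as ! k) * deg (as ! l)))"

definition partition_sign :: "('l::linorder \<Rightarrow> nat) \<Rightarrow> 'l set set \<Rightarrow> complex" where
  "partition_sign deg \<pi> = koszul deg (concat (map sorted_list_of_set (sorted_key_list_of_set Min \<pi>)))"

definition singleton_pair_partitions :: "'l set \<Rightarrow> 'l set set set" where
  "singleton_pair_partitions J = {\<pi>. partition_on J \<pi> \<and> (\<forall>p\<in>\<pi>. card p = 1 \<or> card p = 2)}"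

definition labels :: "nat \<Rightarrow> (nat \<Rightarrow> 'l set) \<Rightarrow> 'l set" where
  "labels N H = (\<Union>i\<in>{1..N}. H i)"

definition block_index :: "nat \<Rightarrow> (nat \<Rightarrow> 'l set) \<Rightarrow> 'l \<Rightarrow> nat" where
  "block_index N H a = (THE i. i \<in> {1..N} \<and> a \<in> H i)"

definition concatenated :: "nat \<Rightarrow> (nat \<Rightarrow> 'l::linorder set) \<Rightarrow> bool" where
  "concatenated N H \<longleftrightarrow> (\<forall>i\<in>{1..N}. \<forall>j\<in>{1..N}. i < j \<longrightarrow> (\<forall>a\<in>H i. \<forall>b\<in>H j. a < b))"

definition normal_order :: "('l \<Rightarrow> int) \<Rightarrow> 'l list \<Rightarrow> 'l list" where
  "normal_order \<mu> as = filter (\<lambda>a. \<mu> a < 0) as @ filter (\<lambda>a. \<mu> a > 0) as"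

text \<open>The monomial selected in one block by a mode assignment \<open>\<mu>\<close>, without powers of \<open>x\<close>.\<close>

definition block_monomial ::
  "('h, 'f::ab_group_add) fock \<Rightarrow> ('l \<Rightarrow> 'h) \<Rightarrow> ('l \<Rightarrow> nat) \<Rightarrow> ('l \<Rightarrow> int) \<Rightarrow> 'l::linorder set \<Rightarrow> 'f \<Rightarrow> 'f" where
  "block_monomial F \<alpha> deg \<mu> A v =
    (let as = normal_order \<mu> (sorted_list_of_set A)
     in cscale F (koszul deg as) (foldr (\<lambda>a. nak F (\<mu> a) (\<alpha> a)) as v))"

definition monomial_product ::
  "('h, 'f::ab_group_add) fock \<Rightarrow> nat \<Rightarrow> (nat \<Rightarrow> 'l::linorder set) \<Rightarrow> ('l \<Rightarrow> 'h) \<Rightarrow> ('l \<Rightarrow> nat)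
    \<Rightarrow> ('l \<Rightarrow> int) \<Rightarrow> 'f \<Rightarrow> 'f" where
  "monomial_product F N H \<alpha> deg \<mu> v = foldr (\<lambda>i. block_monomial F \<alpha> deg \<mu> (H i)) [1..<Suc N] v"

definition mode_assignments :: "nat \<Rightarrow> (nat \<Rightarrow> 'l set) \<Rightarrow> ('l \<Rightarrow> int) set" where
  "mode_assignments N H = (labels N H \<rightarrow>\<^sub>E UNIV - {0})"

text \<open>
  \<open>D\<^sub>x\<^sup>d x\<^sup>-\<^sup>m = (- m)\<^sup>d x\<^sup>-\<^sup>m\<close> gives the coefficient of a mode in a differentiated field.
\<close>

definition mode_coeff ::
  "nat \<Rightarrow> (nat \<Rightarrow> 'l set) \<Rightarrow> ('l \<Rightarrow> nat) \<Rightarrow> (nat \<Rightarrow> complex) \<Rightarrow> ('l \<Rightarrow> int) \<Rightarrow> complex" where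
  "mode_coeff N H d x \<mu> =
    (\<Prod>a\<in>labels N H. (- of_int (\<mu> a)) ^ d a * x (block_index N H a) powi (- \<mu> a))"

text \<open>The base point \<open>y\<close> is \<open>x 0\<close>.\<close>

definition Omega_term ::
  "'h surface \<Rightarrow> ('h, 'f::ab_group_add) fock \<Rightarrow> nat \<Rightarrow> (nat \<Rightarrow> 'l::linorder set) \<Rightarrow> ('l \<Rightarrow> 'h)
    \<Rightarrow> ('l \<Rightarrow> nat) \<Rightarrow> ('l \<Rightarrow> nat) \<Rightarrow> complex \<Rightarrow> (nat \<Rightarrow> complex) \<Rightarrow> ('l \<Rightarrow> int) \<Rightarrow> complex" where
  "Omega_term X F N H \<alpha> deg d q x \<mu> =
    mode_coeff N H d x \<mu> * Omega X F q (x 0) (monomial_product F N H \<alpha> deg \<mu>)"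

definition Omega_blocks ::
  "'h surface \<Rightarrow> ('h, 'f::ab_group_add) fock \<Rightarrow> nat \<Rightarrow> (nat \<Rightarrow> 'l::linorder set) \<Rightarrow> ('l \<Rightarrow> 'h)
    \<Rightarrow> ('l \<Rightarrow> nat) \<Rightarrow> ('l \<Rightarrow> nat) \<Rightarrow> complex \<Rightarrow> (nat \<Rightarrow> complex) \<Rightarrow> complex" where
  "Omega_blocks X F N H \<alpha> deg d q x =
    (\<Sum>\<^sub>\<infinity>\<mu>\<in>mode_assignments N H. Omega_term X F N H \<alpha> deg d q x \<mu>)"

text \<open>Since \<^const>\<open>infsum\<close> and division are total, well-definedness is a separate assertion.\<close>

definition Omega_blocks_converges ::
  "'h surface \<Rightarrow> ('h, 'f::ab_group_add) fock \<Rightarrow> nat \<Rightarrow> (nat \<Rightarrow> 'l::linorder set) \<Rightarrow> ('l \<Rightarrow> 'h)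
    \<Rightarrow> ('l \<Rightarrow> nat) \<Rightarrow> ('l \<Rightarrow> nat) \<Rightarrow> complex \<Rightarrow> (nat \<Rightarrow> complex) \<Rightarrow> bool" where
  "Omega_blocks_converges X F N H \<alpha> deg d q x \<longleftrightarrow>
    hilb_supertrace F (weighted_op X F q (x 0) (\<lambda>v. v)) summable_on UNIV \<and>
    supertrace F (weighted_op X F q (x 0) (\<lambda>v. v)) \<noteq> 0 \<and>
    (\<forall>\<mu>\<in>mode_assignments N H.
      hilb_supertrace F (weighted_op X F q (x 0) (monomial_product F N H \<alpha> deg \<mu>)) summable_on UNIV) \<and>
    (\<lambda>\<mu>. norm (Omega_term X F N H \<alpha> deg d q x \<mu>)) summable_on mode_assignments N H"


section \<open>Scalar functions\<close>

definition Dlog :: "(complex \<Rightarrow> complex) \<Rightarrow> complex \<Rightarrow> complex" where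
  "Dlog f u = u * deriv f u"

definition Zhat :: "complex \<Rightarrow> complex \<Rightarrow> complex" where
  "Zhat q u = (\<Sum>\<^sub>\<infinity>n\<in>{1::nat..}. u ^ n / (1 - q ^ n) - q ^ n * inverse u ^ n / (1 - q ^ n))"

definition Pfun :: "complex \<Rightarrow> complex \<Rightarrow> complex" where
  "Pfun q u = (\<Sum>\<^sub>\<infinity>n\<in>{1::nat..}. of_nat n * (u ^ n / (1 - q ^ n) + q ^ n * inverse u ^ n / (1 - q ^ n)))"

definition Tfun :: "nat \<Rightarrow> complex \<Rightarrow> complex" where
  "Tfun s q = (\<Sum>\<^sub>\<infinity>n\<in>{1::nat..}. of_nat n ^ (s - 1) * (q ^ n / (1 - q ^ n)))"

definition M_factor ::
  "'h surface \<Rightarrow> ('l \<Rightarrow> 'h) \<Rightarrow> ('l \<Rightarrow> nat) \<Rightarrow> ('l \<Rightarrow> nat) \<Rightarrow> complex \<Rightarrow> (nat \<Rightarrow> complex) \<Rightarrow> 'l \<Rightarrow> complex" where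
  "M_factor X \<alpha> d idx q x a =
    of_rat (integral\<^sub>X X (\<alpha> a)) * (Dlog ^^ d a) (Zhat q) (x (idx a) / x 0)"

definition C_factor ::
  "'h surface \<Rightarrow> ('l \<Rightarrow> 'h) \<Rightarrow> ('l \<Rightarrow> nat) \<Rightarrow> ('l \<Rightarrow> nat) \<Rightarrow> complex \<Rightarrow> (nat \<Rightarrow> complex) \<Rightarrow> 'l \<Rightarrow> 'l \<Rightarrow> complex" where
  "C_factor X \<alpha> d idx q x a b =
    - of_rat (pairing X (\<alpha> a) (\<alpha> b)) * (Dlog ^^ (d a + d b)) (Pfun q) (x (idx b) / x (idx a))"

definition L_factor ::
  "'h surface \<Rightarrow> ('l \<Rightarrow> 'h) \<Rightarrow> ('l \<Rightarrow> nat) \<Rightarrow> complex \<Rightarrow> 'l \<Rightarrow> 'l \<Rightarrow> complex" where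
  "L_factor X \<alpha> d q a b =
    - 2 * of_rat (pairing X (\<alpha> a) (\<alpha> b)) * Tfun (d a + d b + 2) q"

text \<open>
  In a pair, \<open>Min p\<close> is the label that comes first in the concatenated order, hence also the one
  in the block of smaller index if the blocks differ.
\<close>

definition partition_weight ::
  "'h surface \<Rightarrow> ('l::linorder \<Rightarrow> 'h) \<Rightarrow> ('l \<Rightarrow> nat) \<Rightarrow> ('l \<Rightarrow> nat) \<Rightarrow> complex \<Rightarrow> (nat \<Rightarrow> complex)
    \<Rightarrow> 'l set set \<Rightarrow> complex" where
  "partition_weight X \<alpha> d idx q x \<pi> =
    (\<Prod>p | p \<in> \<pi> \<and> card p = 1. M_factor X \<alpha> d idx q x (the_elem p)) *
    (\<Prod>p | p \<in> \<pi> \<and> card p = 2 \<and> idx (Min p) \<noteq> idx (Max p). C_factor X \<alpha> d idx q x (Min p) (Max p)) *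
    (\<Prod>p | p \<in> \<pi> \<and> card p = 2 \<and> idx (Min p) = idx (Max p). L_factor X \<alpha> d q (Min p) (Max p))"

end

theory Submission
  imports Defs "HOL-Complex_Analysis.Complex_Analysis" "HOL-Real_Asymp.Real_Asymp"
begin

text \<open>
  The proof rests on cyclicity of the supertrace. A mode \<open>\<a>\<^sub>m(\<alpha>)\<close> passes \<open>q\<^sup>\<n>\<close> at the cost of the
  factor \<open>q\<^sup>m\<close> and passes \<open>W\<^sub>y\<close> up to the scalar \<open>y\<^sup>m \<integral>\<alpha>\<close>, so carrying it once around the trace
  expresses \<open>(1 - q\<^sup>m) \<Omega>(\<a>\<^sub>m(\<alpha>) A)\<close> through \<open>- q\<^sup>m y\<^sup>m \<integral>\<alpha> \<Omega>(A)\<close> and the commutators of \<open>\<a>\<^sub>m(\<alpha>)\<close>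
  with the factors of \<open>A\<close>. Read as an identity of generating series over the levels of the Fock
  space, this also shows that every trace converges for \<open>|q| < 1\<close>.

  For the trace of \<open>q\<^sup>\<n> W\<^sub>y\<close> itself, the number operator is \<open>- \<Sum> \<a>\<^sub>-\<^sub>m(b) \<a>\<^sub>m(b')\<close> over dual bases, and the
  recursion becomes the differential equation \<open>t G' = \<kappa> (\<Sum> m t\<^sup>m / (1 - t\<^sup>m)) G\<close> with \<open>G(0) = 1\<close>. Its
  solution is an exponential, hence converges on the unit disc and has no zeros there.

  Inside a block, normal ordering replaces the contraction coefficient \<open>- m / (1 - q\<^sup>m)\<close> by the
  symmetric \<open>- |m| q\<^sup>|\<^sup>m\<^sup>| / (1 - q\<^sup>|\<^sup>m\<^sup>|)\<close>. The sum over modes and the sum over partitions then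
  satisfy the same recursion, obtained by removing the least label together with its partner.
\<close>

section \<open>Power series on the unit disc\<close>


text \<open>Cyclicity is a statement about finite-dimensional blocks, whereas convergence of the
  full traces is part of the claim. Hence the rotation is carried out level by level: it relates
  level k to level k - m, and 1 - q^m is this shift seen in the generating series. Dividing by 1 -
  t^m keeps convergence on the unit disc, so only the empty word needs an analytic argument.

  The symmetric coefficient comes from the order of the modes. If the least label a carries m > 0,
  the labels of its block with negative modes stand before it; bringing a to the front costs one
  plain contraction each and turns 1 / (1 - q^m) into q^m / (1 - q^m). For m < 0 no correction
  occurs, and - m / (1 - q^m) already equals - |m| q^|m| / (1 - q^|m|). Taking the least label keeps
  the correction inside one block.

  A contracted pair has modes m and - m, so differentiation leaves (-m)^d m^d', which is m^(d+d')
  for even orders. The chamber places every ratio u = x_i / y or x_j / x_i in |q| < |u| < 1, where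
  the series at u and at q / u both converge.\<close>

lemma fps_conv_radius_ge_1I:
  fixes f :: "complex fps"
  assumes "\<And>n. norm (fps_nth f n) \<le> C * real n ^ k + C"
  shows "fps_conv_radius f \<ge> 1"
  unfolding fps_conv_radius_def
proof (rule conv_radius_geI_ex')
  fix r :: real assume r: "0 < r" "ereal r < 1"
  have "summable (\<lambda>n. (C * real n ^ k + C) * r ^ n)"
  proof -
    \<comment> \<open>Any \<open>s\<close> strictly between \<open>r\<close> and 1 would do: a
      polynomial times \<open>r ^ n\<close> is dominated by \<open>s ^ n\<close>.\<close>
    define s where "s = (1 + r) / 2"
    have s: "r < s" "s < 1" using r by (auto simp: s_def)
    have "(\<lambda>n. (C * real n ^ k + C) * r ^ n) \<in> O(\<lambda>n. s ^ n)"
      using r s by real_asymp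
    moreover have "summable (\<lambda>n. norm (s ^ n))" using r s by (simp add: norm_power)
    ultimately show ?thesis by (rule summable_comparison_test_bigo[rotated])
  qed
  then show "summable (\<lambda>n. fps_nth f n * of_real r ^ n)"
  proof (rule summable_comparison_test')
    fix n :: nat
    show "norm (fps_nth f n * of_real r ^ n) \<le> (C * real n ^ k + C) * r ^ n"
      using assms[of n] r by (simp add: norm_mult norm_power mult_right_mono)
  qed
qed

lemma less_fps_conv_radius:
  "fps_conv_radius f \<ge> 1 \<Longrightarrow> norm z < 1 \<Longrightarrow> ereal (norm z) < fps_conv_radius f"
  for f :: "complex fps"
  by (metis ereal_less(3) less_le_trans)

lemma fps_conv_radius_ge_1_add:
  "fps_conv_radius f \<ge> 1 \<Longrightarrow> fps_conv_radius g \<ge> 1 \<Longrightarrow> fps_conv_radius (f + g) \<ge> 1"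
  for f g :: "complex fps"
  using fps_conv_radius_add[of f g] by (meson min.boundedI order_trans)

lemma fps_conv_radius_ge_1_mult:
  "fps_conv_radius f \<ge> 1 \<Longrightarrow> fps_conv_radius g \<ge> 1 \<Longrightarrow> fps_conv_radius (f * g) \<ge> 1"
  for f g :: "complex fps"
  using fps_conv_radius_mult[of f g] by (meson min.boundedI order_trans)

lemma fps_conv_radius_ge_1_sum:
  "(\<And>i. i \<in> I \<Longrightarrow> fps_conv_radius (f i) \<ge> 1) \<Longrightarrow> fps_conv_radius (\<Sum>i\<in>I. f i) \<ge> 1"
  for f :: "'i \<Rightarrow> complex fps"
  by (induction I rule: infinite_finite_induct) (auto intro!: fps_conv_radius_ge_1_add)

lemma eval_fps_sum_ge_1:
  fixes f :: "'i \<Rightarrow> complex fps"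
  assumes "\<And>i. i \<in> I \<Longrightarrow> fps_conv_radius (f i) \<ge> 1" "norm z < 1"
  shows "eval_fps (\<Sum>i\<in>I. f i) z = (\<Sum>i\<in>I. eval_fps (f i) z)"
  using assms
proof (induction I rule: infinite_finite_induct)
  case (insert i I)
  have "ereal (norm z) < fps_conv_radius (f i)" "ereal (norm z) < fps_conv_radius (\<Sum>i\<in>I. f i)"
    using insert.prems by (auto intro!: less_fps_conv_radius fps_conv_radius_ge_1_sum)
  then show ?case using insert by (simp add: eval_fps_add)
qed auto

text \<open>The explicit coefficients serve twice: they bound the radius of convergence, and they
  produce the divisor sums in \<open>vac_fps_ODE\<close>.\<close>

lemma inverse_one_minus_fps_X_power:
  "m > 0 \<Longrightarrow> inverse (1 - fps_X ^ m) = (Abs_fps (\<lambda>n. if m dvd n then 1 else 0) :: complex fps)"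
proof -
  assume m: "m > 0"
  define f :: "complex fps" where "f = Abs_fps (\<lambda>n. if m dvd n then 1 else 0)"
  have "(1 - fps_X ^ m) * f = 1"
  proof (rule fps_ext)
    fix n
    have "m dvd n \<longleftrightarrow> m dvd n - m" if "m \<le> n"
      using that by (metis dvd_minus_self dvd_add_right_iff dvd_refl le_add_diff_inverse)
    then show "fps_nth ((1 - fps_X ^ m) * f) n = fps_nth 1 n"
      using m by (cases "n = 0") (auto simp: f_def algebra_simps fps_X_power_mult_nth dest: dvd_imp_le)
  qed
  then show "inverse (1 - fps_X ^ m) = f"
    by (metis fps_inverse_unique)
qed

lemma fps_conv_radius_geometric: "m > 0 \<Longrightarrow> fps_conv_radius (inverse (1 - fps_X ^ m) :: complex fps) \<ge> 1"
  by (rule fps_conv_radius_ge_1I[of _ 1 0]) (auto simp: inverse_one_minus_fps_X_power)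

text \<open>The inverse of \<open>1 - fps_X ^ m\<close> converges on the unit disc, so a recursion
  for \<open>(1 - fps_X ^ m) * G\<close> passes convergence from its right side to
  \<open>G\<close>.\<close>

lemma fps_divide_one_minus_power:
  fixes G R :: "complex fps"
  assumes "m > 0" "(1 - fps_X ^ m) * G = R" "fps_conv_radius R \<ge> 1"
  shows "fps_conv_radius G \<ge> 1"
    and "norm z < 1 \<Longrightarrow> (1 - z ^ m) * eval_fps G z = eval_fps R z"
proof -
  have nz: "fps_nth (1 - fps_X ^ m :: complex fps) 0 \<noteq> 0" using assms(1) by simp
  have "G = inverse (1 - fps_X ^ m) * R"
    unfolding assms(2)[symmetric] mult.assoc[symmetric] using inverse_mult_eq_1[OF nz] by simp
  then show G: "fps_conv_radius G \<ge> 1"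
    using fps_conv_radius_ge_1_mult[OF fps_conv_radius_geometric[OF assms(1)] assms(3)] by simp
  have r: "fps_conv_radius (1 - fps_X ^ m :: complex fps) = \<infinity>"
    using fps_conv_radius_diff[of "1 :: complex fps" "fps_X ^ m"] by simp
  assume z: "norm z < 1"
  then have zG: "ereal (norm z) < fps_conv_radius G"
    using G by (intro less_fps_conv_radius)
  show "(1 - z ^ m) * eval_fps G z = eval_fps R z"
    unfolding assms(2)[symmetric] using zG r
    by (simp add: eval_fps_mult eval_fps_diff)
qed

text \<open>The solution is the exponential of a series \<open>A\<close> with
  \<open>t A' = E\<close>: the quotient of \<open>G\<close> by \<open>fps_exp 1 oo A\<close> has
  zero derivative. The radius is not read off from the formal composition; instead
  \<open>exp \<circ> eval_fps A\<close> is holomorphic on the disc, which yields both the radius and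
  the absence of zeros.\<close>

lemma fps_exponential_ODE:
  fixes G E :: "complex fps"
  assumes "fps_nth G 0 = 1" "fps_X * fps_deriv G = E * G" "\<And>n. norm (fps_nth E n) \<le> C * real n ^ k + C"
  shows "fps_conv_radius G \<ge> 1" and "norm z < 1 \<Longrightarrow> eval_fps G z \<noteq> 0"
proof -
  define A where "A = Abs_fps (\<lambda>n. fps_nth E n / of_nat n)"
  have C: "C \<ge> 0"
  proof -
    have "0 \<le> norm (fps_nth E 0)" by simp
    also have "\<dots> \<le> C * 0 ^ k + C" using assms(3)[of 0] by simp
    finally show ?thesis by (auto simp: power_0_left split: if_splits)
  qed
  \<comment> \<open>As \<open>G\<close> has constant term 1, comparing constant terms in the
    equation forces this. It is the condition for \<open>E\<close> to be of the form
    \<open>t A'\<close>.\<close>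
  have E0: "fps_nth E 0 = 0"
    using arg_cong[OF assms(2), of "\<lambda>f. fps_nth f 0"] assms(1) by (simp)
  have A: "fps_conv_radius A \<ge> 1"
  proof (rule fps_conv_radius_ge_1I[of _ C k])
    fix n
    show "norm (fps_nth A n) \<le> C * real n ^ k + C"
    proof (cases "n = 0")
      case False
      then have "norm (fps_nth A n) \<le> norm (fps_nth E n)"
        using mult_left_mono[of 1 "real n" "norm (fps_nth E n)"]
        by (simp add: A_def norm_divide divide_le_eq)
      then show ?thesis using assms(3)[of n] by simp
    qed (use C in \<open>simp add: A_def\<close>)
  qed
  have XA: "fps_X * fps_deriv A = E"
    using E0 by (intro fps_ext) (auto simp: A_def)
  define g where "g = exp \<circ> eval_fps A"
  define B where "B = fps_exp 1 oo A"
  have A0: "fps_nth A 0 = 0" by (simp add: A_def)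
  have "eval_fps A has_fps_expansion A"
    using A by (intro eval_fps_has_fps_expansion) (use less_le_trans[of 0 1 "fps_conv_radius A"] in simp)
  then have gB: "g has_fps_expansion B"
    unfolding g_def B_def
    by (intro has_fps_expansion_compose A0) (auto intro: fps_expansion_intros)
  have B0: "fps_nth B 0 = 1" by (simp add: B_def)
  have dB: "fps_X * fps_deriv B = E * B"
    using A0 XA by (simp add: B_def fps_compose_deriv ac_simps)
  have BB: "inverse B * B = 1" by (rule inverse_mult_eq_1) (simp add: B0)
  have "fps_X * fps_deriv (G * inverse B) = 0"
  proof -
    have "fps_X * fps_deriv (G * inverse B)
        = (fps_X * fps_deriv G) * inverse B - G * (fps_X * fps_deriv B) * (inverse B)\<^sup>2"
      using B0 by (simp add: fps_inverse_deriv algebra_simps)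
    also have "\<dots> = E * G * inverse B - E * G * inverse B * (inverse B * B)"
      unfolding assms(2) dB by (simp add: algebra_simps power2_eq_square)
    also have "\<dots> = 0" unfolding BB by simp
    finally show ?thesis .
  qed
  then have "fps_deriv (G * inverse B) = 0" by simp
  then have "G * inverse B = fps_const (fps_nth (G * inverse B) 0)"
    by (rule fps_deriv_eq_0_iff[THEN iffD1])
  also have "\<dots> = 1" using assms(1) B0 by simp
  finally have "G * inverse B * B = B" by simp
  then have GB: "G = B" using BB by (simp add: mult.assoc)
  have hol: "g holomorphic_on eball 0 1"
    unfolding g_def o_def using A
    by (intro holomorphic_intros) (auto simp: eball_mono)
  then show "fps_conv_radius G \<ge> 1"
    unfolding GB using holomorphic_on_imp_fps_conv_radius_ge[OF gB] by blast
  assume z: "norm z < 1"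
  have "g holomorphic_on ball 0 1" using hol by (metis eball_ereal one_ereal_def)
  from has_fps_expansion_imp_eval_fps_eq[OF gB z this]
  show "eval_fps G z \<noteq> 0" unfolding GB by (simp add: g_def)
qed

section \<open>Lambert series\<close>

text \<open>A power series in the argument with \<open>q\<close> as a parameter, so that the Euler
  operator merely raises \<open>k\<close>. \<open>Zhat\<close>, \<open>Pfun\<close> and
  \<open>Tfun\<close> are combinations of its values at \<open>u\<close>, \<open>q / u\<close> and
  \<open>q\<close>.\<close>

definition Lambert :: "nat \<Rightarrow> complex \<Rightarrow> complex fps" where
  "Lambert k q = Abs_fps (\<lambda>n. if n = 0 then 0 else of_nat n ^ k / (1 - q ^ n))"

lemma norm_one_minus_power_ge: "norm q < 1 \<Longrightarrow> n > 0 \<Longrightarrow> norm (1 - q ^ n) \<ge> 1 - norm (q :: complex)"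
proof -
  assume q: "norm q < 1" and n: "n > 0"
  have "norm q ^ n \<le> norm q ^ 1" using q n by (intro power_decreasing) auto
  then have "1 - norm q \<le> norm (1::complex) - norm (q ^ n)" by (simp add: norm_power)
  also have "\<dots> \<le> norm (1 - q ^ n)" by (rule norm_triangle_ineq2)
  finally show ?thesis .
qed

lemma one_minus_power_nonzero: "norm q < 1 \<Longrightarrow> n > 0 \<Longrightarrow> 1 - q ^ n \<noteq> (0 :: complex)"
  using norm_one_minus_power_ge[of q n] by auto

lemma Lambert_radius: "norm q < 1 \<Longrightarrow> fps_conv_radius (Lambert k q) \<ge> 1"
proof (rule fps_conv_radius_ge_1I[of _ "1 / (1 - norm q)" k])
  fix n assume q: "norm q < 1"
  show "norm (fps_nth (Lambert k q) n) \<le> 1 / (1 - norm q) * real n ^ k + 1 / (1 - norm q)"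
  proof (cases "n = 0")
    case False
    then have "norm (fps_nth (Lambert k q) n) = real n ^ k / norm (1 - q ^ n)"
      by (simp add: Lambert_def norm_divide norm_power)
    also have "\<dots> \<le> real n ^ k / (1 - norm q)"
      using norm_one_minus_power_ge[of q n] q False by (intro divide_left_mono) (auto intro!: mult_pos_pos)
    also have "\<dots> \<le> 1 / (1 - norm q) * real n ^ k + 1 / (1 - norm q)"
      using q by simp
    finally show ?thesis .
  qed (use q in \<open>simp add: Lambert_def\<close>)
qed

lemma Lambert_deriv: "fps_X * fps_deriv (Lambert k q) = Lambert (Suc k) q"
  by (intro fps_ext) (auto simp: Lambert_def)

lemma Lambert_has_sum:
  assumes "norm q < 1" "norm w < 1"
  shows "((\<lambda>n. of_nat n ^ k * w ^ n / (1 - q ^ n)) has_sum eval_fps (Lambert k q) w) {1..}"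
    and "(\<lambda>n. norm (of_nat n ^ k * w ^ n / (1 - q ^ n))) summable_on {1..}"
proof -
  have w: "ereal (norm w) < fps_conv_radius (Lambert k q)"
    by (intro less_fps_conv_radius Lambert_radius assms)
  define f where "f = (\<lambda>n. fps_nth (Lambert k q) n * w ^ n)"
  have "(f has_sum eval_fps (Lambert k q) w) UNIV"
    using norm_summable_imp_has_sum[OF norm_summable_fps[OF w] sums_eval_fps[OF w]] by (simp add: f_def)
  then have 1: "(f has_sum eval_fps (Lambert k q) w) {1..}"
    by (rule has_sum_cong_neutral[THEN iffD1, rotated -1]) (auto simp: f_def Lambert_def)
  then show "((\<lambda>n. of_nat n ^ k * w ^ n / (1 - q ^ n)) has_sum eval_fps (Lambert k q) w) {1..}"
    by (rule has_sum_cong[THEN iffD1, rotated]) (auto simp: f_def Lambert_def)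
  have "(\<lambda>n. norm (f n)) summable_on UNIV"
    using norm_summable_fps[OF w] by (intro norm_summable_imp_summable_on) (simp add: f_def)
  then have "(\<lambda>n. norm (f n)) summable_on {1..}" by (rule summable_on_subset_banach) auto
  then show "(\<lambda>n. norm (of_nat n ^ k * w ^ n / (1 - q ^ n))) summable_on {1..}"
    by (rule summable_on_cong[THEN iffD1, rotated]) (auto simp: f_def Lambert_def)
qed

lemma eval_Lambert_has_field_derivative:
  assumes "norm q < 1" "norm w < 1" "w \<noteq> 0"
  shows "(eval_fps (Lambert k q) has_field_derivative eval_fps (Lambert (Suc k) q) w / w) (at w)"
proof -
  have w: "ereal (norm w) < fps_conv_radius (Lambert k q)"
    by (intro less_fps_conv_radius Lambert_radius assms)
  then have w': "ereal (norm w) < fps_conv_radius (fps_deriv (Lambert k q))"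
    using fps_conv_radius_deriv less_le_trans by blast
  have "eval_fps (Lambert (Suc k) q) w = w * eval_fps (fps_deriv (Lambert k q)) w"
    unfolding Lambert_deriv[symmetric] using w' by (subst eval_fps_mult) auto
  then show ?thesis using has_field_derivative_eval_fps[OF w] assms(3) by simp
qed

text \<open>\<open>s\<close> is the sign in \<open>Zhat\<close> (-1) or in \<open>Pfun\<close> (+1).
  Every \<open>Dlog\<close> raises the index of both Lambert series and, by the chain rule, adds a
  sign to the one at \<open>q / u\<close>. Knowing \<open>f\<close> on the annulus is enough, since
  the annulus is open and a derivative depends only on a neighbourhood.\<close>

lemma Dlog_pow_Lambert:
  fixes f :: "complex \<Rightarrow> complex" and s :: complex
  assumes q: "norm q < 1"
    and f: "\<And>u. norm q < norm u \<Longrightarrow> norm u < 1 \<Longrightarrow>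
      f u = eval_fps (Lambert k q) u + s * eval_fps (Lambert k q) (q / u)"
    and u: "norm q < norm u" "norm u < 1"
  shows "(Dlog ^^ d) f u = eval_fps (Lambert (k + d) q) u + (-1) ^ d * s * eval_fps (Lambert (k + d) q) (q / u)"
  using u
proof (induction d arbitrary: u)
  case (Suc d)
  define A :: "complex set" where "A = {u. norm q < norm u \<and> norm u < 1}"
  have "open A"
    unfolding A_def by (intro open_Collect_conj open_Collect_less continuous_intros)
  define h where "h u = eval_fps (Lambert (k + d) q) u + (-1) ^ d * s * eval_fps (Lambert (k + d) q) (q / u)" for u
  have u0: "u \<noteq> 0" using Suc.prems by auto
  have qu: "norm (q / u) < 1" using Suc.prems u0 by (simp add: norm_divide divide_less_eq)
  have "deriv ((Dlog ^^ d) f) u = deriv h u"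
  proof (rule deriv_cong_ev)
    have "\<forall>\<^sub>F v in nhds u. v \<in> A"
      using \<open>open A\<close> Suc.prems by (intro eventually_nhds_in_open) (auto simp: A_def)
    then show "\<forall>\<^sub>F v in nhds u. (Dlog ^^ d) f v = h v"
      by eventually_elim (use Suc.IH in \<open>auto simp: A_def h_def\<close>)
  qed simp
  also have "u * deriv h u = eval_fps (Lambert (k + Suc d) q) u + (-1) ^ Suc d * s * eval_fps (Lambert (k + Suc d) q) (q / u)"
  proof (cases "q = 0")
    \<comment> \<open>Here \<open>q / v\<close> is constantly 0, outside the range of the derivative
      rule; the second series has value 0 there because \<open>Lambert\<close> has no constant
      term.\<close>
    case True
    have "(h has_field_derivative eval_fps (Lambert (Suc (k + d)) q) u / u) (at u)"
      unfolding h_def using DERIV_add[OF eval_Lambert_has_field_derivative[OF q Suc.prems(2) u0, of "k + d"] DERIV_const]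
      by (simp add: True)
    then have "u * deriv h u = eval_fps (Lambert (Suc (k + d)) q) u"
      using u0 by (simp add: DERIV_imp_deriv)
    then show ?thesis using True by (simp add: eval_fps_at_0 Lambert_def)
  next
    case False
    have 1: "((\<lambda>v. q / v) has_field_derivative - q / u\<^sup>2) (at u)"
      using u0 by (auto intro!: derivative_eq_intros simp: field_simps power2_eq_square)
    have 2: "((\<lambda>v. eval_fps (Lambert (k + d) q) (q / v)) has_field_derivative
        eval_fps (Lambert (Suc (k + d)) q) (q / u) / (q / u) * (- q / u\<^sup>2)) (at u)"
      by (rule DERIV_chain2[OF eval_Lambert_has_field_derivative 1]) (use qu False u0 q in auto)
    have "(h has_field_derivative eval_fps (Lambert (Suc (k + d)) q) u / u
        + (-1) ^ d * s * (eval_fps (Lambert (Suc (k + d)) q) (q / u) / (q / u) * (- q / u\<^sup>2))) (at u)"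
      unfolding h_def
      by (intro DERIV_add DERIV_cmult 2 eval_Lambert_has_field_derivative Suc.prems q u0)
    then have "u * deriv h u = u * (eval_fps (Lambert (Suc (k + d)) q) u / u
        + (-1) ^ d * s * (eval_fps (Lambert (Suc (k + d)) q) (q / u) / (q / u) * (- q / u\<^sup>2)))"
      by (simp add: DERIV_imp_deriv)
    also have "\<dots> = eval_fps (Lambert (Suc (k + d)) q) u - (-1) ^ d * s * eval_fps (Lambert (Suc (k + d)) q) (q / u)"
    proof -
      have "u * (e1 / u + c * (e2 / (q / u) * (- q / u\<^sup>2))) = e1 - c * e2" for c e1 e2
        using u0 False by (simp add: field_simps power2_eq_square)
      then show ?thesis .
    qed
    finally show ?thesis by simp
  qed
  finally show ?case by (simp add: Dlog_def[of "(Dlog ^^ d) f"])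
qed (use f in auto)

section \<open>Sums over the non-zero integers\<close>

lemma has_sum_nonzero_int:
  fixes f :: "int \<Rightarrow> complex"
  assumes "((\<lambda>n. f (- int n)) has_sum A) {1..}" "((\<lambda>n. f (int n)) has_sum B) {1..}"
  shows "(f has_sum (A + B)) (UNIV - {0})"
proof -
  have *: "((\<lambda>n. f (- int n)) has_sum A) {1..} \<longleftrightarrow> (f has_sum A) {..<0}"
    by (rule has_sum_reindex_bij_witness[where i="\<lambda>m. nat (- m)" and j="\<lambda>n. - int n"]) auto
  have **: "((\<lambda>n. f (int n)) has_sum B) {1..} \<longleftrightarrow> (f has_sum B) {0<..}"
    by (rule has_sum_reindex_bij_witness[where i="\<lambda>m. nat m" and j="\<lambda>n. int n"]) auto
  have "(f has_sum (A + B)) ({..<0} \<union> {0<..})"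
    using assms unfolding * ** by (intro has_sum_Un_disjoint) auto
  also have "{..<0} \<union> {0<..} = UNIV - {0 :: int}" by auto
  finally show ?thesis .
qed

lemma summable_on_nonzero_int:
  fixes f :: "int \<Rightarrow> real"
  assumes "(\<lambda>n. f (- int n)) summable_on {1..}" "(\<lambda>n. f (int n)) summable_on {1..}"
  shows "f summable_on (UNIV - {0})"
proof -
  have *: "(\<lambda>n. f (- int n)) summable_on {1..} \<longleftrightarrow> f summable_on {..<0}"
    by (rule summable_on_reindex_bij_witness[where i="\<lambda>m. nat (- m)" and j="\<lambda>n. - int n"]) auto
  have **: "(\<lambda>n. f (int n)) summable_on {1..} \<longleftrightarrow> f summable_on {0<..}"
    by (rule summable_on_reindex_bij_witness[where i="\<lambda>m. nat m" and j="\<lambda>n. int n"]) auto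
  have "f summable_on ({..<0} \<union> {0<..})"
    using assms unfolding * ** by (intro summable_on_Un_disjoint) auto
  also have "{..<0} \<union> {0<..} = UNIV - {0 :: int}" by auto
  finally show ?thesis .
qed


section \<open>Dual bases of the cohomology\<close>

context surface_cohomology
begin

lemma coh_zero: "0 \<in> coh X j"
  using coh_subspace[of j] by (rule subspace_0)

text \<open>The commutator and degree axioms speak of homogeneous classes; this induction carries
  additive consequences over to all classes.\<close>

lemma coh_induct [case_names homogeneous add]:
  assumes "\<And>j v. v \<in> coh X j \<Longrightarrow> P v" "\<And>v w. P v \<Longrightarrow> P w \<Longrightarrow> P (v + w)"
  shows "P v"
proof -
  obtain f where f: "\<And>j. f j \<in> coh X j" "v = (\<Sum>j\<le>4. f j)"
    using coh_direct_sum[of v] by auto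
  have "P (\<Sum>j\<in>J. f j)" if "finite J" for J :: "nat set"
    using that
  proof induction
    case empty
    show ?case using assms(1)[OF coh_zero] by simp
  next
    case (insert j J)
    then show ?case using assms(1)[OF f(1)[of j]] assms(2) by simp
  qed
  then show ?thesis unfolding f(2) by simp
qed

lemma integral_add: "integral\<^sub>X X (v + w) = integral\<^sub>X X v + integral\<^sub>X X w"
  and integral_smul: "integral\<^sub>X X (smul X c v) = c * integral\<^sub>X X v"
  using integral_linear by (simp_all add: Vector_Spaces.linear_iff)

lemma integral_sum: "integral\<^sub>X X (\<Sum>i\<in>I. f i) = (\<Sum>i\<in>I. integral\<^sub>X X (f i))"
proof -
  have "integral\<^sub>X X 0 = 0" using integral_add[of 0 0] by simp
  then show ?thesis by (induction I rule: infinite_finite_induct) (auto simp: integral_add)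
qed

lemma pairing_add_left: "pairing X (u + v) w = pairing X u w + pairing X v w"
  and pairing_add_right: "pairing X w (u + v) = pairing X w u + pairing X w v"
  and pairing_smul_left: "pairing X (smul X c u) w = c * pairing X u w"
  and pairing_smul_right: "pairing X w (smul X c u) = c * pairing X w u"
  using cup_linear_left cup_linear_right
  by (auto simp: pairing_def Vector_Spaces.linear_iff integral_add integral_smul)

lemma pairing_zero_right: "pairing X w 0 = 0"
  using pairing_add_right[of w 0 0] by simp

lemma pairing_zero_left: "pairing X 0 w = 0"
  using pairing_add_left[of 0 0 w] by simp

lemma pairing_sum_left: "pairing X (\<Sum>i\<in>I. f i) w = (\<Sum>i\<in>I. pairing X (f i) w)"
  by (induction I rule: infinite_finite_induct) (auto simp: pairing_add_left pairing_zero_left)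

lemma pairing_sum_right: "pairing X w (\<Sum>i\<in>I. f i) = (\<Sum>i\<in>I. pairing X w (f i))"
  by (induction I rule: infinite_finite_induct) (auto simp: pairing_add_right pairing_zero_right)

lemma pairing_unit_left: "pairing X (unit X) v = integral\<^sub>X X v"
  by (simp add: pairing_def cup_unit)

lemma pairing_unit_right: "v \<in> coh X i \<Longrightarrow> pairing X v (unit X) = integral\<^sub>X X v"
  using cup_commute[of v i "unit X" 0] unit_degree by (simp add: pairing_def cup_unit)

lemma pairing_degree: "v \<in> coh X i \<Longrightarrow> w \<in> coh X j \<Longrightarrow> pairing X v w \<noteq> 0 \<Longrightarrow> i + j = 4"
  unfolding pairing_def using cup_degree integral_degree by blast

lemma integral_unit: "integral\<^sub>X X (unit X) = 0"
  by (rule integral_degree[OF unit_degree]) simp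

text \<open>Homogeneity of both families makes the signs in \<open>number_operator\<close>
  computable. The last property is duality in the form in which it is applied: it reassembles a
  class from its pairings.\<close>

lemma homogeneous_dual_bases:
  obtains B :: "'h set" and e :: "'h \<Rightarrow> nat" and D :: "'h \<Rightarrow> 'h"
  where "finite B" "\<And>b. b \<in> B \<Longrightarrow> b \<in> coh X (e b)" "\<And>b. b \<in> B \<Longrightarrow> D b \<in> coh X (4 - e b)"
    "\<And>b. b \<in> B \<Longrightarrow> e b \<le> 4"
    "\<And>v. v = (\<Sum>b\<in>B. smul X (pairing X (D b) v) b)"
proof -
  have "\<forall>j. \<exists>A. finite A \<and> span A = coh X j" using coh_finite_dim by blast
  then obtain A where A: "\<And>j. finite (A j)" "\<And>j. span (A j) = coh X j" by metis
  obtain B where B: "B \<subseteq> (\<Union>j\<le>4. A j)" "\<not> dependent B" "(\<Union>j\<le>4. A j) \<subseteq> span B"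
    using maximal_independent_subset by blast
  have finB: "finite B" by (rule finite_subset[OF B(1)]) (use A in auto)
  have coh_B: "coh X j \<subseteq> span B" for j
  proof (cases "j \<le> 4")
    case True
    then have "A j \<subseteq> span B" using B by auto
    then show ?thesis using A(2) span_minimal[of "A j" "span B"] by auto
  next
    case False
    then show ?thesis using coh_above[of j] span_zero[of B] by simp
  qed
  have spanB: "span B = UNIV"
  proof -
    have "v \<in> span B" for v
      by (induction v rule: coh_induct) (use coh_B in \<open>auto intro: span_add\<close>)
    then show ?thesis by auto
  qed
  have "\<exists>j. j \<le> 4 \<and> b \<in> coh X j" if "b \<in> B" for b
    using that B(1) A(2) span_base by (metis UN_E atMost_iff subsetD)
  then obtain e where e: "\<And>b. b \<in> B \<Longrightarrow> e b \<le> 4" "\<And>b. b \<in> B \<Longrightarrow> b \<in> coh X (e b)" by metis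
  let ?rep = "module.representation (smul X) B"
  interpret fd: finite_dimensional_vector_space "smul X" B
    by unfold_locales (use finB B spanB in auto)
  \<comment> \<open>Recording the pairings with the basis as coordinates in that same basis gives an
    endomorphism of a finite-dimensional space. Injectivity, which is Poincare duality, then yields
    surjectivity and hence dual vectors.\<close>
  define \<Phi> where "\<Phi> c = (\<Sum>b\<in>B. smul X (pairing X c b) b)" for c
  have lin: "Vector_Spaces.linear (smul X) (smul X) \<Phi>"
    unfolding Vector_Spaces.linear_iff \<Phi>_def using vector_space_axioms
    by (auto simp: pairing_add_left pairing_smul_left scale_left_distrib sum.distrib scale_sum_right)
  have coeff: "?rep (\<Phi> c) b = pairing X c b" if "b \<in> B" for c b
  proof -
    have "?rep (\<Phi> c) b = (\<Sum>b'\<in>B. pairing X c b' * ?rep b' b)"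
      unfolding \<Phi>_def using B(2) spanB
      by (subst representation_sum) (auto simp: representation_scale)
    also have "\<dots> = (\<Sum>b'\<in>B. if b' = b then pairing X c b' else 0)"
      by (intro sum.cong) (auto simp: representation_basis B(2))
    finally show ?thesis using that finB by simp
  qed
  have rep: "(\<Sum>b\<in>B. smul X (?rep v b) b) = v" for v
    using sum_representation_eq[OF B(2) _ finB subset_refl, of v] spanB by auto
  have "inj \<Phi>"
  proof (rule injI)
    fix c c' assume eq: "\<Phi> c = \<Phi> c'"
    then have *: "pairing X c b = pairing X c' b" if "b \<in> B" for b
      using coeff[OF that] by metis
    have "pairing X (c - c') w = 0" for w
    proof -
      have "pairing X c (\<Sum>b\<in>B. smul X (?rep w b) b)
          = pairing X c' (\<Sum>b\<in>B. smul X (?rep w b) b)"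
        by (simp add: pairing_sum_right pairing_smul_right *)
      then have "pairing X c w = pairing X c' w" unfolding rep .
      then show ?thesis using pairing_add_left[of "c - c'" c' w] by simp
    qed
    then have "c - c' = 0" by (intro Poincare_duality) (simp add: pairing_def)
    then show "c = c'" by simp
  qed
  interpret fdp: finite_dimensional_vector_space_pair "smul X" B "smul X" B
    by unfold_locales
  have "surj \<Phi>" by (rule fdp.linear_injective_imp_surjective[OF lin \<open>inj \<Phi>\<close> refl])
  then obtain c where c: "\<And>v. \<Phi> (c v) = v" by (metis surjD)
  have c_pair: "pairing X (c b) b' = (if b = b' then 1 else 0)" if "b \<in> B" "b' \<in> B" for b b'
    using coeff[OF that(2), of "c b"] that by (auto simp: c representation_basis B(2))
  have "\<exists>f. (\<forall>j. f j \<in> coh X j) \<and> v = (\<Sum>j\<le>4. f j)" for v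
    using coh_direct_sum[of v] by auto
  then obtain f where f: "\<And>v j. f v j \<in> coh X j" "\<And>v. v = (\<Sum>j\<le>4. f v j)" by metis
  \<comment> \<open>\<open>c b\<close> has the right pairings but possibly mixed degree. Integration
    sees only degree 4, so its part in degree \<open>4 - e b\<close> pairs in the same way with
    basis elements of degree \<open>e b\<close> and trivially with the others.\<close>
  define D where "D b = f (c b) (4 - e b)" for b
  have D_coh: "D b \<in> coh X (4 - e b)" for b by (simp add: D_def f)
  have D_pair: "pairing X (D b) b' = (if b = b' then 1 else 0)" if b: "b \<in> B" "b' \<in> B" for b b'
  proof (cases "e b = e b'")
    case True
    have "pairing X (c b) b' = (\<Sum>j\<le>4. pairing X (f (c b) j) b')"
      by (subst f(2)[of "c b"]) (rule pairing_sum_left)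
    also have "\<dots> = (\<Sum>j\<in>{4 - e b'}. pairing X (f (c b) j) b')"
    proof (rule sum.mono_neutral_right)
      show "\<forall>j\<in>{..4} - {4 - e b'}. pairing X (f (c b) j) b' = 0"
      proof
        fix j assume j: "j \<in> {..4} - {4 - e b'}"
        show "pairing X (f (c b) j) b' = 0"
        proof (rule ccontr)
          assume "pairing X (f (c b) j) b' \<noteq> 0"
          from pairing_degree[OF f(1) e(2)[OF b(2)] this] j show False by auto
        qed
      qed
    qed auto
    finally show ?thesis using c_pair[OF b] True by (simp add: D_def)
  next
    case False
    then have "pairing X (D b) b' = 0"
      using pairing_degree[OF D_coh e(2)[OF b(2)], of b] e(1)[OF b(1)] e(1)[OF b(2)] by fastforce
    then show ?thesis using False by auto
  qed
  have D_rep: "pairing X (D b) v = ?rep v b" if b: "b \<in> B" for b v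
  proof -
    have "pairing X (D b) v = pairing X (D b) (\<Sum>b\<in>B. smul X (?rep v b) b)"
      unfolding rep ..
    also have "\<dots> = (\<Sum>b'\<in>B. ?rep v b' * pairing X (D b) b')"
      by (simp add: pairing_sum_right pairing_smul_right)
    also have "\<dots> = (\<Sum>b'\<in>B. if b = b' then ?rep v b' else 0)"
      by (intro sum.cong) (auto simp: D_pair b)
    finally show ?thesis using b finB by simp
  qed
  have "v = (\<Sum>b\<in>B. smul X (pairing X (D b) v) b)" for v
    using rep[of v, symmetric] D_rep by (metis (no_types, lifting) sum.cong)
  moreover note D_coh
  ultimately show thesis using that[of B e D] finB e by blast
qed

end

section \<open>Linear operators on the Fock space\<close>

context nakajima_fock
begin

abbreviation sc :: "complex \<Rightarrow> 'f \<Rightarrow> 'f" where "sc \<equiv> cscale F"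
abbreviation pr :: "nat \<Rightarrow> 'f \<Rightarrow> 'f" where "pr \<equiv> hilb_component F"
abbreviation cmp :: "nat \<Rightarrow> nat \<Rightarrow> 'f \<Rightarrow> 'f" where "cmp \<equiv> component F"

definition lin :: "('f \<Rightarrow> 'f) \<Rightarrow> bool" where
  "lin f \<longleftrightarrow> (\<forall>v w. f (v + w) = f v + f w) \<and> (\<forall>c v. f (sc c v) = sc c (f v))"

lemma lin_add: "lin f \<Longrightarrow> f (v + w) = f v + f w"
  and lin_scale: "lin f \<Longrightarrow> f (sc c v) = sc c (f v)"
  by (auto simp: lin_def)

lemma lin_zero: "lin f \<Longrightarrow> f 0 = 0"
  using lin_add[of f 0 0] by simp

lemma lin_sum: "lin f \<Longrightarrow> f (\<Sum>i\<in>I. g i) = (\<Sum>i\<in>I. f (g i))"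
  by (induction I rule: infinite_finite_induct) (auto simp: lin_zero lin_add)

lemma lin_minus: "lin f \<Longrightarrow> f (- v) = - f v"
  using lin_add[of f v "- v"] lin_zero[of f] by (simp add: eq_neg_iff_add_eq_0 add.commute)

lemma lin_nak: "m \<noteq> 0 \<Longrightarrow> lin (nak F m \<alpha>)"
  using nak_linear[of m \<alpha>] by (simp add: lin_def Vector_Spaces.linear_iff)

lemma lin_compose: "lin f \<Longrightarrow> lin g \<Longrightarrow> lin (\<lambda>v. f (g v))"
  by (simp add: lin_def)

lemma lin_scale_fun: "lin f \<Longrightarrow> lin (\<lambda>v. sc c (f v))"
  by (simp add: lin_def fock.scale_right_distrib mult.commute)

lemma lin_add_fun: "lin f \<Longrightarrow> lin g \<Longrightarrow> lin (\<lambda>v. f v + g v)"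
  unfolding lin_def by (simp add: fock.scale_right_distrib add_ac)

lemma lin_zero_fun: "lin (\<lambda>v. 0)"
  by (simp add: lin_def)

lemma lin_sum_fun: "(\<And>i. i \<in> I \<Longrightarrow> lin (f i)) \<Longrightarrow> lin (\<lambda>v. \<Sum>i\<in>I. f i v)"
  by (induction I rule: infinite_finite_induct) (auto intro!: lin_add_fun simp: lin_zero_fun)

lemma lin_id: "lin (\<lambda>v. v)"
  by (simp add: lin_def)

lemma lin_funpow: "lin f \<Longrightarrow> lin (f ^^ r)"
  by (induction r) (auto simp: lin_def)

section \<open>Grading\<close>

lemma hilb_0: "0 \<in> hilb F n j"
  using hilb_subspace by (rule fock.subspace_0)

lemma hilb_add: "v \<in> hilb F n j \<Longrightarrow> w \<in> hilb F n j \<Longrightarrow> v + w \<in> hilb F n j"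
  using hilb_subspace by (rule fock.subspace_add)

lemma hilb_scale: "v \<in> hilb F n j \<Longrightarrow> sc c v \<in> hilb F n j"
  using hilb_subspace by (rule fock.subspace_scale)

lemma component_mem: "cmp n j v \<in> hilb F n j"
  and finite_components: "finite {p. cmp (fst p) (snd p) v \<noteq> 0}"
  and sum_components: "v = (\<Sum>p | cmp (fst p) (snd p) v \<noteq> 0. cmp (fst p) (snd p) v)"
  using theI'[OF hilb_direct_sum[of v]]
  by (auto simp: component_def dest: spec[of _ "(n, j)"])

text \<open>Uniqueness of the decomposition resolves the definite description in
  \<open>component\<close>. \<open>P\<close> may be any finite set containing the support, so that
  two decompositions can be summed over a common set.\<close>

lemma component_eqI:
  assumes "\<And>n j. f (n, j) \<in> hilb F n j" "finite P" "\<And>p. p \<notin> P \<Longrightarrow> f p = 0" "v = (\<Sum>p\<in>P. f p)"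
  shows "cmp n j v = f (n, j)"
proof -
  have 1: "\<forall>p. f p \<in> hilb F (fst p) (snd p)" using assms(1) by auto
  have 2: "{p. f p \<noteq> 0} \<subseteq> P" using assms(3) by auto
  then have 3: "v = (\<Sum>p | f p \<noteq> 0. f p)"
    unfolding assms(4) using assms(2) by (intro sum.mono_neutral_right) auto
  have "(THE f. (\<forall>p. f p \<in> hilb F (fst p) (snd p)) \<and> finite {p. f p \<noteq> 0}
        \<and> v = (\<Sum>p | f p \<noteq> 0. f p)) = f"
    by (rule the1_equality[OF hilb_direct_sum]) (use 1 2 3 assms(2) finite_subset in blast)
  then show ?thesis by (simp add: component_def)
qed

lemma lin_component: "lin (cmp n j)"
  unfolding lin_def
proof (intro conjI allI)
  define S where "S v = {p. cmp (fst p) (snd p) v \<noteq> 0}" for v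
  have sumS: "v = (\<Sum>p\<in>P. cmp (fst p) (snd p) v)" if "finite P" "S v \<subseteq> P" for v P
    by (rule trans[OF sum_components sum.mono_neutral_left]) (use that in \<open>auto simp: S_def\<close>)
  have fin: "finite (S v)" for v
    unfolding S_def by (rule finite_components)
  fix v w
  show "cmp n j (v + w) = cmp n j v + cmp n j w"
  proof (subst component_eqI[where f = "\<lambda>p. cmp (fst p) (snd p) v + cmp (fst p) (snd p) w" and P = "S v \<union> S w"])
    show "v + w = (\<Sum>p\<in>S v \<union> S w. cmp (fst p) (snd p) v + cmp (fst p) (snd p) w)"
      unfolding sum.distrib by (intro arg_cong2[where f = "(+)"] sumS) (use fin in auto)
  qed (use fin in \<open>auto simp: S_def component_mem hilb_add\<close>)
  fix c
  show "cmp n j (sc c v) = sc c (cmp n j v)"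
  proof (subst component_eqI[where f = "\<lambda>p. sc c (cmp (fst p) (snd p) v)" and P = "S v"])
    show "sc c v = (\<Sum>p\<in>S v. sc c (cmp (fst p) (snd p) v))"
      unfolding fock.scale_sum_right[symmetric] by (intro arg_cong[where f = "sc c"] sumS) (use fin in auto)
  qed (use fin in \<open>auto simp: S_def component_mem hilb_scale\<close>)
qed

lemma component_hilb: "v \<in> hilb F k i \<Longrightarrow> cmp n j v = (if n = k \<and> j = i then v else 0)"
  by (subst component_eqI[where f = "\<lambda>p. if p = (k, i) then v else 0" and P = "{(k, i)}"])
     (auto simp: hilb_0)

lemma component_above: "4 * n < j \<Longrightarrow> cmp n j v = 0"
  using component_mem[of n j v] hilb_above[of n j] by simp

lemma hilb_induct [case_names homogeneous add]:
  assumes "\<And>n j v. v \<in> hilb F n j \<Longrightarrow> P v" "\<And>v w. P v \<Longrightarrow> P w \<Longrightarrow> P (v + w)"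
  shows "P v"
proof -
  have "P (\<Sum>p\<in>J. cmp (fst p) (snd p) v)" if "finite J" for J
    using that
  proof induction
    case empty
    show ?case using assms(1)[OF hilb_0] by simp
  next
    case (insert j J)
    then show ?case by (simp add: assms(2) assms(1)[OF component_mem])
  qed
  from this[of "{p. cmp (fst p) (snd p) v \<noteq> 0}", OF finite_components] show ?thesis
    unfolding sum_components[of v, symmetric] .
qed

lemma eq_by_components: "(\<And>n j. cmp n j v = cmp n j w) \<Longrightarrow> v = w"
proof -
  assume *: "\<And>n j. cmp n j v = cmp n j w"
  show "v = w"
    by (rule trans[OF sum_components trans[OF _ sum_components[symmetric]]]) (simp add: *)
qed

lemma lin_pr: "lin (pr n)"
  unfolding hilb_component_def by (intro lin_sum_fun lin_component)

lemma component_pr: "cmp n j (pr k v) = (if n = k then cmp n j v else 0)"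
proof -
  have "cmp n j (pr k v) = (\<Sum>i\<le>4 * k. cmp n j (cmp k i v))"
    unfolding hilb_component_def by (rule lin_sum[OF lin_component])
  also have "\<dots> = (\<Sum>i\<le>4 * k. if n = k \<and> j = i then cmp k i v else 0)"
    by (intro sum.cong refl component_hilb component_mem)
  also have "\<dots> = (if n = k then cmp n j v else 0)"
    using component_above[of n j v] by (cases "n = k") auto
  finally show ?thesis .
qed

lemma pr_pr: "pr n (pr k v) = (if n = k then pr n v else 0)"
  by (rule eq_by_components) (auto simp: component_pr lin_zero[OF lin_component])

lemma pr_hilb: "v \<in> hilb F k j \<Longrightarrow> pr n v = (if n = k then v else 0)"
  by (rule eq_by_components) (auto simp: component_pr component_hilb lin_zero[OF lin_component])

text \<open>This bound makes the annihilation exponential a finite sum on each vector.\<close>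

lemma pr_bound_exists: "\<exists>K. \<forall>n>K. pr n v = 0"
proof (induction v rule: hilb_induct)
  case (homogeneous n j v)
  then show ?case by (auto simp: pr_hilb)
next
  case (add v w)
  then obtain K L where "\<forall>n>K. pr n v = 0" "\<forall>n>L. pr n w = 0" by blast
  then have "\<forall>n>max K L. pr n (v + w) = 0" by (simp add: lin_add[OF lin_pr])
  then show ?case by blast
qed

lemma nak_class_zero: "m \<noteq> 0 \<Longrightarrow> nak F m 0 v = 0"
  using nak_add[of m 0 0 v] by simp

lemma nak_class_sum: "m \<noteq> 0 \<Longrightarrow> nak F m (\<Sum>i\<in>I. f i) v = (\<Sum>i\<in>I. nak F m (f i) v)"
  by (induction I rule: infinite_finite_induct) (auto simp: nak_add nak_class_zero)

lemma component_span:
  assumes "w \<in> fock.span (\<Union>i\<in>S. hilb F k i)" "\<not> (n = k \<and> j \<in> S)"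
  shows "cmp n j w = 0"
  using assms(1)
proof (induction rule: fock.span_induct)
  case base
  show ?case unfolding fock.subspace_def
    by (simp add: lin_add[OF lin_component] lin_scale[OF lin_component] lin_zero[OF lin_component])
next
  case (step x)
  then show ?case using assms(2) by (auto simp: component_hilb)
qed

lemma nak_parity:
  assumes "m \<noteq> 0" "\<alpha> \<in> coh X i" "v \<in> hilb F k j" "cmp n l (nak F m \<alpha> v) \<noteq> 0"
  shows "even (l + i + j)" "int n = int k - m"
proof -
  have m: "m \<le> int k"
    using nak_kill[OF assms(3), of m \<alpha>] assms(4) by (force simp: lin_zero[OF lin_component])
  have "n = nat (int k - m) \<and> l \<in> {l. even (l + i + j)}"
    using component_span[OF nak_grading[OF assms(1-3) m]] assms(4) by blast
  then show "even (l + i + j)" "int n = int k - m" using m by auto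
qed

lemma pr_nak:
  assumes m: "m \<noteq> 0"
  shows "pr n (nak F m \<alpha> v) = (if 0 \<le> int n + m then nak F m \<alpha> (pr (nat (int n + m)) v) else 0)"
proof (induction v rule: hilb_induct)
  case (homogeneous k j v)
  show ?case
  proof (induction \<alpha> rule: coh_induct)
    case (homogeneous i \<alpha>)
    have *: "cmp l r (nak F m \<alpha> v) = 0" if "int l \<noteq> int k - m" for l r
      using nak_parity(2)[OF m homogeneous \<open>v \<in> hilb F k j\<close>] that by blast
    have "pr n (nak F m \<alpha> v) = (if int n + m = int k then nak F m \<alpha> v else 0)"
    proof (rule eq_by_components)
      fix l r
      show "cmp l r (pr n (nak F m \<alpha> v)) = cmp l r (if int n + m = int k then nak F m \<alpha> v else 0)"
        by (cases "int l = int k - m") (auto simp: component_pr * lin_zero[OF lin_component])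
    qed
    also have "\<dots> = (if 0 \<le> int n + m then nak F m \<alpha> (pr (nat (int n + m)) v) else 0)"
      using \<open>v \<in> hilb F k j\<close> m by (auto simp: pr_hilb lin_zero[OF lin_nak])
    finally show ?case .
  next
    case (add \<alpha> \<beta>)
    then show ?case using m by (simp add: nak_add lin_add[OF lin_pr])
  qed
next
  case (add v w)
  then show ?case using m by (simp add: lin_add[OF lin_pr] lin_add[OF lin_nak])
qed

section \<open>Supertrace\<close>

text \<open>The same choice as in \<open>block_trace\<close>, so that unfolding identifies the two
  traces without a comparison of bases.\<close>

definition Bs :: "nat \<Rightarrow> nat \<Rightarrow> 'f set" where
  "Bs n j = (SOME B. \<not> fock.dependent B \<and> fock.span B = hilb F n j)"

lemma Bs: "\<not> fock.dependent (Bs n j)" "fock.span (Bs n j) = hilb F n j" "finite (Bs n j)"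
proof -
  obtain C where C: "finite C" "fock.span C = hilb F n j" using hilb_finite_dim by blast
  obtain B where B: "B \<subseteq> C" "\<not> fock.dependent B" "C \<subseteq> fock.span B"
    using fock.maximal_independent_subset by blast
  then have "fock.span B = fock.span C"
    by (intro antisym fock.span_mono fock.span_minimal) auto
  then have "\<exists>B. \<not> fock.dependent B \<and> fock.span B = hilb F n j"
    using B(2) C(2) by auto
  then have *: "\<not> fock.dependent (Bs n j) \<and> fock.span (Bs n j) = hilb F n j"
    unfolding Bs_def by (rule someI_ex)
  then show "\<not> fock.dependent (Bs n j)" "fock.span (Bs n j) = hilb F n j" by auto
  have "Bs n j \<subseteq> fock.span C" using * C(2) fock.span_superset by blast
  then show "finite (Bs n j)" using fock.independent_span_bound[OF C(1)] * by blast
qed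

lemma Bs_hilb: "b \<in> Bs n j \<Longrightarrow> b \<in> hilb F n j"
  using Bs(2) fock.span_base by blast

definition cf :: "nat \<Rightarrow> nat \<Rightarrow> 'f \<Rightarrow> 'f \<Rightarrow> complex" where
  "cf n j b v = fock.representation (Bs n j) (cmp n j v) b"

lemma cf_add: "cf n j b (v + w) = cf n j b v + cf n j b w"
  unfolding cf_def lin_add[OF lin_component]
  by (subst fock.representation_add) (auto simp: Bs component_mem)

lemma cf_scale: "cf n j b (sc c v) = c * cf n j b v"
  unfolding cf_def lin_scale[OF lin_component]
  by (subst fock.representation_scale) (auto simp: Bs component_mem)

lemma cf_zero: "cf n j b 0 = 0"
  using cf_add[of n j b 0 0] by simp

lemma cf_sum: "cf n j b (\<Sum>i\<in>I. f i) = (\<Sum>i\<in>I. cf n j b (f i))"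
  by (induction I rule: infinite_finite_induct) (auto simp: cf_zero cf_add)

definition Is :: "nat \<Rightarrow> (nat \<times> 'f) set" where
  "Is n = Sigma {..4 * n} (Bs n)"

lemma sum_Is: "(\<Sum>p\<in>Is n. h (fst p) (snd p)) = (\<Sum>j\<le>4 * n. \<Sum>b\<in>Bs n j. h j b)"
  unfolding Is_def by (subst sum.Sigma) (auto simp: Bs case_prod_beta)

lemma pr_expansion: "pr n v = (\<Sum>p\<in>Is n. sc (cf n (fst p) (snd p) v) (snd p))"
proof -
  have "(\<Sum>b\<in>Bs n j. sc (cf n j b v) b) = cmp n j v" for j
    unfolding cf_def
    by (rule fock.sum_representation_eq) (auto simp: Bs component_mem)
  then show ?thesis
    unfolding hilb_component_def sum_Is[where h = "\<lambda>j b. sc (cf n j b v) b"] by simp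
qed

definition Str :: "nat \<Rightarrow> ('f \<Rightarrow> 'f) \<Rightarrow> complex" where
  "Str n g = (\<Sum>p\<in>Is n. (-1) ^ fst p * cf n (fst p) (snd p) (g (snd p)))"

lemma hilb_supertrace_eq: "hilb_supertrace F A n = Str n (\<lambda>v. A v n)"
proof -
  have "block_trace F n j g = (\<Sum>b\<in>Bs n j. cf n j b (g b))" for j g
    unfolding block_trace_def Bs_def cf_def Let_def ..
  then show ?thesis
    unfolding hilb_supertrace_def Str_def sum_Is[where h = "\<lambda>j b. (-1) ^ j * cf n j b (A b n)"]
    by (simp add: sum_distrib_left)
qed

lemma Is_hilb: "p \<in> Is n \<Longrightarrow> snd p \<in> hilb F n (fst p)"
  by (auto simp: Is_def Bs_hilb)

lemma Str_cong: "(\<And>j v. v \<in> hilb F n j \<Longrightarrow> f v = g v) \<Longrightarrow> Str n f = Str n g"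
  unfolding Str_def by (intro sum.cong) (auto dest: Is_hilb)

lemma Str_add: "Str n (\<lambda>v. f v + g v) = Str n f + Str n g"
  by (simp add: Str_def cf_add algebra_simps sum.distrib)

lemma Str_scale: "Str n (\<lambda>v. sc c (f v)) = c * Str n f"
  by (simp add: Str_def cf_scale algebra_simps sum_distrib_left)

lemma Str_zero: "Str n (\<lambda>v. 0) = 0"
  by (simp add: Str_def cf_zero)

lemma Str_sum: "Str n (\<lambda>v. \<Sum>i\<in>I. f i v) = (\<Sum>i\<in>I. Str n (f i))"
  by (induction I rule: infinite_finite_induct) (auto simp: Str_zero Str_add)

text \<open>Both sides are the double sum of products of matrix entries of \<open>f\<close> and
  \<open>g\<close>; the level hypotheses say that the two maps go between levels \<open>n\<close>
  and \<open>k\<close>. Where an entry of \<open>f\<close> is nonzero, the degrees at its two ends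
  differ by \<open>p\<close> modulo 2, so the parity of \<open>f\<close> alone accounts for the sign
  \<open>(-1) ^ p\<close>.\<close>

lemma Str_cyclic:
  assumes f: "lin f" and g: "lin g"
    and f_level: "\<And>j v. v \<in> hilb F n j \<Longrightarrow> pr k (f v) = f v"
    and f_parity: "\<And>j v i. v \<in> hilb F n j \<Longrightarrow> cmp k i (f v) \<noteq> 0 \<Longrightarrow> even (i + p + j)"
    and g_level: "\<And>i w. w \<in> hilb F k i \<Longrightarrow> pr n (g w) = g w"
  shows "Str n (\<lambda>v. g (f v)) = (-1) ^ p * Str k (\<lambda>w. f (g w))"
proof -
  define a :: "nat \<times> 'f \<Rightarrow> nat \<times> 'f \<Rightarrow> complex" where "a s t = cf k (fst t) (snd t) (f (snd s))" for s t
  define b :: "nat \<times> 'f \<Rightarrow> nat \<times> 'f \<Rightarrow> complex" where "b t s = cf n (fst s) (snd s) (g (snd t))" for s t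
  have 1: "cf n (fst s) (snd s) (g (f (snd s))) = (\<Sum>t\<in>Is k. a s t * b t s)" if "s \<in> Is n" for s
  proof -
    have "f (snd s) = (\<Sum>t\<in>Is k. sc (a s t) (snd t))"
      unfolding a_def using pr_expansion[of k "f (snd s)"] f_level[OF Is_hilb[OF that]] by simp
    then have "g (f (snd s)) = (\<Sum>t\<in>Is k. sc (a s t) (g (snd t)))"
      by (simp add: lin_sum[OF g] lin_scale[OF g])
    then show ?thesis by (simp add: cf_sum cf_scale b_def)
  qed
  have 2: "cf k (fst t) (snd t) (f (g (snd t))) = (\<Sum>s\<in>Is n. b t s * a s t)" if "t \<in> Is k" for t
  proof -
    have "g (snd t) = (\<Sum>s\<in>Is n. sc (b t s) (snd s))"
      unfolding b_def using pr_expansion[of n "g (snd t)"] g_level[OF Is_hilb[OF that]] by simp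
    then have "f (g (snd t)) = (\<Sum>s\<in>Is n. sc (b t s) (f (snd s)))"
      by (simp add: lin_sum[OF f] lin_scale[OF f])
    then show ?thesis by (simp add: cf_sum cf_scale a_def)
  qed
  have sgn: "(-1) ^ fst s * (a s t * b t s) = (-1) ^ p * ((-1) ^ fst t * (b t s * a s t))"
    if s: "s \<in> Is n" and t: "t \<in> Is k" for s t
  proof (cases "a s t = 0")
    case False
    then have "cmp k (fst t) (f (snd s)) \<noteq> 0"
      unfolding a_def cf_def by (metis fock.representation_zero)
    from f_parity[OF Is_hilb[OF s] this]
    have "even (fst s) \<longleftrightarrow> even (p + fst t)" by auto
    then have "(-1::complex) ^ fst s = (-1) ^ (p + fst t)" by (simp add: uminus_power_if)
    then show ?thesis by (simp add: power_add)
  qed simp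
  have "Str n (\<lambda>v. g (f v)) = (\<Sum>s\<in>Is n. \<Sum>t\<in>Is k. (-1) ^ fst s * (a s t * b t s))"
    unfolding Str_def by (intro sum.cong refl) (simp add: 1 sum_distrib_left)
  also have "\<dots> = (\<Sum>s\<in>Is n. \<Sum>t\<in>Is k. (-1) ^ p * ((-1) ^ fst t * (b t s * a s t)))"
    by (intro sum.cong refl sgn)
  also have "\<dots> = (\<Sum>t\<in>Is k. \<Sum>s\<in>Is n. (-1) ^ p * ((-1) ^ fst t * (b t s * a s t)))"
    by (rule sum.swap)
  also have "\<dots> = (-1) ^ p * Str k (\<lambda>w. f (g w))"
    unfolding Str_def sum_distrib_left by (intro sum.cong refl) (simp add: 2 sum_distrib_left)
  finally show ?thesis .
qed

end


section \<open>Commutation with the vertex operator\<close>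

lemma positive_list_bounds:
  fixes ns :: "nat list"
  assumes "0 \<notin> set ns"
  shows "length ns \<le> sum_list ns" "set ns \<subseteq> {1..sum_list ns}"
proof -
  show "length ns \<le> sum_list ns"
    using assms by (induction ns) (auto simp: Suc_le_eq)
  show "set ns \<subseteq> {1..sum_list ns}"
    using assms member_le_sum_list[of _ ns] by (auto simp: Suc_le_eq intro!: Nat.gr0I)
qed

context nakajima_fock
begin

text \<open>Expanding the power of a sum of operators, without commuting them, produces each word of
  length \<open>r\<close> once. This turns the word sums of \<open>exp_term\<close> back into powers
  of one operator.\<close>

lemma sum_lists_foldr:
  assumes "finite A" "\<And>n. n \<in> A \<Longrightarrow> lin (g n)"
  shows "(\<Sum>ns | set ns \<subseteq> A \<and> length ns = r. foldr g ns v) = ((\<lambda>w. \<Sum>n\<in>A. g n w) ^^ r) v"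
proof (induction r)
  case 0
  have "{ns. set ns \<subseteq> A \<and> length ns = 0} = {[]}" by auto
  then show ?case by simp
next
  case (Suc r)
  let ?L = "{ns. set ns \<subseteq> A \<and> length ns = r}"
  have "(\<Sum>ns | set ns \<subseteq> A \<and> length ns = Suc r. foldr g ns v) = (\<Sum>(ns, n)\<in>?L \<times> A. foldr g (n # ns) v)"
    unfolding lists_length_Suc_eq by (subst sum.reindex) (auto simp: inj_on_def case_prod_beta)
  also have "\<dots> = (\<Sum>ns\<in>?L. \<Sum>n\<in>A. g n (foldr g ns v))"
    by (simp add: sum.cartesian_product)
  also have "\<dots> = (\<Sum>n\<in>A. \<Sum>ns\<in>?L. g n (foldr g ns v))"
    by (rule sum.swap)
  also have "\<dots> = (\<Sum>n\<in>A. g n (\<Sum>ns\<in>?L. foldr g ns v))"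
    by (intro sum.cong refl lin_sum[symmetric] assms)
  finally show ?case by (simp add: Suc)
qed

text \<open>
  On a vector (or component) of bounded level an exponential is determined by the modes up to
  \<open>K\<close> and the words up to length \<open>R\<close>, for all sufficiently large \<open>K\<close> and \<open>R\<close>.
\<close>

definition truncated_exp :: "nat \<Rightarrow> nat \<Rightarrow> (nat \<Rightarrow> 'f \<Rightarrow> 'f) \<Rightarrow> 'f \<Rightarrow> 'f" where
  "truncated_exp K R g v = (\<Sum>r\<le>R. sc (1 / fact r) (((\<lambda>w. \<Sum>n\<in>{1..K}. g n w) ^^ r) v))"

lemma lin_truncated_exp: "(\<And>n. n \<in> {1..K} \<Longrightarrow> lin (g n)) \<Longrightarrow> lin (truncated_exp K R g)"
  unfolding truncated_exp_def by (intro lin_sum_fun lin_scale_fun lin_funpow) auto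

text \<open>\<open>p\<close> is the identity for the annihilation exponential and the projection to
  one level for the creation exponential, which is finite only after projection.\<close>

lemma Sum_any_exp_term:
  assumes g: "\<And>n. n > 0 \<Longrightarrow> lin (g n)" and p: "lin p"
    and supp: "\<And>ns. 0 \<notin> set ns \<Longrightarrow> p (foldr g ns v) \<noteq> 0 \<Longrightarrow> set ns \<subseteq> {1..K} \<and> length ns \<le> R"
  shows "Sum_any (\<lambda>ns. p (exp_term F g ns v)) = p (truncated_exp K R g v)"
proof -
  let ?L = "\<lambda>r. {ns. set ns \<subseteq> {1..K} \<and> length ns = r}"
  have tm: "exp_term F g ns v = sc (1 / fact r) (foldr g ns v)" if "ns \<in> ?L r" for ns r
    using that by (auto simp: exp_term_def)
  have un: "{ns. set ns \<subseteq> {1..K} \<and> length ns \<le> R} = (\<Union>r\<in>{..R}. ?L r)" by auto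
  have "Sum_any (\<lambda>ns. p (exp_term F g ns v)) = (\<Sum>ns | set ns \<subseteq> {1..K} \<and> length ns \<le> R. p (exp_term F g ns v))"
  proof (rule Sum_any.expand_superset)
    show "{ns. p (exp_term F g ns v) \<noteq> 0} \<subseteq> {ns. set ns \<subseteq> {1..K} \<and> length ns \<le> R}"
    proof safe
      fix ns assume "p (exp_term F g ns v) \<noteq> 0"
      then have "0 \<notin> set ns" "p (foldr g ns v) \<noteq> 0"
        by (auto simp: exp_term_def lin_zero[OF p] lin_scale[OF p] split: if_splits)
      note supp[OF this]
      then show "n \<in> {1..K}" if "n \<in> set ns" for n using that by auto
      show "length ns \<le> R" using \<open>set ns \<subseteq> {1..K} \<and> length ns \<le> R\<close> by simp
    qed
  qed (rule finite_lists_length_le, simp)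
  also have "\<dots> = (\<Sum>r\<le>R. \<Sum>ns\<in>?L r. p (exp_term F g ns v))"
    unfolding un by (rule sum.UNION_disjoint) (auto intro: finite_lists_length_eq)
  also have "\<dots> = (\<Sum>r\<le>R. \<Sum>ns\<in>?L r. p (sc (1 / fact r) (foldr g ns v)))"
    by (intro sum.cong refl arg_cong[where f = p] tm)
  also have "\<dots> = p (\<Sum>r\<le>R. sc (1 / fact r) (\<Sum>ns\<in>?L r. foldr g ns v))"
    by (simp add: lin_sum[OF p] fock.scale_sum_right)
  also have "\<dots> = p (truncated_exp K R g v)"
    unfolding truncated_exp_def
    by (intro arg_cong[where f = p] sum.cong refl arg_cong[where f = "sc _"] sum_lists_foldr) (auto intro: g)
  finally show ?thesis .
qed

text \<open>If the sum \<open>T\<close> satisfies \<open>[T, a] = \<beta>\<close> with a scalar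
  \<open>\<beta>\<close>, then \<open>[T ^^ r, a] = r \<beta> T ^^ (r - 1)\<close>, and division by
  \<open>r!\<close> shifts the index. Hence the commutator term is truncated one step
  earlier.\<close>

lemma truncated_exp_commute:
  assumes g: "\<And>n. n \<in> {1..K} \<Longrightarrow> lin (g n)" and a: "lin a"
    and comm: "\<And>w. (\<Sum>n\<in>{1..K}. g n (a w)) = a (\<Sum>n\<in>{1..K}. g n w) + sc \<beta> w"
  shows "truncated_exp K (Suc R) g (a w) = a (truncated_exp K (Suc R) g w) + sc \<beta> (truncated_exp K R g w)"
proof -
  define T where "T w = (\<Sum>n\<in>{1..K}. g n w)" for w
  have T: "lin T" unfolding T_def by (intro lin_sum_fun g)
  have pow: "(T ^^ r) (a w) = a ((T ^^ r) w) + sc (of_nat r * \<beta>) ((T ^^ (r - 1)) w)" for r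
  proof (induction r)
    case (Suc r)
    have "(T ^^ Suc r) (a w) = T (a ((T ^^ r) w)) + sc (of_nat r * \<beta>) (T ((T ^^ (r - 1)) w))"
      by (simp add: Suc lin_add[OF T] lin_scale[OF T])
    also have "T (a ((T ^^ r) w)) = a ((T ^^ Suc r) w) + sc \<beta> ((T ^^ r) w)"
      using comm[of "(T ^^ r) w"] by (simp add: T_def)
    also have "sc (of_nat r * \<beta>) (T ((T ^^ (r - 1)) w)) = sc (of_nat r * \<beta>) ((T ^^ r) w)"
      by (cases r) auto
    moreover have "sc \<beta> e + sc (of_nat r * \<beta>) e = sc (of_nat (Suc r) * \<beta>) e" for e
      by (simp add: fock.scale_left_distrib ring_distribs)
    ultimately show ?case by (simp only: add.assoc diff_Suc_1)
  qed (simp add: fock.scale_zero_left)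
  have te: "truncated_exp K S g v = (\<Sum>r\<le>S. sc (1 / fact r) ((T ^^ r) v))" for S v
    by (simp add: truncated_exp_def T_def[abs_def])
  have "truncated_exp K (Suc R) g (a w) = a (truncated_exp K (Suc R) g w)
      + (\<Sum>r\<le>Suc R. sc (1 / fact r) (sc (of_nat r * \<beta>) ((T ^^ (r - 1)) w)))"
    unfolding te by (simp only: pow fock.scale_right_distrib sum.distrib lin_sum[OF a] lin_scale[OF a])
  also have "(\<Sum>r\<le>Suc R. sc (1 / fact r) (sc (of_nat r * \<beta>) ((T ^^ (r - 1)) w)))
      = (\<Sum>r\<le>R. sc \<beta> (sc (1 / fact r) ((T ^^ r) w)))"
  proof -
    have "1 / fact (Suc r) * (of_nat (Suc r) * \<beta>) = \<beta> * (1 / fact r)" for r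
      unfolding fact_Suc of_nat_mult using of_nat_neq_0[of r, where ?'a = complex]
      by (simp add: field_simps del: of_nat_Suc)
    then show ?thesis
      by (subst sum.atMost_Suc_shift) (simp only: fock.scale_scale of_nat_0 mult_zero_left mult_zero_right fock.scale_zero_left fock.scale_zero_right diff_Suc_1 add_0)
  qed
  finally show ?thesis by (simp add: te fock.scale_sum_right)
qed

lemma nak_unit_commute:
  assumes "m \<noteq> 0" "l \<noteq> 0" "\<alpha> \<in> coh X i"
  shows "nak F m (unit X) (nak F l \<alpha> w) = nak F l \<alpha> (nak F m (unit X) w)
    + sc (if m = - l then - of_int m * of_rat (integral\<^sub>X X \<alpha>) else 0) w"
  using nak_commutator[OF assms(1,2) unit_degree assms(3), of w]
  by (simp add: pairing_unit_left algebra_simps split: if_splits)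

lemma eq_0_by_pr: "(\<And>n. pr n v = 0) \<Longrightarrow> v = 0"
proof (rule eq_by_components)
  fix n j assume "\<And>n. pr n v = 0"
  then have "cmp n j (pr n v) = cmp n j 0" by simp
  then show "cmp n j v = cmp n j 0" by (simp add: component_pr)
qed

lemma vac_hilb: "vac F \<in> hilb F 0 0"
  unfolding hilb_zero by (rule fock.span_base) simp

context
  fixes y :: complex
  assumes y: "y \<noteq> 0"
begin

definition ann :: "nat \<Rightarrow> 'f \<Rightarrow> 'f" where
  "ann n w = sc (- (1 / (of_nat n * y ^ n))) (nak F (int n) (unit X) w)"

definition cre :: "nat \<Rightarrow> 'f \<Rightarrow> 'f" where
  "cre n w = sc (y ^ n / of_nat n) (nak F (- int n) (unit X) w)"

lemma lin_ann: "n > 0 \<Longrightarrow> lin (ann n)"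
  unfolding ann_def by (intro lin_scale_fun lin_nak) simp

lemma lin_cre: "n > 0 \<Longrightarrow> lin (cre n)"
  unfolding cre_def by (intro lin_scale_fun lin_nak) simp

lemma pr_foldr_ann:
  "0 \<notin> set ns \<Longrightarrow> pr k (foldr ann ns v) = foldr ann ns (pr (k + sum_list ns) v)"
proof (induction ns arbitrary: k)
  case (Cons n ns)
  then have "pr k (foldr ann (n # ns) v) = ann n (pr (k + n) (foldr ann ns v))"
    by (auto simp: ann_def lin_minus[OF lin_pr] lin_scale[OF lin_pr] pr_nak nat_add_distrib)
  then show ?case using Cons by (simp add: add.assoc)
qed simp

lemma pr_foldr_cre:
  "0 \<notin> set ns \<Longrightarrow> pr k (foldr cre ns v) = (if sum_list ns \<le> k then foldr cre ns (pr (k - sum_list ns) v) else 0)"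
proof (induction ns arbitrary: k)
  case (Cons n ns)
  then have "pr k (foldr cre (n # ns) v) = (if n \<le> k then cre n (pr (k - n) (foldr cre ns v)) else 0)"
    by (simp add: cre_def lin_scale[OF lin_pr] pr_nak nat_diff_distrib fock.scale_zero_right)
  then show ?case using Cons lin_zero[OF lin_cre[of n]] by auto
qed simp

text \<open>A word lowers the level by the sum of its indices, so it kills \<open>v\<close> once
  that sum exceeds \<open>L\<close>; for positive indices the sum bounds both the letters and the
  length.\<close>

lemma exp_annihilation_eq:
  assumes "\<forall>n>L. pr n v = 0" "L \<le> K" "L \<le> R"
  shows "exp_annihilation X F y v = truncated_exp K R ann v"
proof -
  have z: "foldr ann ns 0 = 0" if "0 \<notin> set ns" for ns
    using that by (induction ns) (auto simp: lin_zero[OF lin_ann])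
  have "Sum_any (\<lambda>ns. exp_term F ann ns v) = truncated_exp K R ann v"
  proof (rule Sum_any_exp_term[where p = "\<lambda>v. v"])
    fix ns assume ns: "0 \<notin> set ns" "foldr ann ns v \<noteq> 0"
    have "sum_list ns \<le> L"
    proof (rule ccontr)
      assume "\<not> sum_list ns \<le> L"
      then have "pr k (foldr ann ns v) = 0" for k
        using assms(1) ns(1) by (simp add: pr_foldr_ann z)
      then show False using ns(2) eq_0_by_pr by blast
    qed
    then show "set ns \<subseteq> {1..K} \<and> length ns \<le> R"
      using positive_list_bounds[OF ns(1)] assms(2,3) by auto
  qed (auto intro: lin_ann lin_id)
  then show ?thesis by (simp add: exp_annihilation_def ann_def[abs_def])
qed

lemma exp_creation_eq:
  assumes "l \<le> K" "l \<le> R"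
  shows "exp_creation X F y v l = pr l (truncated_exp K R cre v)"
proof -
  have "Sum_any (\<lambda>ns. pr l (exp_term F cre ns v)) = pr l (truncated_exp K R cre v)"
  proof (rule Sum_any_exp_term)
    fix ns assume ns: "0 \<notin> set ns" "pr l (foldr cre ns v) \<noteq> 0"
    then have "sum_list ns \<le> l" by (auto simp: pr_foldr_cre split: if_splits)
    then show "set ns \<subseteq> {1..K} \<and> length ns \<le> R"
      using positive_list_bounds[OF ns(1)] assms by auto
  qed (auto intro: lin_cre lin_pr)
  then show ?thesis by (simp add: exp_creation_def cre_def[abs_def])
qed

lemma lin_exp_annihilation: "lin (exp_annihilation X F y)"
  unfolding lin_def
proof (intro conjI allI)
  fix v w c
  obtain L where L: "\<forall>n>L. pr n v = 0" using pr_bound_exists by blast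
  obtain L' where L': "\<forall>n>L'. pr n w = 0" using pr_bound_exists by blast
  define K where "K = max L L'"
  have K: "\<forall>n>K. pr n v = 0" "\<forall>n>K. pr n w = 0" "\<forall>n>K. pr n (v + w) = 0" "\<forall>n>K. pr n (sc c v) = 0"
    using L L' by (auto simp: K_def lin_add[OF lin_pr] lin_scale[OF lin_pr] fock.scale_zero_right)
  have *: "lin (truncated_exp K K ann)" by (intro lin_truncated_exp lin_ann) auto
  have eq: "exp_annihilation X F y u = truncated_exp K K ann u" if "\<forall>n>K. pr n u = 0" for u
    by (rule exp_annihilation_eq[OF that]) auto
  show "exp_annihilation X F y (v + w) = exp_annihilation X F y v + exp_annihilation X F y w"
    unfolding eq[OF K(1)] eq[OF K(2)] eq[OF K(3)] by (rule lin_add[OF *])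
  show "exp_annihilation X F y (sc c v) = sc c (exp_annihilation X F y v)"
    unfolding eq[OF K(1)] eq[OF K(4)] by (rule lin_scale[OF *])
qed

lemma lin_exp_creation: "lin (\<lambda>v. exp_creation X F y v l)"
  unfolding exp_creation_eq[OF order_refl order_refl]
  by (intro lin_compose[OF lin_pr] lin_truncated_exp lin_cre) auto

lemma lin_vertex_op: "lin (\<lambda>v. vertex_op X F y v l)"
  unfolding vertex_op_def by (rule lin_compose[OF lin_exp_creation lin_exp_annihilation])

lemma pr_vertex_op: "pr l (vertex_op X F y v l) = vertex_op X F y v l"
  unfolding vertex_op_def exp_creation_eq[OF order_refl order_refl] by (simp add: pr_pr)

text \<open>Only the mode \<open>n = - m\<close> fails to commute: its coefficient
  \<open>- 1 / (n y ^ n)\<close> times the commutator \<open>- n \<integral>\<alpha>\<close> is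
  \<open>y powi m\<close> times \<open>\<integral>\<alpha>\<close>.\<close>

lemma exp_annihilation_nak:
  assumes m: "m \<noteq> 0" and \<alpha>: "\<alpha> \<in> coh X i"
  shows "exp_annihilation X F y (nak F m \<alpha> w) = nak F m \<alpha> (exp_annihilation X F y w)
    + sc (if m < 0 then y powi m * of_rat (integral\<^sub>X X \<alpha>) else 0) (exp_annihilation X F y w)"
    (is "_ = _ + sc ?\<beta> _")
proof -
  obtain L where L: "\<forall>n>L. pr n w = 0" using pr_bound_exists by blast
  \<comment> \<open>Large enough for the levels of \<open>w\<close> and of
    \<open>nak F m \<alpha> w\<close>, and for the one mode that fails to commute.\<close>
  define K where "K = L + nat \<bar>m\<bar>"
  have K: "\<forall>n>K. pr n w = 0" using L by (auto simp: K_def)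
  have K': "\<forall>n>K. pr n (nak F m \<alpha> w) = 0"
    using L m by (auto simp: K_def pr_nak lin_zero[OF lin_nak])
  have "(\<Sum>n\<in>{1..K}. ann n (nak F m \<alpha> w)) = nak F m \<alpha> (\<Sum>n\<in>{1..K}. ann n w) + sc ?\<beta> w" for w
  proof -
    define c where "c n = - (1 / (of_nat n * y ^ n)) * (if int n = - m then - of_int (int n) * of_rat (integral\<^sub>X X \<alpha>) else 0)" for n
    have "(\<Sum>n\<in>{1..K}. ann n (nak F m \<alpha> w)) = (\<Sum>n\<in>{1..K}. nak F m \<alpha> (ann n w) + sc (c n) w)"
      using m \<alpha> by (intro sum.cong refl) (simp add: ann_def lin_minus[OF lin_nak] nak_unit_commute c_def fock.scale_right_distrib lin_scale[OF lin_nak])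
    also have "\<dots> = nak F m \<alpha> (\<Sum>n\<in>{1..K}. ann n w) + sc (\<Sum>n\<in>{1..K}. c n) w"
      using m by (simp add: sum.distrib lin_sum[OF lin_nak] fock.scale_sum_left)
    also have "(\<Sum>n\<in>{1..K}. c n) = (\<Sum>n\<in>{1..K}. if n = nat (- m) then ?\<beta> else 0)"
      by (intro sum.cong refl) (auto simp: c_def y power_int_def field_simps)
    also have "\<dots> = ?\<beta>" using m by (auto simp: K_def)
    finally show ?thesis .
  qed
  from truncated_exp_commute[OF _ lin_nak[OF m] this, of K w] lin_ann
  have "truncated_exp K (Suc K) ann (nak F m \<alpha> w)
      = nak F m \<alpha> (truncated_exp K (Suc K) ann w) + sc ?\<beta> (truncated_exp K K ann w)"
    by simp
  note te = this
  have e1: "exp_annihilation X F y (nak F m \<alpha> w) = truncated_exp K (Suc K) ann (nak F m \<alpha> w)"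
    by (rule exp_annihilation_eq[OF K']) auto
  have e2: "exp_annihilation X F y w = truncated_exp K (Suc K) ann w"
    by (rule exp_annihilation_eq[OF K]) auto
  \<comment> \<open>Words longer than the level of \<open>w\<close> vanish on \<open>w\<close>; this
    absorbs the shift from \<open>Suc K\<close> to \<open>K\<close> left by
    \<open>truncated_exp_commute\<close>.\<close>
  have e3: "truncated_exp K (Suc K) ann w = truncated_exp K K ann w"
    unfolding e2[symmetric] by (rule exp_annihilation_eq[OF K]) auto
  show ?thesis
    unfolding e1 e2 te unfolding e3 ..
qed

lemma exp_creation_nak:
  assumes m: "m \<noteq> 0" and \<alpha>: "\<alpha> \<in> coh X i"
  shows "exp_creation X F y (nak F m \<alpha> w) l
    = (if 0 \<le> int l + m then nak F m \<alpha> (exp_creation X F y w (nat (int l + m))) else 0)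
    + sc (if m > 0 then y powi m * of_rat (integral\<^sub>X X \<alpha>) else 0) (exp_creation X F y w l)"
    (is "_ = _ + sc ?\<beta> _")
proof -
  \<comment> \<open>For creation the bound comes from the components that are read off,
    \<open>l\<close> and \<open>l + m\<close>, rather than from the vector.\<close>
  define K where "K = l + nat \<bar>m\<bar>"
  have "(\<Sum>n\<in>{1..K}. cre n (nak F m \<alpha> w)) = nak F m \<alpha> (\<Sum>n\<in>{1..K}. cre n w) + sc ?\<beta> w" for w
  proof -
    define c where "c n = (y ^ n / of_nat n) * (if - int n = - m then - of_int (- int n) * of_rat (integral\<^sub>X X \<alpha>) else 0)" for n
    have "(\<Sum>n\<in>{1..K}. cre n (nak F m \<alpha> w)) = (\<Sum>n\<in>{1..K}. nak F m \<alpha> (cre n w) + sc (c n) w)"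
      using m \<alpha> by (intro sum.cong refl) (simp add: cre_def nak_unit_commute c_def fock.scale_right_distrib lin_scale[OF lin_nak])
    also have "\<dots> = nak F m \<alpha> (\<Sum>n\<in>{1..K}. cre n w) + sc (\<Sum>n\<in>{1..K}. c n) w"
      using m by (simp add: sum.distrib lin_sum[OF lin_nak] fock.scale_sum_left)
    also have "(\<Sum>n\<in>{1..K}. c n) = (\<Sum>n\<in>{1..K}. if n = nat m then ?\<beta> else 0)"
      by (intro sum.cong refl) (auto simp: c_def y power_int_def field_simps)
    also have "\<dots> = ?\<beta>" using m by (auto simp: K_def)
    finally show ?thesis .
  qed
  from truncated_exp_commute[OF _ lin_nak[OF m] this, of K w] lin_cre
  have "truncated_exp K (Suc K) cre (nak F m \<alpha> w)
      = nak F m \<alpha> (truncated_exp K (Suc K) cre w) + sc ?\<beta> (truncated_exp K K cre w)"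
    by simp
  note te = this
  have e1: "exp_creation X F y (nak F m \<alpha> w) l = pr l (truncated_exp K (Suc K) cre (nak F m \<alpha> w))"
    and e2: "exp_creation X F y w l = pr l (truncated_exp K K cre w)"
    by (intro exp_creation_eq; simp add: K_def)+
  have e3: "exp_creation X F y w (nat (int l + m)) = pr (nat (int l + m)) (truncated_exp K (Suc K) cre w)"
    by (rule exp_creation_eq) (auto simp: K_def)
  show ?thesis
    unfolding e1 e2 e3 te lin_add[OF lin_pr] lin_scale[OF lin_pr] pr_nak[OF m] ..
qed

text \<open>Each exponential corrects only one sign of \<open>m\<close>, creation for
  \<open>m > 0\<close> and annihilation for \<open>m < 0\<close>, but both corrections have the same
  form. Together they are \<open>W a_m = a_m W + y ^ m \<integral>\<alpha> W\<close>, read at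
  component \<open>l\<close>.\<close>

lemma vertex_op_nak:
  assumes m: "m \<noteq> 0" and \<alpha>: "\<alpha> \<in> coh X i"
  shows "vertex_op X F y (nak F m \<alpha> w) l
    = (if 0 \<le> int l + m then nak F m \<alpha> (vertex_op X F y w (nat (int l + m))) else 0)
    + sc (y powi m * of_rat (integral\<^sub>X X \<alpha>)) (vertex_op X F y w l)"
proof -
  have b: "sc (if m > 0 then c else 0) e + sc (if m < 0 then c else 0) e = sc c e" for c e
    using m by (cases "m < 0") (simp_all add: fock.scale_zero_left)
  show ?thesis
    unfolding vertex_op_def exp_annihilation_nak[OF assms] lin_add[OF lin_exp_creation]
      lin_scale[OF lin_exp_creation] exp_creation_nak[OF assms] add.assoc b ..
qed

lemma vertex_op_vac: "vertex_op X F y (vac F) 0 = vac F"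
proof -
  have te: "truncated_exp 0 0 g v = v" for g v
    unfolding truncated_exp_def by simp
  have "exp_annihilation X F y (vac F) = truncated_exp 0 0 ann (vac F)"
    by (rule exp_annihilation_eq[of 0]) (auto simp: pr_hilb[OF vac_hilb])
  then show ?thesis
    unfolding vertex_op_def exp_creation_eq[OF order_refl order_refl] te by (simp add: pr_hilb[OF vac_hilb])
qed

end

end


section \<open>Wick recursion for traces\<close>

text \<open>Steps of length \<open>|m|\<close> lead down to the negative integers, where
  \<open>f\<close> vanishes. For \<open>m < 0\<close> the relation has to be inverted first, which
  needs \<open>e \<noteq> 0\<close>.\<close>

lemma periodic_zero:
  fixes f :: "int \<Rightarrow> complex"
  assumes m: "m \<noteq> 0" and e: "e \<noteq> 0" and f: "\<And>k. f k = e * f (k - m)" and neg: "\<And>k. k < 0 \<Longrightarrow> f k = 0"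
  shows "f k = 0"
proof -
  have pos: "f k = 0" if "M > 0" "c \<noteq> 0" "\<And>k. f k = c * f (k - M)" for M c k
  proof (induction "nat k" arbitrary: k rule: less_induct)
    case less
    show ?case
    proof (cases "k < 0")
      case False
      have "f (k - M) = 0"
      proof (cases "k - M < 0")
        case False
        then show ?thesis using less[of "k - M"] that(1) by auto
      qed (simp add: neg)
      then show ?thesis using that(3)[of k] by simp
    qed (simp add: neg)
  qed
  show ?thesis
  proof (cases "m > 0")
    case True
    then show ?thesis using pos[OF True e f] by blast
  next
    case False
    have prev: "f k = inverse e * f (k - (- m))" for k
      using f[of "k + m"] e by (simp add: field_simps)
    show ?thesis by (rule pos[OF _ _ prev]) (use False m e in auto)
  qed
qed

context nakajima_fock
begin

definition nak_word :: "('l \<Rightarrow> int) \<Rightarrow> ('l \<Rightarrow> 'h) \<Rightarrow> 'l list \<Rightarrow> 'f \<Rightarrow> 'f" where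
  "nak_word \<mu> \<alpha> as v = foldr (\<lambda>a. nak F (\<mu> a) (\<alpha> a)) as v"

lemma nak_word_simps [simp]:
  "nak_word \<mu> \<alpha> [] v = v"
  "nak_word \<mu> \<alpha> (a # as) v = nak F (\<mu> a) (\<alpha> a) (nak_word \<mu> \<alpha> as v)"
  "nak_word \<mu> \<alpha> (as @ bs) v = nak_word \<mu> \<alpha> as (nak_word \<mu> \<alpha> bs v)"
  by (simp_all add: nak_word_def)

lemma lin_nak_word: "(\<And>a. a \<in> set as \<Longrightarrow> \<mu> a \<noteq> 0) \<Longrightarrow> lin (nak_word \<mu> \<alpha> as)"
proof (induction as)
  case Nil
  show ?case using lin_id by (simp add: lin_def)
next
  case (Cons a as)
  then have "lin (\<lambda>v. nak F (\<mu> a) (\<alpha> a) (nak_word \<mu> \<alpha> as v))"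
    by (intro lin_compose[OF lin_nak]) auto
  then show ?case by (simp add: lin_def)
qed

text \<open>The scalar supercommutator of the two modes.\<close>

definition contraction :: "('l \<Rightarrow> int) \<Rightarrow> ('l \<Rightarrow> 'h) \<Rightarrow> 'l \<Rightarrow> 'l \<Rightarrow> complex" where
  "contraction \<mu> \<alpha> a b = (if \<mu> a = - \<mu> b then - of_int (\<mu> a) * of_rat (pairing X (\<alpha> a) (\<alpha> b)) else 0)"

definition remove_nth :: "nat \<Rightarrow> 'l list \<Rightarrow> 'l list" where
  "remove_nth i as = take i as @ drop (Suc i) as"

lemma remove_nth_simps [simp]:
  "remove_nth 0 (a # as) = as" "remove_nth (Suc i) (a # as) = a # remove_nth i as"
  by (simp_all add: remove_nth_def)

lemma set_remove_nth: "set (remove_nth i as) \<subseteq> set as"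
  unfolding remove_nth_def by (auto dest: in_set_takeD in_set_dropD)

lemma length_remove_nth: "i < length as \<Longrightarrow> length (remove_nth i as) < length as"
  by (simp add: remove_nth_def)

lemma sum_deg_remove_nth:
  "i < length as \<Longrightarrow> sum_list (map deg as) = sum_list (map deg (remove_nth i as)) + (deg (as ! i) :: nat)"
  by (subst (1) id_take_nth_drop[of i as]) (auto simp: remove_nth_def)

definition move_sign :: "('l \<Rightarrow> nat) \<Rightarrow> 'l \<Rightarrow> 'l list \<Rightarrow> complex" where
  "move_sign deg a as = (-1) ^ (deg a * sum_list (map deg as))"

lemma move_sign_simps:
  "move_sign deg a [] = 1"
  "move_sign deg a (b # bs) = (-1) ^ (deg a * deg b) * move_sign deg a bs"
  by (simp_all add: move_sign_def power_add algebra_simps)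

text \<open>Positions rather than labels index the sum because the sign of the contraction at
  \<open>i\<close> comes from the letters already passed, \<open>take i as\<close>.\<close>

lemma nak_past_word:
  assumes "\<mu> a \<noteq> 0" "\<alpha> a \<in> coh X (deg a)" "\<And>b. b \<in> set as \<Longrightarrow> \<mu> b \<noteq> 0 \<and> \<alpha> b \<in> coh X (deg b)"
  shows "nak F (\<mu> a) (\<alpha> a) (nak_word \<mu> \<alpha> as v) =
    sc (move_sign deg a as) (nak_word \<mu> \<alpha> as (nak F (\<mu> a) (\<alpha> a) v))
    + (\<Sum>i<length as. sc (move_sign deg a (take i as) * contraction \<mu> \<alpha> a (as ! i)) (nak_word \<mu> \<alpha> (remove_nth i as) v))"
  using assms(3)
proof (induction as)
  case Nil
  then show ?case by (simp add: move_sign_simps)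
next
  case (Cons b bs)
  let ?A = "nak F (\<mu> a) (\<alpha> a)" and ?B = "nak F (\<mu> b) (\<alpha> b)" and ?w = "nak_word \<mu> \<alpha> bs v"
  let ?e = "(-1) ^ (deg a * deg b) :: complex"
  have b: "\<mu> b \<noteq> 0" "\<alpha> b \<in> coh X (deg b)" using Cons.prems by auto
  have "?A (?B ?w) = sc ?e (?B (?A ?w)) + sc (contraction \<mu> \<alpha> a b) ?w"
    using nak_commutator[OF assms(1) b(1) assms(2) b(2), of ?w]
    by (simp add: contraction_def diff_eq_eq add.commute split: if_splits)
  also have "?A ?w = sc (move_sign deg a bs) (nak_word \<mu> \<alpha> bs (?A v))
    + (\<Sum>i<length bs. sc (move_sign deg a (take i bs) * contraction \<mu> \<alpha> a (bs ! i)) (nak_word \<mu> \<alpha> (remove_nth i bs) v))"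
    using Cons by auto
  finally show ?case
    using b(1)
    by (simp add: lin_add[OF lin_nak] lin_scale[OF lin_nak] lin_sum[OF lin_nak] fock.scale_right_distrib
        fock.scale_sum_right move_sign_simps sum.lessThan_Suc_shift add_ac mult_ac del: sum.lessThan_Suc)
qed

context
  fixes y :: complex
  assumes y: "y \<noteq> 0"
begin

text \<open>
  Extending the levels by \<open>0\<close> to the negative integers makes the shift in the rotation rule
  below valid without case distinctions.
\<close>

definition level_trace :: "('l \<Rightarrow> int) \<Rightarrow> ('l \<Rightarrow> 'h) \<Rightarrow> int \<Rightarrow> 'l list \<Rightarrow> complex" where
  "level_trace \<mu> \<alpha> k as = (if k < 0 then 0 else Str (nat k) (\<lambda>v. vertex_op X F y (nak_word \<mu> \<alpha> as v) (nat k)))"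

lemma level_trace_move:
  assumes "\<mu> a \<noteq> 0" "\<alpha> a \<in> coh X (deg a)" "\<And>b. b \<in> set as \<Longrightarrow> \<mu> b \<noteq> 0 \<and> \<alpha> b \<in> coh X (deg b)"
  shows "level_trace \<mu> \<alpha> k (a # as) = move_sign deg a as * level_trace \<mu> \<alpha> k (as @ [a])
    + (\<Sum>i<length as. move_sign deg a (take i as) * contraction \<mu> \<alpha> a (as ! i) * level_trace \<mu> \<alpha> k (remove_nth i as))"
proof -
  note W = lin_vertex_op[OF y]
  have rw: "nak F (\<mu> a) (\<alpha> a) (nak_word \<mu> \<alpha> as v) =
    sc (move_sign deg a as) (nak_word \<mu> \<alpha> as (nak F (\<mu> a) (\<alpha> a) v))
    + (\<Sum>i<length as. sc (move_sign deg a (take i as) * contraction \<mu> \<alpha> a (as ! i)) (nak_word \<mu> \<alpha> (remove_nth i as) v))" for v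
    by (rule nak_past_word) (use assms in auto)
  show ?thesis
    unfolding level_trace_def nak_word_simps rw
    by (simp add: lin_add[OF W] lin_scale[OF W] lin_sum[OF W] Str_add Str_scale Str_sum)
qed

text \<open>Cyclicity carries the last mode to the far left and the trace from level
  \<open>k\<close> to level \<open>k - \<mu> a\<close>; there \<open>vertex_op_nak\<close> moves the
  mode back to the right of the vertex operator.\<close>

lemma level_trace_rotate:
  assumes a: "\<mu> a \<noteq> 0" "\<alpha> a \<in> coh X (deg a)" and as: "\<And>b. b \<in> set as \<Longrightarrow> \<mu> b \<noteq> 0"
  shows "level_trace \<mu> \<alpha> k (as @ [a]) = (-1) ^ deg a * (level_trace \<mu> \<alpha> (k - \<mu> a) (a # as)
    - y powi \<mu> a * of_rat (integral\<^sub>X X (\<alpha> a)) * level_trace \<mu> \<alpha> (k - \<mu> a) as)"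
proof -
  let ?c = "y powi \<mu> a * of_rat (integral\<^sub>X X (\<alpha> a))"
  consider "k < 0" "k - \<mu> a < 0" | "k < 0" "k - \<mu> a \<ge> 0" | "k \<ge> 0" "k - \<mu> a < 0" | "k \<ge> 0" "k - \<mu> a \<ge> 0"
    by linarith
  then show ?thesis
  proof cases
    case 1
    then show ?thesis by (simp add: level_trace_def)
  next
    \<comment> \<open>The left side is 0 by convention. On the right, \<open>vertex_op_nak\<close>
      has no first term, because it would read a component at the negative level \<open>k\<close>,
      so the two summands cancel.\<close>
    case 2
    then have "vertex_op X F y (nak F (\<mu> a) (\<alpha> a) w) (nat (k - \<mu> a)) = sc ?c (vertex_op X F y w (nat (k - \<mu> a)))" for w
      by (subst vertex_op_nak[OF y a]) simp
    then show ?thesis using 2 by (simp add: level_trace_def Str_scale)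
  next
    case 3
    have "Str (nat k) (\<lambda>v. vertex_op X F y (nak_word \<mu> \<alpha> (as @ [a]) v) (nat k)) = Str (nat k) (\<lambda>v. 0)"
    proof (rule Str_cong)
      fix j v assume "v \<in> hilb F (nat k) j"
      then have "nak F (\<mu> a) (\<alpha> a) v = 0" by (rule nak_kill) (use 3 in auto)
      then show "vertex_op X F y (nak_word \<mu> \<alpha> (as @ [a]) v) (nat k) = 0"
        using as by (simp add: lin_zero[OF lin_nak_word] lin_zero[OF lin_vertex_op[OF y]])
    qed
    then show ?thesis using 3 by (simp add: level_trace_def Str_zero)
  next
    case 4
    define n where "n = nat k"
    define n' where "n' = nat (k - \<mu> a)"
    have n': "int n' = int n - \<mu> a" and n: "int n' + \<mu> a = int n" using 4 by (auto simp: n_def n'_def)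
    have "Str n (\<lambda>v. vertex_op X F y (nak_word \<mu> \<alpha> as (nak F (\<mu> a) (\<alpha> a) v)) n)
        = (-1) ^ deg a * Str n' (\<lambda>w. nak F (\<mu> a) (\<alpha> a) (vertex_op X F y (nak_word \<mu> \<alpha> as w) n))"
    proof (rule Str_cyclic)
      show "lin (nak F (\<mu> a) (\<alpha> a))" by (rule lin_nak) fact
      show "lin (\<lambda>v. vertex_op X F y (nak_word \<mu> \<alpha> as v) n)"
        by (intro lin_compose[OF lin_vertex_op[OF y]] lin_nak_word as)
      show "pr n' (nak F (\<mu> a) (\<alpha> a) v) = nak F (\<mu> a) (\<alpha> a) v" if "v \<in> hilb F n j" for j v
        using that a(1) n' by (simp add: pr_nak pr_hilb)
      show "even (i + deg a + j)" if "v \<in> hilb F n j" "cmp n' i (nak F (\<mu> a) (\<alpha> a) v) \<noteq> 0" for i j v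
        using nak_parity(1)[OF a that] .
      show "pr n (vertex_op X F y (nak_word \<mu> \<alpha> as w) n) = vertex_op X F y (nak_word \<mu> \<alpha> as w) n" for w
        by (rule pr_vertex_op[OF y])
    qed
    moreover have "vertex_op X F y (nak F (\<mu> a) (\<alpha> a) w) n'
        = nak F (\<mu> a) (\<alpha> a) (vertex_op X F y w n) + sc ?c (vertex_op X F y w n')" for w
      by (subst vertex_op_nak[OF y a]) (simp add: n)
    ultimately show ?thesis
      using 4 by (simp add: level_trace_def n_def[symmetric] n'_def[symmetric] Str_add Str_scale)
  qed
qed

lemma contraction_parity:
  assumes "\<alpha> a \<in> coh X (deg a)" "\<alpha> b \<in> coh X (deg b)" "contraction \<mu> \<alpha> a b \<noteq> 0"
  shows "even (deg a) \<longleftrightarrow> even (deg b)"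
proof -
  have "pairing X (\<alpha> a) (\<alpha> b) \<noteq> 0" using assms(3) by (auto simp: contraction_def split: if_splits)
  from pairing_degree[OF assms(1,2) this] show ?thesis by presburger
qed

text \<open>
  Rotation produces the sign \<open>(-1)\<^sup>|\<^sup>\<alpha>\<^sup>|\<close>, moving the mode back the sign \<open>(-1)\<^sup>|\<^sup>\<alpha>\<^sup>| \<^sup>|\<^sup>A\<^sup>|\<close>. They cancel only
  if the total degree is even; words of odd total degree have to be treated separately.
\<close>

lemma level_trace_odd:
  assumes "\<And>b. b \<in> set as \<Longrightarrow> \<mu> b \<noteq> 0 \<and> \<alpha> b \<in> coh X (deg b)" "odd (sum_list (map deg as))"
  shows "level_trace \<mu> \<alpha> k as = 0"
  using assms
proof (induction "length as" arbitrary: as k rule: less_induct)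
  case less
  obtain a bs where as: "as = a # bs" using less.prems(2) by (cases as) auto
  have a: "\<mu> a \<noteq> 0" "\<alpha> a \<in> coh X (deg a)" and bs: "\<And>b. b \<in> set bs \<Longrightarrow> \<mu> b \<noteq> 0 \<and> \<alpha> b \<in> coh X (deg b)"
    using less.prems(1) as by auto
  have rem: "contraction \<mu> \<alpha> a (bs ! i) * level_trace \<mu> \<alpha> k (remove_nth i bs) = 0" if i: "i < length bs" for i k
  proof (cases "contraction \<mu> \<alpha> a (bs ! i) = 0")
    case False
    have "even (deg a) \<longleftrightarrow> even (deg (bs ! i))"
      by (rule contraction_parity[where \<mu> = \<mu> and \<alpha> = \<alpha> and deg = deg and a = a, OF a(2) _ False]) (use bs i in auto)
    then have "odd (sum_list (map deg (remove_nth i bs)))"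
      using less.prems(2) sum_deg_remove_nth[OF i, of deg] by (simp add: as) blast
    then have "level_trace \<mu> \<alpha> k (remove_nth i bs) = 0"
      using less.hyps[of "remove_nth i bs"] length_remove_nth[OF i] bs set_remove_nth[of i bs]
      by (auto simp: as)
    then show ?thesis by simp
  qed simp
  have int0: "of_rat (integral\<^sub>X X (\<alpha> a)) * level_trace \<mu> \<alpha> k bs = 0" for k
  proof (cases "even (deg a)")
    case True
    then have "level_trace \<mu> \<alpha> k bs = 0" using less.hyps[of bs] bs less.prems(2) by (auto simp: as)
    then show ?thesis by simp
  next
    case False
    then have "integral\<^sub>X X (\<alpha> a) = 0" using integral_degree[OF a(2)] by fastforce
    then show ?thesis by simp
  qed
  \<comment> \<open>All shorter words enter with odd total degree or with coefficient 0. What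
    remains says that the trace equals a sign times itself at a shifted level, and
    \<open>periodic_zero\<close> makes such a sequence vanish.\<close>
  have "level_trace \<mu> \<alpha> k (a # bs) = (move_sign deg a bs * (-1) ^ deg a) * level_trace \<mu> \<alpha> (k - \<mu> a) (a # bs)" for k
  proof -
    have "(\<Sum>i<length bs. move_sign deg a (take i bs) * contraction \<mu> \<alpha> a (bs ! i) * level_trace \<mu> \<alpha> k (remove_nth i bs)) = 0"
      using rem by (intro sum.neutral) (auto simp: mult.assoc)
    then show ?thesis
      using level_trace_move[where \<mu> = \<mu> and \<alpha> = \<alpha> and deg = deg and a = a and as = bs, OF a bs, of k] level_trace_rotate[where \<mu> = \<mu> and \<alpha> = \<alpha> and deg = deg and a = a and as = bs, OF a, of k] bs int0[of "k - \<mu> a"]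
      by (simp add: mult.assoc)
  qed
  note per = this
  show ?case
    unfolding as
    by (rule periodic_zero[where f = "\<lambda>k. level_trace \<mu> \<alpha> k (a # bs)", OF a(1) _ per])
       (auto simp: move_sign_def level_trace_def)
qed

lemma level_trace_recursion:
  assumes a: "\<mu> a \<noteq> 0" "\<alpha> a \<in> coh X (deg a)" and as: "\<And>b. b \<in> set as \<Longrightarrow> \<mu> b \<noteq> 0 \<and> \<alpha> b \<in> coh X (deg b)"
  shows "level_trace \<mu> \<alpha> k (a # as) = level_trace \<mu> \<alpha> (k - \<mu> a) (a # as)
    - y powi \<mu> a * of_rat (integral\<^sub>X X (\<alpha> a)) * level_trace \<mu> \<alpha> (k - \<mu> a) as
    + (\<Sum>i<length as. move_sign deg a (take i as) * contraction \<mu> \<alpha> a (as ! i) * level_trace \<mu> \<alpha> k (remove_nth i as))"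
proof (cases "even (sum_list (map deg (a # as)))")
  case True
  then have "even (deg a * sum_list (map deg as) + deg a)"
    by (cases "even (deg a)") simp_all
  then have sgn: "move_sign deg a as * (-1) ^ deg a = 1"
    unfolding move_sign_def power_add[symmetric] by (rule neg_one_even_power)
  have rot: "level_trace \<mu> \<alpha> k (as @ [a]) = (-1) ^ deg a * (level_trace \<mu> \<alpha> (k - \<mu> a) (a # as)
    - y powi \<mu> a * of_rat (integral\<^sub>X X (\<alpha> a)) * level_trace \<mu> \<alpha> (k - \<mu> a) as)"
    using a as by (rule_tac level_trace_rotate[where \<mu> = \<mu> and \<alpha> = \<alpha> and deg = deg and a = a and as = as]) blast+
  have mov: "level_trace \<mu> \<alpha> k (a # as) = move_sign deg a as * level_trace \<mu> \<alpha> k (as @ [a])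
    + (\<Sum>i<length as. move_sign deg a (take i as) * contraction \<mu> \<alpha> a (as ! i) * level_trace \<mu> \<alpha> k (remove_nth i as))"
    using a as by (rule_tac level_trace_move[where \<mu> = \<mu> and \<alpha> = \<alpha> and deg = deg and a = a and as = as]) blast+
  have cancel: "A = R + S" if "A = m * B + S" "B = e * R" "m * e = 1" for A B R S m e :: complex
    using that by (simp add: mult.assoc[symmetric])
  show ?thesis by (rule cancel[OF mov rot sgn])
next
  \<comment> \<open>For odd total degree the rotation sign does not cancel, but every term of the
    identity vanishes.\<close>
  case False
  have 1: "level_trace \<mu> \<alpha> k (a # as) = 0" for k
    by (rule level_trace_odd[where deg = deg]) (use a as False in auto)
  have 2: "of_rat (integral\<^sub>X X (\<alpha> a)) * level_trace \<mu> \<alpha> k as = 0" for k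
  proof (cases "even (deg a)")
    case True
    have "level_trace \<mu> \<alpha> k as = 0"
    proof (rule level_trace_odd)
      show "odd (sum_list (map deg as))" using True False by simp
    qed (fact as)
    then show ?thesis by simp
  next
    case False
    then have "integral\<^sub>X X (\<alpha> a) = 0" using integral_degree[OF a(2)] by fastforce
    then show ?thesis by simp
  qed
  have 3: "contraction \<mu> \<alpha> a (as ! i) * level_trace \<mu> \<alpha> k (remove_nth i as) = 0" if i: "i < length as" for i
  proof (cases "contraction \<mu> \<alpha> a (as ! i) = 0")
    case nz: False
    have "even (deg a) \<longleftrightarrow> even (deg (as ! i))"
      by (rule contraction_parity[where \<mu> = \<mu> and \<alpha> = \<alpha> and deg = deg and a = a, OF a(2) _ nz]) (use as i in auto)
    then have "odd (sum_list (map deg (remove_nth i as)))"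
      using False sum_deg_remove_nth[OF i, of deg] by simp blast
    then have "level_trace \<mu> \<alpha> k (remove_nth i as) = 0"
    proof (rule level_trace_odd[rotated])
      fix b assume "b \<in> set (remove_nth i as)"
      then show "\<mu> b \<noteq> 0 \<and> \<alpha> b \<in> coh X (deg b)" using as set_remove_nth[of i as] by blast
    qed
    then show ?thesis by simp
  qed simp
  have "(\<Sum>i<length as. move_sign deg a (take i as) * contraction \<mu> \<alpha> a (as ! i) * level_trace \<mu> \<alpha> k (remove_nth i as)) = 0"
    using 3 by (intro sum.neutral) (auto simp: mult.assoc)
  then show ?thesis using 1 2 by (simp add: mult.assoc)
qed

section \<open>Generating series of the level traces\<close>

definition trace_fps :: "('l \<Rightarrow> int) \<Rightarrow> ('l \<Rightarrow> 'h) \<Rightarrow> 'l list \<Rightarrow> complex fps" where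
  "trace_fps \<mu> \<alpha> as = Abs_fps (\<lambda>n. level_trace \<mu> \<alpha> (int n) as)"

lemma nth_X_power_trace_fps: "fps_nth (fps_X ^ m * trace_fps \<mu> \<alpha> as) n = level_trace \<mu> \<alpha> (int n - int m) as"
  by (auto simp: fps_X_power_mult_nth trace_fps_def level_trace_def nat_diff_distrib)

lemma trace_fps_recursion_pos:
  assumes a: "\<mu> a > 0" "\<alpha> a \<in> coh X (deg a)" and as: "\<And>b. b \<in> set as \<Longrightarrow> \<mu> b \<noteq> 0 \<and> \<alpha> b \<in> coh X (deg b)"
  shows "(1 - fps_X ^ nat (\<mu> a)) * trace_fps \<mu> \<alpha> (a # as) =
    fps_const (- (y powi \<mu> a * of_rat (integral\<^sub>X X (\<alpha> a)))) * (fps_X ^ nat (\<mu> a) * trace_fps \<mu> \<alpha> as)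
    + (\<Sum>i<length as. fps_const (move_sign deg a (take i as) * contraction \<mu> \<alpha> a (as ! i)) * trace_fps \<mu> \<alpha> (remove_nth i as))"
proof (rule fps_ext)
  fix n
  have "\<mu> a \<noteq> 0" using a by simp
  from level_trace_recursion[where \<mu> = \<mu> and \<alpha> = \<alpha> and deg = deg and a = a and as = as, OF this a(2) as, of "int n"] a(1)
  show "fps_nth ((1 - fps_X ^ nat (\<mu> a)) * trace_fps \<mu> \<alpha> (a # as)) n = fps_nth (fps_const (- (y powi \<mu> a * of_rat (integral\<^sub>X X (\<alpha> a)))) * (fps_X ^ nat (\<mu> a) * trace_fps \<mu> \<alpha> as)
    + (\<Sum>i<length as. fps_const (move_sign deg a (take i as) * contraction \<mu> \<alpha> a (as ! i)) * trace_fps \<mu> \<alpha> (remove_nth i as))) n"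
    by (simp add: left_diff_distrib nth_X_power_trace_fps fps_sum_nth) (simp add: trace_fps_def)
qed

text \<open>A negative power of \<open>fps_X\<close> would be needed to read the recursion at level
  \<open>n\<close>. Reading it at level \<open>n + \<mu> a\<close> moves the shift to the
  contraction terms, where it is a positive power.\<close>

lemma trace_fps_recursion_neg:
  assumes a: "\<mu> a < 0" "\<alpha> a \<in> coh X (deg a)" and as: "\<And>b. b \<in> set as \<Longrightarrow> \<mu> b \<noteq> 0 \<and> \<alpha> b \<in> coh X (deg b)"
  shows "(1 - fps_X ^ nat (- \<mu> a)) * trace_fps \<mu> \<alpha> (a # as) =
    fps_const (y powi \<mu> a * of_rat (integral\<^sub>X X (\<alpha> a))) * trace_fps \<mu> \<alpha> as
    - (\<Sum>i<length as. fps_const (move_sign deg a (take i as) * contraction \<mu> \<alpha> a (as ! i)) * (fps_X ^ nat (- \<mu> a) * trace_fps \<mu> \<alpha> (remove_nth i as)))"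
proof (rule fps_ext)
  fix n
  have "\<mu> a \<noteq> 0" using a by simp
  from level_trace_recursion[where \<mu> = \<mu> and \<alpha> = \<alpha> and deg = deg and a = a and as = as, OF this a(2) as, of "int n + \<mu> a"] a(1)
  show "fps_nth ((1 - fps_X ^ nat (- \<mu> a)) * trace_fps \<mu> \<alpha> (a # as)) n = fps_nth (fps_const (y powi \<mu> a * of_rat (integral\<^sub>X X (\<alpha> a))) * trace_fps \<mu> \<alpha> as
    - (\<Sum>i<length as. fps_const (move_sign deg a (take i as) * contraction \<mu> \<alpha> a (as ! i)) * (fps_X ^ nat (- \<mu> a) * trace_fps \<mu> \<alpha> (remove_nth i as)))) n"
    by (simp add: left_diff_distrib nth_X_power_trace_fps fps_sum_nth) (simp add: trace_fps_def)
qed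

text \<open>After division both signs of \<open>\<mu> a\<close> give one formula, since
  \<open>1 / (1 - w) = - inverse w / (1 - inverse w)\<close>. It is Wick's rule: a mean value for
  the first letter plus its contractions with the later ones.\<close>

lemma trace_fps_recursion:
  assumes a: "\<mu> a \<noteq> 0" "\<alpha> a \<in> coh X (deg a)" and as: "\<And>b. b \<in> set as \<Longrightarrow> \<mu> b \<noteq> 0 \<and> \<alpha> b \<in> coh X (deg b)"
    and r: "fps_conv_radius (trace_fps \<mu> \<alpha> as) \<ge> 1"
      "\<And>i. i < length as \<Longrightarrow> fps_conv_radius (trace_fps \<mu> \<alpha> (remove_nth i as)) \<ge> 1"
  shows "fps_conv_radius (trace_fps \<mu> \<alpha> (a # as)) \<ge> 1"
    and "norm z < 1 \<Longrightarrow> z \<noteq> 0 \<Longrightarrow> eval_fps (trace_fps \<mu> \<alpha> (a # as)) z =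
      - (z powi \<mu> a / (1 - z powi \<mu> a)) * (y powi \<mu> a * of_rat (integral\<^sub>X X (\<alpha> a))) * eval_fps (trace_fps \<mu> \<alpha> as) z
      + (\<Sum>i<length as. move_sign deg a (take i as) * (contraction \<mu> \<alpha> a (as ! i) / (1 - z powi \<mu> a)) * eval_fps (trace_fps \<mu> \<alpha> (remove_nth i as)) z)"
proof -
  define G where "G = trace_fps \<mu> \<alpha> (a # as)"
  define P where "P = trace_fps \<mu> \<alpha> as"
  define R where "R i = trace_fps \<mu> \<alpha> (remove_nth i as)" for i
  note r = r[folded P_def R_def]
  define c where "c = y powi \<mu> a * of_rat (integral\<^sub>X X (\<alpha> a))"
  define s where "s i = move_sign deg a (take i as) * contraction \<mu> \<alpha> a (as ! i)" for i
  have rX: "fps_conv_radius (fps_X ^ m * f) \<ge> 1" if "fps_conv_radius f \<ge> 1" for m and f :: "complex fps"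
    by (rule fps_conv_radius_ge_1_mult) (use that in auto)
  have rc: "fps_conv_radius (fps_const d * f) \<ge> 1" if "fps_conv_radius f \<ge> 1" for d and f :: "complex fps"
    by (rule fps_conv_radius_ge_1_mult) (use that in auto)
  have ev: "eval_fps (fps_const d * f) z = d * eval_fps f z" "eval_fps (fps_X ^ m * f) z = z ^ m * eval_fps f z"
    if "fps_conv_radius f \<ge> 1" "norm z < 1" for d m z and f :: "complex fps"
    using less_fps_conv_radius[OF that] by (simp_all add: eval_fps_mult)
  have rsum: "fps_conv_radius (\<Sum>i<length as. fps_const (s i) * R i) \<ge> 1"
    by (intro fps_conv_radius_ge_1_sum rc r) auto
  have rsumX: "fps_conv_radius (\<Sum>i<length as. fps_const (s i) * (fps_X ^ m * R i)) \<ge> 1" for m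
    by (intro fps_conv_radius_ge_1_sum rc rX r) auto
  have evsum: "eval_fps (\<Sum>i<length as. fps_const (s i) * R i) z
      = (\<Sum>i<length as. s i * eval_fps (R i) z)"
    "eval_fps (\<Sum>i<length as. fps_const (s i) * (fps_X ^ m * R i)) z
      = z ^ m * (\<Sum>i<length as. s i * eval_fps (R i) z)"
    if "norm z < 1" for z m
  proof -
    show "eval_fps (\<Sum>i<length as. fps_const (s i) * R i) z
        = (\<Sum>i<length as. s i * eval_fps (R i) z)"
      by (subst eval_fps_sum_ge_1) (use that in \<open>auto simp: rc r ev intro!: sum.cong\<close>)
    show "eval_fps (\<Sum>i<length as. fps_const (s i) * (fps_X ^ m * R i)) z
        = z ^ m * (\<Sum>i<length as. s i * eval_fps (R i) z)"
      unfolding sum_distrib_left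
      by (subst eval_fps_sum_ge_1) (use that in \<open>auto simp: rc rX r ev intro!: sum.cong\<close>)
  qed
  have goal: "fps_conv_radius G \<ge> 1 \<and> (norm z < 1 \<longrightarrow> z \<noteq> 0 \<longrightarrow>
    eval_fps G z = - (z powi \<mu> a / (1 - z powi \<mu> a)) * c * eval_fps (P) z
      + (\<Sum>i<length as. s i * eval_fps (R i) z) / (1 - z powi \<mu> a))" for z
  proof (cases "\<mu> a > 0")
    case True
    define m where "m = nat (\<mu> a)"
    have m: "m > 0" "\<mu> a = int m" using True by (auto simp: m_def)
    have rec: "(1 - fps_X ^ m) * G = fps_const (- c) * (fps_X ^ m * P)
      + (\<Sum>i<length as. fps_const (s i) * R i)"
      using trace_fps_recursion_pos[where \<mu> = \<mu> and \<alpha> = \<alpha> and deg = deg and a = a and as = as, OF True a(2) as] by (simp add: m_def c_def s_def G_def P_def R_def)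
    have rr: "fps_conv_radius (fps_const (- c) * (fps_X ^ m * P)
      + (\<Sum>i<length as. fps_const (s i) * R i)) \<ge> 1"
      by (intro fps_conv_radius_ge_1_add rc rX r rsum)
    have "eval_fps G z = - (z powi \<mu> a / (1 - z powi \<mu> a)) * c * eval_fps (P) z
      + (\<Sum>i<length as. s i * eval_fps (R i) z) / (1 - z powi \<mu> a)"
      if z: "norm z < 1" "z \<noteq> 0"
    proof -
      have "(1 - z ^ m) * eval_fps G z = - c * (z ^ m * eval_fps (P) z)
        + (\<Sum>i<length as. s i * eval_fps (R i) z)"
        unfolding fps_divide_one_minus_power(2)[OF m(1) rec rr z(1)]
        using z r rX rc rsum by (subst eval_fps_add) (auto intro!: less_fps_conv_radius simp: ev evsum)
      then show ?thesis
        using one_minus_power_nonzero[OF z(1) m(1)] by (simp add: m(2) divide_simps mult_ac)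
    qed
    then show ?thesis using fps_divide_one_minus_power(1)[OF m(1) rec rr] by blast
  next
    case False
    define m where "m = nat (- \<mu> a)"
    have m: "m > 0" "\<mu> a = - int m" using False a(1) by (auto simp: m_def)
    have rec: "(1 - fps_X ^ m) * G = fps_const c * P
      + fps_const (-1) * (\<Sum>i<length as. fps_const (s i) * (fps_X ^ m * R i))"
      using trace_fps_recursion_neg[where \<mu> = \<mu> and \<alpha> = \<alpha> and deg = deg and a = a and as = as, OF _ a(2) as] False a(1) by (simp add: m_def c_def s_def G_def P_def R_def flip: fps_const_neg)
    have rr: "fps_conv_radius (fps_const c * P
      + fps_const (-1) * (\<Sum>i<length as. fps_const (s i) * (fps_X ^ m * R i))) \<ge> 1"
      by (intro fps_conv_radius_ge_1_add rc rX r rsumX)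
    have "eval_fps G z = - (z powi \<mu> a / (1 - z powi \<mu> a)) * c * eval_fps (P) z
      + (\<Sum>i<length as. s i * eval_fps (R i) z) / (1 - z powi \<mu> a)"
      if z: "norm z < 1" "z \<noteq> 0"
    proof -
      have nz: "1 - z ^ m \<noteq> 0" "z ^ m - 1 \<noteq> 0" "z ^ m \<noteq> 0" using one_minus_power_nonzero[OF z(1) m(1)] z by auto
      have e: "(1 - z ^ m) * eval_fps G z = c * eval_fps (P) z
        - z ^ m * (\<Sum>i<length as. s i * eval_fps (R i) z)"
        unfolding fps_divide_one_minus_power(2)[OF m(1) rec rr z(1)]
        using z r rX rc rsumX by (subst eval_fps_add) (auto intro!: less_fps_conv_radius simp: ev evsum)
      have 1: "z powi \<mu> a / (1 - z powi \<mu> a) = - (1 / (1 - z ^ m))" "1 / (1 - z powi \<mu> a) = - (z ^ m / (1 - z ^ m))"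
        using nz by (simp_all add: m(2) power_int_minus divide_simps)
      have "eval_fps G z = (c * eval_fps (P) z
        - z ^ m * (\<Sum>i<length as. s i * eval_fps (R i) z)) / (1 - z ^ m)"
        using e nz by (simp add: field_simps)
      also have "\<dots> = (1 / (1 - z ^ m)) * c * eval_fps (P) z
         - (z ^ m / (1 - z ^ m)) * (\<Sum>i<length as. s i * eval_fps (R i) z)"
        by (simp add: diff_divide_distrib)
      also have "\<dots> = - (z powi \<mu> a / (1 - z powi \<mu> a)) * c * eval_fps (P) z
         + (1 / (1 - z powi \<mu> a)) * (\<Sum>i<length as. s i * eval_fps (R i) z)"
        unfolding 1 by simp
      finally show ?thesis by simp
    qed
    then show ?thesis using fps_divide_one_minus_power(1)[OF m(1) rec rr] by blast
  qed
  show "fps_conv_radius (trace_fps \<mu> \<alpha> (a # as)) \<ge> 1" using goal unfolding G_def by blast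
  show "eval_fps (trace_fps \<mu> \<alpha> (a # as)) z =
      - (z powi \<mu> a / (1 - z powi \<mu> a)) * (y powi \<mu> a * of_rat (integral\<^sub>X X (\<alpha> a))) * eval_fps (trace_fps \<mu> \<alpha> as) z
      + (\<Sum>i<length as. move_sign deg a (take i as) * (contraction \<mu> \<alpha> a (as ! i) / (1 - z powi \<mu> a)) * eval_fps (trace_fps \<mu> \<alpha> (remove_nth i as)) z)"
    if "norm z < 1" "z \<noteq> 0"
    using goal[of z] that by (simp add: c_def s_def G_def P_def R_def sum_divide_distrib mult.assoc)
qed

end

end


context nakajima_fock
begin

section \<open>The number operator and the trace of the vertex operator\<close>

definition total_modes :: "(int \<times> 'h) list \<Rightarrow> nat" where
  "total_modes ops = sum_list (map (\<lambda>(m, \<alpha>). nat (- m)) ops)"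

lemma span_creation_words:
  assumes "\<And>ops. \<forall>(m, \<alpha>)\<in>set ops. m < 0 \<Longrightarrow> P (foldr (\<lambda>(m, \<alpha>). nak F m \<alpha>) ops (vac F))"
    "P 0" "\<And>v w. P v \<Longrightarrow> P w \<Longrightarrow> P (v + w)" "\<And>c v. P v \<Longrightarrow> P (sc c v)"
  shows "P v"
proof -
  have "v \<in> fock.span {foldr (\<lambda>(m, \<alpha>). nak F m \<alpha>) ops (vac F) | ops. \<forall>(m, \<alpha>)\<in>set ops. m < 0}"
    using fock_generated by simp
  then show ?thesis
  proof (induction rule: fock.span_induct)
    case base
    then show ?case using assms by (auto simp: fock.subspace_def)
  next
    case (step x)
    then show ?case using assms(1) by auto
  qed
qed

text \<open>The sum kills the vacuum, and its commutator with a creation mode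
  \<open>a_(-k)(\<beta>)\<close> is \<open>- k a_(-k)(\<beta>)\<close>: contracting with
  \<open>D b\<close> gives \<open>- k (D b, \<beta>)\<close>, and summing over \<open>b\<close>
  reassembles \<open>\<beta>\<close>. Passing both \<open>b\<close> and \<open>D b\<close> costs two
  signs that cancel, because their degrees add up to 4.\<close>

lemma number_operator:
  assumes B: "finite B" "\<And>b. b \<in> B \<Longrightarrow> b \<in> coh X (e b)" "\<And>b. b \<in> B \<Longrightarrow> D b \<in> coh X (4 - e b)"
    "\<And>b. b \<in> B \<Longrightarrow> e b \<le> 4" "\<And>v. v = (\<Sum>b\<in>B. smul X (pairing X (D b) v) b)"
  shows "(\<Sum>m\<in>{1..n}. \<Sum>b\<in>B. nak F (- int m) b (nak F (int m) (D b) (pr n v))) = sc (- of_nat n) (pr n v)"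
proof -
  define Q where "Q K v = (\<Sum>m\<in>{1..K}. \<Sum>b\<in>B. nak F (- int m) b (nak F (int m) (D b) v))" for K :: nat and v
  have linQ: "lin (Q K)" for K
    unfolding Q_def by (intro lin_sum_fun lin_compose[OF lin_nak lin_nak]) auto
  have comm: "Q K (nak F (- int k) \<beta> w) = nak F (- int k) \<beta> (Q K w) + sc (- of_nat k) (nak F (- int k) \<beta> w)"
    if k: "1 \<le> k" "k \<le> K" for K k \<beta> w
  proof (induction \<beta> rule: coh_induct)
    case (homogeneous i \<beta>)
    have nz: "- int k \<noteq> 0" using k by simp
    have one: "nak F (- int m) b (nak F (int m) (D b) (nak F (- int k) \<beta> w))
        = nak F (- int k) \<beta> (nak F (- int m) b (nak F (int m) (D b) w))
          + (if m = k then sc (- of_nat k * of_rat (pairing X (D b) \<beta>)) (nak F (- int k) b w) else 0)"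
      if m: "m \<in> {1..K}" and b: "b \<in> B" for m b
    proof -
      have m0: "int m \<noteq> 0" "- int m \<noteq> 0" using m by auto
      have 1: "nak F (int m) (D b) (nak F (- int k) \<beta> u) =
          sc ((-1) ^ ((4 - e b) * i)) (nak F (- int k) \<beta> (nak F (int m) (D b) u))
          + sc (if m = k then - of_nat k * of_rat (pairing X (D b) \<beta>) else 0) u" for u
        using nak_commutator[OF m0(1) nz B(3)[OF b] homogeneous, of u]
        by (auto simp: diff_eq_eq add.commute split: if_splits)
      have "int m \<noteq> - int k" using m by auto
      then have 2: "nak F (- int m) b (nak F (- int k) \<beta> u) =
          sc ((-1) ^ (e b * i)) (nak F (- int k) \<beta> (nak F (- int m) b u))" for u
        using nak_commutator[OF m0(2) nz B(2)[OF b] homogeneous, of u]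
        by (auto simp: fock.scale_zero_left split: if_splits)
      have "even ((4 - e b) * i + e b * i)"
        using B(4)[OF b] by (simp add: distrib_right[symmetric])
      then have sgn: "(-1) ^ ((4 - e b) * i) * (-1) ^ (e b * i) = (1 :: complex)"
        unfolding power_add[symmetric] by (rule neg_one_even_power)
      show ?thesis
        unfolding 1 lin_add[OF lin_nak[OF m0(2)]] lin_scale[OF lin_nak[OF m0(2)]] 2 fock.scale_scale sgn
        by (simp add: fock.scale_zero_left)
    qed
    have "Q K (nak F (- int k) \<beta> w) = (\<Sum>m\<in>{1..K}. \<Sum>b\<in>B. nak F (- int k) \<beta> (nak F (- int m) b (nak F (int m) (D b) w))
          + (if m = k then sc (- of_nat k * of_rat (pairing X (D b) \<beta>)) (nak F (- int k) b w) else 0))"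
      unfolding Q_def by (intro sum.cong refl one)
    also have "\<dots> = nak F (- int k) \<beta> (Q K w)
        + (\<Sum>m\<in>{1..K}. if m = k then \<Sum>b\<in>B. sc (- of_nat k * of_rat (pairing X (D b) \<beta>)) (nak F (- int k) b w) else 0)"
      unfolding Q_def lin_sum[OF lin_nak[OF nz]] sum.distrib by (intro arg_cong2[where f = "(+)"] sum.cong refl) auto
    also have "(\<Sum>m\<in>{1..K}. if m = k then \<Sum>b\<in>B. sc (- of_nat k * of_rat (pairing X (D b) \<beta>)) (nak F (- int k) b w) else 0)
        = (\<Sum>b\<in>B. sc (- of_nat k * of_rat (pairing X (D b) \<beta>)) (nak F (- int k) b w))"
      using k by simp
    also have "\<dots> = sc (- of_nat k) (\<Sum>b\<in>B. nak F (- int k) (smul X (pairing X (D b) \<beta>) b) w)"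
      unfolding fock.scale_sum_right by (intro sum.cong refl) (simp only: nak_smul[OF nz] fock.scale_scale)
    also have "\<dots> = sc (- of_nat k) (nak F (- int k) \<beta> w)"
      unfolding nak_class_sum[OF nz, symmetric] B(5)[of \<beta>, symmetric] ..
    finally show ?case .
  next
    case (add \<alpha> \<beta>)
    have nz: "- int k \<noteq> 0" using k by simp
    show ?case
      unfolding nak_add[OF nz] lin_add[OF linQ] add fock.scale_right_distrib by (simp add: add_ac)
  qed
  define wd where "wd ops = foldr (\<lambda>(m, \<alpha>). nak F m \<alpha>) ops (vac F)" for ops
  have word: "(\<forall>n. pr n (wd ops) = (if n = total_modes ops then wd ops else 0))
     \<and> (\<forall>K\<ge>total_modes ops. Q K (wd ops) = sc (- of_nat (total_modes ops)) (wd ops))"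
    if "\<forall>(m, \<alpha>)\<in>set ops. m < 0" for ops
    using that
  proof (induction ops)
    case Nil
    have "nak F (- int m) b (nak F (int m) (D b) (vac F)) = 0" if "m \<in> {1..K}" for m b K
      using nak_kill[OF vac_hilb, of "int m"] that by (simp add: lin_zero[OF lin_nak])
    then have "Q K (vac F) = 0" for K unfolding Q_def by (intro sum.neutral ballI) auto
    then show ?case by (simp add: total_modes_def wd_def pr_hilb[OF vac_hilb] fock.scale_zero_left)
  next
    case (Cons p ops)
    obtain m \<alpha> where p: "p = (m, \<alpha>)" by fastforce
    define k where "k = nat (- m)"
    have k: "m = - int k" "1 \<le> k" using Cons.prems p by (auto simp: k_def)
    have nz: "- int k \<noteq> 0" using k by simp
    define w where "w = wd ops"
    define t where "t = total_modes ops"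
    have IH: "\<And>n. pr n w = (if n = t then w else 0)" "\<And>K. t \<le> K \<Longrightarrow> Q K w = sc (- of_nat t) w"
      using Cons by (auto simp: w_def t_def)
    have t': "total_modes (p # ops) = k + t" by (simp add: total_modes_def p k_def t_def)
    have w': "wd (p # ops) = nak F (- int k) \<alpha> w"
      by (simp add: p k(1) w_def wd_def)
    have "pr n (nak F (- int k) \<alpha> w) = (if n = k + t then nak F (- int k) \<alpha> w else 0)" for n
      unfolding pr_nak[OF nz] IH by (auto simp: lin_zero[OF lin_nak[OF nz]])
    moreover have "Q K (nak F (- int k) \<alpha> w) = sc (- of_nat (k + t)) (nak F (- int k) \<alpha> w)" if "k + t \<le> K" for K
    proof -
      have "Q K (nak F (- int k) \<alpha> w) = nak F (- int k) \<alpha> (sc (- of_nat t) w) + sc (- of_nat k) (nak F (- int k) \<alpha> w)"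
        using comm[of k K \<alpha> w] IH(2)[of K] that k(2) by simp
      also have "\<dots> = sc (- of_nat t + - of_nat k) (nak F (- int k) \<alpha> w)"
        unfolding lin_scale[OF lin_nak[OF nz]] fock.scale_left_distrib ..
      finally show ?thesis by (simp add: algebra_simps)
    qed
    ultimately show ?case unfolding t' w' by blast
  qed
  have "Q n (pr n v) = sc (- of_nat n) (pr n v)"
  proof (induction v rule: span_creation_words)
    case (1 ops)
    from word[OF this, unfolded wd_def] show ?case
      by (cases "n = total_modes ops") (auto simp: lin_zero[OF linQ] fock.scale_zero_right)
  next
    case 2
    show ?case by (simp add: lin_zero[OF linQ] lin_zero[OF lin_pr] fock.scale_zero_right)
  next
    case (3 v w)
    then show ?case by (simp add: lin_add[OF linQ] lin_add[OF lin_pr] fock.scale_right_distrib)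
  next
    case (4 c v)
    then show ?case by (simp add: lin_scale[OF linQ] lin_scale[OF lin_pr] mult.commute)
  qed
  then show ?thesis by (simp add: Q_def)
qed

context
  fixes y :: complex
  assumes y: "y \<noteq> 0"
begin

text \<open>The empty word at one fixed label type, so that words over all label types share one
  denominator.\<close>

definition vac_fps :: "complex fps" where
  "vac_fps = trace_fps y (\<lambda>_. 0) (\<lambda>_. 0) ([] :: nat list)"

lemma trace_fps_Nil: "trace_fps y \<mu> \<alpha> [] = vac_fps"
  unfolding vac_fps_def trace_fps_def[OF y] level_trace_def[OF y] by simp

text \<open>At level 0 the vertex operator is the identity on the line spanned by the vacuum, which
  lies in the even degree 0.\<close>

lemma vac_fps_0: "fps_nth vac_fps 0 = 1"
proof -
  have 0: "{..4 * 0} = {0 :: nat}" by auto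
  have "fps_nth vac_fps 0 = Str 0 (\<lambda>v. vertex_op X F y v 0)"
    by (simp add: vac_fps_def trace_fps_def[OF y] level_trace_def[OF y])
  also have "\<dots> = Str 0 (\<lambda>v. v)"
  proof (rule Str_cong)
    fix j v assume v: "v \<in> hilb F 0 j"
    show "vertex_op X F y v 0 = v"
    proof (cases "j = 0")
      case True
      with v have "v \<in> fock.span {vac F}" by (simp add: hilb_zero)
      then obtain c where "v = sc c (vac F)" using fock.span_breakdown_eq[of v "vac F" "{}"] by auto
      then show ?thesis by (simp add: lin_scale[OF lin_vertex_op[OF y]] vertex_op_vac[OF y])
    next
      case False
      then have "v = 0" using hilb_above[of 0 j] v by simp
      then show ?thesis by (simp add: lin_zero[OF lin_vertex_op[OF y]])
    qed
  qed
  also have "\<dots> = (\<Sum>b\<in>Bs 0 0. cf 0 0 b b)"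
    unfolding Str_def sum_Is[where h = "\<lambda>j b. (-1) ^ j * cf 0 j b b"] by simp
  also have "\<dots> = of_nat (card (Bs 0 0))"
  proof -
    have "cf 0 0 b b = 1" if "b \<in> Bs 0 0" for b
      using that by (simp add: cf_def component_hilb[OF Bs_hilb[OF that]] fock.representation_basis[OF Bs(1)])
    then show ?thesis by simp
  qed
  also have "card (Bs 0 0) = 1"
  proof -
    have "\<not> fock.dependent {vac F}" using vac_nonzero by simp
    then have "card (Bs 0 0) = card {vac F}"
      using fock.dim_eq_card[OF Bs(2)[of 0 0, unfolded hilb_zero] Bs(1)] fock.dim_eq_card[of "{vac F}" "{vac F}"] by simp
    then show ?thesis by simp
  qed
  finally show ?thesis by simp
qed

text \<open>
  The term with \<open>\<integral>b \<integral>b'\<close> drops out after summation over dual bases because \<open>\<integral>1 = 0\<close>.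
\<close>

lemma vac_fps_number_term:
  assumes B: "b \<in> coh X eb" "Db \<in> coh X ed" and m: "m > 0"
    and \<mu>: "\<mu> = (\<lambda>s. if s then int m else - int m)" and \<alpha>: "\<alpha> = (\<lambda>s. if s then Db else b)"
  shows "(1 - fps_X ^ m) * ((1 - fps_X ^ m) * trace_fps y \<mu> \<alpha> [False, True]) =
    - (fps_const (of_rat (integral\<^sub>X X b * integral\<^sub>X X Db)) * (fps_X ^ m * vac_fps))
    - fps_const (of_nat m * of_rat (pairing X b Db)) * ((1 - fps_X ^ m) * (fps_X ^ m * vac_fps))"
proof -
  define deg where "deg = (\<lambda>s. if s then ed else eb)"
  have 1: "(1 - fps_X ^ m) * trace_fps y \<mu> \<alpha> [True] = - (fps_const (y powi int m * of_rat (integral\<^sub>X X Db)) * (fps_X ^ m * vac_fps))"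
    using trace_fps_recursion_pos[OF y, where \<mu> = \<mu> and \<alpha> = \<alpha> and deg = deg and a = True and as = "[]"] m B
    by (simp add: \<mu> \<alpha> deg_def trace_fps_Nil flip: fps_const_neg)
  have 2: "(1 - fps_X ^ m) * trace_fps y \<mu> \<alpha> [False, True] =
      fps_const (y powi - int m * of_rat (integral\<^sub>X X b)) * trace_fps y \<mu> \<alpha> [True]
      - fps_const (of_nat m * of_rat (pairing X b Db)) * (fps_X ^ m * vac_fps)"
    using trace_fps_recursion_neg[OF y, where \<mu> = \<mu> and \<alpha> = \<alpha> and deg = deg and a = False and as = "[True]"] m B
    by (simp add: \<mu> \<alpha> deg_def trace_fps_Nil contraction_def move_sign_simps)
  \<comment> \<open>The two opposite modes carry inverse powers of \<open>y\<close>, so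
    \<open>y\<close> drops out.\<close>
  have c: "fps_const (y powi - int m * of_rat (integral\<^sub>X X b)) * fps_const (y powi int m * of_rat (integral\<^sub>X X Db))
      = fps_const (of_rat (integral\<^sub>X X b * integral\<^sub>X X Db))"
    using y by (simp add: power_int_minus of_rat_mult)
  have "(1 - fps_X ^ m) * ((1 - fps_X ^ m) * trace_fps y \<mu> \<alpha> [False, True]) =
      fps_const (y powi - int m * of_rat (integral\<^sub>X X b)) * ((1 - fps_X ^ m) * trace_fps y \<mu> \<alpha> [True])
      - fps_const (of_nat m * of_rat (pairing X b Db)) * ((1 - fps_X ^ m) * (fps_X ^ m * vac_fps))"
    unfolding 2 right_diff_distrib by (simp only: mult.left_commute[of "1 - fps_X ^ m"])
  also have "\<dots> = - ((fps_const (y powi - int m * of_rat (integral\<^sub>X X b)) * fps_const (y powi int m * of_rat (integral\<^sub>X X Db))) * (fps_X ^ m * vac_fps))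
      - fps_const (of_nat m * of_rat (pairing X b Db)) * ((1 - fps_X ^ m) * (fps_X ^ m * vac_fps))"
    unfolding 1 by (simp only: mult_minus_right mult.assoc)
  finally show ?thesis unfolding c .
qed

lemma sum_fps_const: "(\<Sum>i\<in>I. fps_const (f i)) = fps_const (\<Sum>i\<in>I. f i :: complex)"
  by (induction I rule: infinite_finite_induct) auto

text \<open>At level \<open>n\<close> the factor \<open>n\<close> is minus the sum in
  \<open>number_operator\<close>, so the Euler derivative of the trace becomes a sum of traces of
  two-letter words, and rotating each letter once evaluates these.\<close>

lemma vac_fps_ODE:
  obtains \<kappa> :: complex where
    "fps_X * fps_deriv vac_fps = Abs_fps (\<lambda>n. \<kappa> * of_nat (\<Sum>m\<in>{m\<in>{1..n}. m dvd n}. m)) * vac_fps"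
proof -
  obtain B :: "'h set" and e :: "'h \<Rightarrow> nat" and D :: "'h \<Rightarrow> 'h"
    where B: "finite B" "\<And>b. b \<in> B \<Longrightarrow> b \<in> coh X (e b)" "\<And>b. b \<in> B \<Longrightarrow> D b \<in> coh X (4 - e b)"
    "\<And>b. b \<in> B \<Longrightarrow> e b \<le> 4" "\<And>v. v = (\<Sum>b\<in>B. smul X (pairing X (D b) v) b)"
    using homogeneous_dual_bases by blast
  \<comment> \<open>Up to the sign \<open>(-1) ^ e b\<close> from supercommutativity the summand is
    a diagonal entry of the identity, so this is the Euler characteristic of
    \<open>X\<close>.\<close>
  define \<kappa> :: complex where "\<kappa> = (\<Sum>b\<in>B. of_rat (pairing X b (D b)))"
  define P where "P m b = trace_fps y (\<lambda>s. if s then int m else - int m) (\<lambda>s. if s then D b else b) [False, True]" for m :: nat and b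
  have int0: "(\<Sum>b\<in>B. integral\<^sub>X X b * integral\<^sub>X X (D b)) = 0"
  proof -
    have "integral\<^sub>X X (unit X) = (\<Sum>b\<in>B. pairing X (D b) (unit X) * integral\<^sub>X X b)"
      by (subst B(5)[of "unit X"]) (simp add: integral_sum integral_smul)
    also have "\<dots> = (\<Sum>b\<in>B. integral\<^sub>X X b * integral\<^sub>X X (D b))"
      by (intro sum.cong refl) (simp add: pairing_unit_right[OF B(3)])
    finally show ?thesis by (simp add: integral_unit)
  qed
  \<comment> \<open>Two rotations leave the square of \<open>1 - fps_X ^ m\<close> as denominator;
    with the product of integrals removed by \<open>int0\<close>, one factor cancels.\<close>
  have sumP: "(\<Sum>b\<in>B. P m b) = fps_const (- (of_nat m * \<kappa>)) * (fps_X ^ m * inverse (1 - fps_X ^ m) * vac_fps)"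
    if m: "m > 0" for m
  proof -
    define u :: "complex fps" where "u = 1 - fps_X ^ m"
    have u0: "fps_nth u 0 \<noteq> 0" using m by (simp add: u_def)
    then have u: "u \<noteq> 0" by auto
    have "u * (u * (\<Sum>b\<in>B. P m b)) = (\<Sum>b\<in>B. - (fps_const (of_rat (integral\<^sub>X X b * integral\<^sub>X X (D b))) * (fps_X ^ m * vac_fps))
        - fps_const (of_nat m * of_rat (pairing X b (D b))) * (u * (fps_X ^ m * vac_fps)))"
      unfolding sum_distrib_left P_def u_def
      by (intro sum.cong refl vac_fps_number_term[OF B(2) B(3) m refl refl]) auto
    also have "\<dots> = - (fps_const (of_rat (\<Sum>b\<in>B. integral\<^sub>X X b * integral\<^sub>X X (D b))) * (fps_X ^ m * vac_fps))
        - fps_const (of_nat m * \<kappa>) * (u * (fps_X ^ m * vac_fps))"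
      by (simp only: sum_subtractf sum_negf sum_distrib_right[symmetric] sum_fps_const of_rat_sum \<kappa>_def sum_distrib_left)
    also have "\<dots> = u * (fps_const (- (of_nat m * \<kappa>)) * (fps_X ^ m * vac_fps))"
      unfolding int0 by (simp add: mult_ac flip: fps_const_neg)
    finally have "u * (\<Sum>b\<in>B. P m b) = fps_const (- (of_nat m * \<kappa>)) * (fps_X ^ m * vac_fps)"
      using u by simp
    then have "inverse u * (u * (\<Sum>b\<in>B. P m b)) = fps_const (- (of_nat m * \<kappa>)) * (fps_X ^ m * inverse u * vac_fps)"
      by (simp only: mult_ac)
    then show ?thesis
      unfolding mult.assoc[symmetric] inverse_mult_eq_1[OF u0] by (simp add: u_def mult.assoc)
  qed
  define E where "E = Abs_fps (\<lambda>n. \<kappa> * of_nat (\<Sum>m\<in>{m\<in>{1..n}. m dvd n}. m))"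
  have "fps_X * fps_deriv vac_fps = E * vac_fps"
  proof (rule fps_ext)
    fix n
    define W where "W v = vertex_op X F y v n" for v
    have W: "lin W" unfolding W_def by (rule lin_vertex_op[OF y])
    have "of_nat n * fps_nth vac_fps n = Str n (\<lambda>v. sc (of_nat n) (W v))"
      by (simp add: vac_fps_def trace_fps_def[OF y] level_trace_def[OF y] Str_scale W_def)
    also have "\<dots> = Str n (\<lambda>v. sc (-1) (\<Sum>m\<in>{1..n}. \<Sum>b\<in>B. W (nak F (- int m) b (nak F (int m) (D b) v))))"
    proof (rule Str_cong)
      fix j v assume v: "v \<in> hilb F n j"
      have "(\<Sum>m\<in>{1..n}. \<Sum>b\<in>B. nak F (- int m) b (nak F (int m) (D b) v)) = sc (- of_nat n) v"
        using number_operator[OF B, of n v] pr_hilb[OF v, of n] by simp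
      then have "W (\<Sum>m\<in>{1..n}. \<Sum>b\<in>B. nak F (- int m) b (nak F (int m) (D b) v)) = sc (- of_nat n) (W v)"
        by (simp only: lin_scale[OF W])
      then show "sc (of_nat n) (W v) = sc (-1) (\<Sum>m\<in>{1..n}. \<Sum>b\<in>B. W (nak F (- int m) b (nak F (int m) (D b) v)))"
        by (simp add: lin_sum[OF W])
    qed
    also have "\<dots> = - (\<Sum>m\<in>{1..n}. \<Sum>b\<in>B. fps_nth (P m b) n)"
      unfolding Str_scale Str_sum
      by (simp add: P_def trace_fps_def[OF y] level_trace_def[OF y] W_def)
    also have "\<dots> = (\<Sum>m\<in>{1..n}. fps_nth (fps_const (of_nat m * \<kappa>) * (fps_X ^ m * inverse (1 - fps_X ^ m) * vac_fps)) n)"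
      unfolding sum_negf[symmetric]
    proof (intro sum.cong refl)
      fix m assume "m \<in> {1..n}"
      then have m: "m > 0" by simp
      have "(\<Sum>b\<in>B. - fps_nth (P m b) n) = - fps_nth (\<Sum>b\<in>B. P m b) n"
        by (simp add: fps_sum_nth sum_negf)
      also have "\<dots> = fps_nth (fps_const (of_nat m * \<kappa>) * (fps_X ^ m * inverse (1 - fps_X ^ m) * vac_fps)) n"
        unfolding sumP[OF m] by (simp only: fps_mult_left_const_nth mult_minus_left minus_minus)
      finally show "(\<Sum>b\<in>B. - fps_nth (P m b) n)
        = fps_nth (fps_const (of_nat m * \<kappa>) * (fps_X ^ m * inverse (1 - fps_X ^ m) * vac_fps)) n" .
    qed
    also have "\<dots> = (\<Sum>m\<in>{1..n}. \<Sum>i\<in>{0..n}. of_nat m * \<kappa> * (if m dvd i \<and> m \<le> i then 1 else 0) * fps_nth vac_fps (n - i))"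
    proof (intro sum.cong refl)
      fix m assume m: "m \<in> {1..n}"
      \<comment> \<open>\<open>m \<le> i\<close> excludes \<open>i = 0\<close>, which every
        \<open>m\<close> divides; the factor \<open>fps_X ^ m\<close> removes that term.\<close>
      have "fps_nth (fps_X ^ m * inverse (1 - fps_X ^ m) :: complex fps) i = (if m dvd i \<and> m \<le> i then 1 else 0)" for i
        using m by (auto simp: fps_X_power_mult_nth inverse_one_minus_fps_X_power dvd_minus_self)
      then show "fps_nth (fps_const (of_nat m * \<kappa>) * (fps_X ^ m * inverse (1 - fps_X ^ m) * vac_fps)) n
        = (\<Sum>i\<in>{0..n}. of_nat m * \<kappa> * (if m dvd i \<and> m \<le> i then 1 else 0) * fps_nth vac_fps (n - i))"
        unfolding fps_mult_left_const_nth fps_mult_nth[of "fps_X ^ m * inverse (1 - fps_X ^ m)" vac_fps] sum_distrib_left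
        by (simp only: mult.assoc)
    qed
    also have "\<dots> = (\<Sum>i\<in>{0..n}. \<Sum>m\<in>{1..n}. of_nat m * \<kappa> * (if m dvd i \<and> m \<le> i then 1 else 0) * fps_nth vac_fps (n - i))"
      by (rule sum.swap)
    also have "\<dots> = (\<Sum>i\<in>{0..n}. fps_nth E i * fps_nth vac_fps (n - i))"
    proof (intro sum.cong refl)
      fix i assume i: "i \<in> {0..n}"
      have "(\<Sum>m\<in>{1..n}. of_nat m * \<kappa> * (if m dvd i \<and> m \<le> i then 1 else 0) :: complex)
          = (\<Sum>m\<in>{m\<in>{1..i}. m dvd i}. of_nat m * \<kappa>)"
        by (rule sum.mono_neutral_cong_right) (use i in auto)
      also have "\<dots> = fps_nth E i" by (simp add: E_def sum_distrib_left mult.commute)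
      finally show "(\<Sum>m\<in>{1..n}. of_nat m * \<kappa> * (if m dvd i \<and> m \<le> i then 1 else 0) * fps_nth vac_fps (n - i))
          = fps_nth E i * fps_nth vac_fps (n - i)"
        by (simp add: sum_distrib_right[symmetric])
    qed
    finally show "fps_nth (fps_X * fps_deriv vac_fps) n = fps_nth (E * vac_fps) n"
      by (cases n) (simp_all add: fps_mult_nth[of E])
  qed
  then show thesis using that E_def by blast
qed

lemma vac_fps_radius: "fps_conv_radius vac_fps \<ge> 1"
  and eval_vac_fps_nonzero: "norm z < 1 \<Longrightarrow> eval_fps vac_fps z \<noteq> 0"
proof -
  obtain \<kappa> :: complex where ODE:
    "fps_X * fps_deriv vac_fps = Abs_fps (\<lambda>n. \<kappa> * of_nat (\<Sum>m\<in>{m\<in>{1..n}. m dvd n}. m)) * vac_fps"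
    using vac_fps_ODE by blast
  have bound: "norm (fps_nth (Abs_fps (\<lambda>n. \<kappa> * of_nat (\<Sum>m\<in>{m\<in>{1..n}. m dvd n}. m))) n) \<le> norm \<kappa> * real n ^ 2 + norm \<kappa>" for n
  proof -
    have "(\<Sum>m\<in>{m\<in>{1..n}. m dvd n}. m) \<le> (\<Sum>m\<in>{1..n}. n)"
      by (rule order_trans[OF sum_mono2 sum_mono]) auto
    then have "real (\<Sum>m\<in>{m\<in>{1..n}. m dvd n}. m) \<le> real (n * n)" by (simp only: of_nat_le_iff) simp
    then have "norm \<kappa> * real (\<Sum>m\<in>{m\<in>{1..n}. m dvd n}. m) \<le> norm \<kappa> * real n ^ 2"
      by (intro mult_left_mono) (auto simp: power2_eq_square)
    moreover have "norm (fps_nth (Abs_fps (\<lambda>n. \<kappa> * of_nat (\<Sum>m\<in>{m\<in>{1..n}. m dvd n}. m))) n)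
        = norm \<kappa> * real (\<Sum>m\<in>{m\<in>{1..n}. m dvd n}. m)"
      unfolding fps_nth_Abs_fps norm_mult norm_of_nat ..
    ultimately show ?thesis using norm_ge_zero[of \<kappa>] by linarith
  qed
  show "fps_conv_radius vac_fps \<ge> 1" by (rule fps_exponential_ODE(1)[OF vac_fps_0 ODE bound])
  show "norm z < 1 \<Longrightarrow> eval_fps vac_fps z \<noteq> 0" by (rule fps_exponential_ODE(2)[OF vac_fps_0 ODE bound])
qed

section \<open>Normalized traces of words\<close>

lemma trace_fps_radius:
  assumes "\<And>b. b \<in> set as \<Longrightarrow> \<mu> b \<noteq> 0 \<and> \<alpha> b \<in> coh X (deg b)"
  shows "fps_conv_radius (trace_fps y \<mu> \<alpha> as) \<ge> 1"
  using assms
proof (induction "length as" arbitrary: as rule: less_induct)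
  case less
  show ?case
  proof (cases as)
    case Nil
    then show ?thesis by (simp add: trace_fps_Nil vac_fps_radius)
  next
    case (Cons a bs)
    show ?thesis unfolding Cons
    proof (rule trace_fps_recursion(1)[OF y, where deg = deg])
      show "fps_conv_radius (trace_fps y \<mu> \<alpha> bs) \<ge> 1"
        by (rule less.hyps) (use Cons less.prems in auto)
      show "fps_conv_radius (trace_fps y \<mu> \<alpha> (remove_nth i bs)) \<ge> 1" if "i < length bs" for i
        by (rule less.hyps) (use Cons less.prems length_remove_nth[OF that] set_remove_nth[of i bs] in auto)
    qed (use Cons less.prems in auto)
  qed
qed

lemma supertrace_word:
  assumes "\<And>b. b \<in> set as \<Longrightarrow> \<mu> b \<noteq> 0 \<and> \<alpha> b \<in> coh X (deg b)" "norm q < 1"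
  shows "(hilb_supertrace F (weighted_op X F q y (\<lambda>v. sc c (nak_word \<mu> \<alpha> as v))) has_sum c * eval_fps (trace_fps y \<mu> \<alpha> as) q) UNIV"
proof -
  have eq: "hilb_supertrace F (weighted_op X F q y (\<lambda>v. sc c (nak_word \<mu> \<alpha> as v))) = (\<lambda>n. c * (fps_nth (trace_fps y \<mu> \<alpha> as) n * q ^ n))"
    by (rule ext) (simp add: hilb_supertrace_eq weighted_op_def q_number_def lin_scale[OF lin_vertex_op[OF y]] Str_scale
        trace_fps_def[OF y] level_trace_def[OF y])
  have r: "norm q < fps_conv_radius (trace_fps y \<mu> \<alpha> as)"
    by (rule less_fps_conv_radius[OF trace_fps_radius[where deg = deg]]) (use assms in auto)
  show ?thesis unfolding eq
    by (intro has_sum_cmult_right norm_summable_imp_has_sum norm_summable_fps sums_eval_fps r)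
qed

definition normalized_trace :: "complex \<Rightarrow> ('l \<Rightarrow> int) \<Rightarrow> ('l \<Rightarrow> 'h) \<Rightarrow> 'l list \<Rightarrow> complex" where
  "normalized_trace q \<mu> \<alpha> as = eval_fps (trace_fps y \<mu> \<alpha> as) q / eval_fps vac_fps q"

lemma supertrace_identity:
  assumes "norm q < 1"
  shows "(hilb_supertrace F (weighted_op X F q y (\<lambda>v. v)) has_sum eval_fps vac_fps q) UNIV"
  using supertrace_word[of "[] :: nat list" "\<lambda>_. 0" "\<lambda>_. 0" "\<lambda>_. 0" q 1] assms by (simp add: trace_fps_Nil)

lemma Omega_word:
  assumes "\<And>b. b \<in> set as \<Longrightarrow> \<mu> b \<noteq> 0 \<and> \<alpha> b \<in> coh X (deg b)" "norm q < 1"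
  shows "Omega X F q y (\<lambda>v. sc c (nak_word \<mu> \<alpha> as v)) = c * normalized_trace q \<mu> \<alpha> as"
proof -
  have "(hilb_supertrace F (weighted_op X F q y (\<lambda>v. sc c (nak_word \<mu> \<alpha> as v))) has_sum c * eval_fps (trace_fps y \<mu> \<alpha> as) q) UNIV"
    by (rule supertrace_word) (use assms in auto)
  then show ?thesis
    unfolding Omega_def supertrace_def normalized_trace_def
    by (simp add: infsumI infsumI[OF supertrace_identity[OF assms(2)]])
qed

lemma normalized_trace_Nil: "norm q < 1 \<Longrightarrow> normalized_trace q \<mu> \<alpha> [] = 1"
  by (simp add: normalized_trace_def trace_fps_Nil eval_vac_fps_nonzero)

lemma normalized_trace_Cons:
  assumes "\<mu> a \<noteq> 0" "\<alpha> a \<in> coh X (deg a)" "\<And>b. b \<in> set as \<Longrightarrow> \<mu> b \<noteq> 0 \<and> \<alpha> b \<in> coh X (deg b)"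
    and q: "norm q < 1" "q \<noteq> 0"
  shows "normalized_trace q \<mu> \<alpha> (a # as) =
      - (q powi \<mu> a / (1 - q powi \<mu> a)) * (y powi \<mu> a * of_rat (integral\<^sub>X X (\<alpha> a))) * normalized_trace q \<mu> \<alpha> as
      + (\<Sum>i<length as. move_sign deg a (take i as) * (contraction \<mu> \<alpha> a (as ! i) / (1 - q powi \<mu> a)) * normalized_trace q \<mu> \<alpha> (remove_nth i as))"
proof -
  have "eval_fps (trace_fps y \<mu> \<alpha> (a # as)) q =
      - (q powi \<mu> a / (1 - q powi \<mu> a)) * (y powi \<mu> a * of_rat (integral\<^sub>X X (\<alpha> a))) * eval_fps (trace_fps y \<mu> \<alpha> as) q
      + (\<Sum>i<length as. move_sign deg a (take i as) * (contraction \<mu> \<alpha> a (as ! i) / (1 - q powi \<mu> a)) * eval_fps (trace_fps y \<mu> \<alpha> (remove_nth i as)) q)"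
  proof (rule trace_fps_recursion(2)[OF y])
    show "fps_conv_radius (trace_fps y \<mu> \<alpha> as) \<ge> 1"
      by (rule trace_fps_radius[where deg = deg]) (use assms in auto)
    show "fps_conv_radius (trace_fps y \<mu> \<alpha> (remove_nth i as)) \<ge> 1" for i
      by (rule trace_fps_radius[where deg = deg]) (use assms(3) set_remove_nth[of i as] in auto)
  qed (use assms in auto)
  then show ?thesis
    by (simp add: normalized_trace_def add_divide_distrib diff_divide_distrib sum_divide_distrib)
qed

end

end


section \<open>Koszul signs\<close>

definition pair_sign :: "('l \<Rightarrow> nat) \<Rightarrow> 'l \<Rightarrow> 'l \<Rightarrow> complex" where
  "pair_sign deg a b = (-1) ^ (deg a * deg b)"

lemma pair_sign_square: "pair_sign deg a b * pair_sign deg a b = 1"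
  by (simp add: pair_sign_def flip: power_mult_distrib)

lemma pair_sign_commute: "pair_sign deg a b = pair_sign deg b a"
  by (simp add: pair_sign_def mult.commute)

lemma koszul_Nil: "koszul deg [] = 1"
  by (simp add: koszul_def)

lemma koszul_Cons:
  "koszul deg (a # as) = (\<Prod>b\<leftarrow>as. if b < a then pair_sign deg a b else 1) * koszul deg as"
proof -
  define S where "S xs = {(k, l). k < l \<and> l < length xs \<and> xs ! l < xs ! k}" for xs :: "'a list"
  define g where "g xs = (\<lambda>(k, l). pair_sign deg (xs ! k) (xs ! l))" for xs
  have kz: "koszul deg xs = prod (g xs) (S xs)" for xs
    by (simp add: koszul_def S_def g_def pair_sign_def)
  have fin: "finite (S xs)" for xs
    by (rule finite_subset[of _ "{..<length xs} \<times> {..<length xs}"]) (auto simp: S_def)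
  have split: "S (a # as) = (\<lambda>l. (0, Suc l)) ` {l. l < length as \<and> as ! l < a} \<union> map_prod Suc Suc ` S as"
  proof (intro equalityI subsetI)
    fix p assume p: "p \<in> S (a # as)"
    obtain k l where kl: "p = (k, l)" by fastforce
    show "p \<in> (\<lambda>l. (0, Suc l)) ` {l. l < length as \<and> as ! l < a} \<union> map_prod Suc Suc ` S as"
    proof (cases k)
      case 0
      then show ?thesis using p kl by (cases l) (auto simp: S_def)
    next
      case (Suc k')
      then show ?thesis using p kl by (cases l) (auto simp: S_def image_iff)
    qed
  qed (auto simp: S_def)
  have "koszul deg (a # as) = prod (g (a # as)) ((\<lambda>l. (0, Suc l)) ` {l. l < length as \<and> as ! l < a}) * prod (g (a # as)) (map_prod Suc Suc ` S as)"
    unfolding kz split by (rule prod.union_disjoint) (auto simp: fin)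
  also have "prod (g (a # as)) ((\<lambda>l. (0, Suc l)) ` {l. l < length as \<and> as ! l < a}) = (\<Prod>l | l < length as \<and> as ! l < a. pair_sign deg a (as ! l))"
    by (subst prod.reindex) (auto simp: inj_on_def g_def)
  also have "\<dots> = (\<Prod>l<length as. if as ! l < a then pair_sign deg a (as ! l) else 1)"
    by (rule prod.mono_neutral_cong_left) auto
  also have "\<dots> = (\<Prod>b\<leftarrow>as. if b < a then pair_sign deg a b else 1)"
    by (subst prod.list_conv_set_nth) (auto simp: lessThan_atLeast0 intro!: prod.cong)
  also have "prod (g (a # as)) (map_prod Suc Suc ` S as) = koszul deg as"
    unfolding kz by (subst prod.reindex) (auto simp: inj_on_def g_def intro!: prod.cong)
  finally show ?thesis .
qed

text \<open>Only pairs containing \<open>b\<close> are lost: it is inverted with the larger entries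
  before it and with the smaller ones after it.\<close>

lemma koszul_remove:
  "koszul deg (xs @ b # ys) = koszul deg (xs @ ys)
    * (\<Prod>c\<leftarrow>xs. if b < c then pair_sign deg b c else 1) * (\<Prod>c\<leftarrow>ys. if c < b then pair_sign deg b c else 1)"
proof (induction xs)
  case Nil
  show ?case by (simp add: koszul_Cons)
next
  case (Cons a xs)
  then show ?case by (simp add: koszul_Cons pair_sign_commute[of deg a b] mult_ac)
qed

lemma prod_list_distinct: "distinct xs \<Longrightarrow> (\<Prod>x\<leftarrow>xs. f x) = (\<Prod>x\<in>set xs. f x :: complex)"
  by (induction xs) auto

text \<open>The Koszul sign of moving \<open>b\<close> to the front of \<open>J\<close> in its given
  order.\<close>

definition jump_sign :: "('l::linorder \<Rightarrow> nat) \<Rightarrow> 'l set \<Rightarrow> 'l \<Rightarrow> complex" where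
  "jump_sign deg J b = (\<Prod>c\<in>{c\<in>J. c < b}. pair_sign deg b c)"

text \<open>
  Bringing \<open>b\<close> to the front and deleting it leaves a sign that depends on the underlying set only.
\<close>

lemma koszul_remove_jump:
  assumes "distinct (xs @ b # ys)"
  shows "koszul deg (xs @ b # ys) * (\<Prod>c\<leftarrow>xs. pair_sign deg b c) = jump_sign deg (set xs \<union> set ys) b * koszul deg (xs @ ys)"
proof -
  have 1: "(\<Prod>c\<leftarrow>xs. if b < c then pair_sign deg b c else 1) * (\<Prod>c\<leftarrow>xs. pair_sign deg b c)
      = (\<Prod>c\<leftarrow>xs. if c < b then pair_sign deg b c else 1)"
    using assms
  proof (induction xs)
    case (Cons c xs)
    have sq: "pair_sign deg b c * u * (pair_sign deg b c * v) = u * v" for u v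
      using pair_sign_square[of deg b c] by (metis mult.assoc mult.left_commute mult_1)
    show ?case using Cons by (auto simp: sq pair_sign_square mult_ac)
  qed simp
  have "(\<Prod>c\<leftarrow>xs. if c < b then pair_sign deg b c else 1) * (\<Prod>c\<leftarrow>ys. if c < b then pair_sign deg b c else 1)
      = (\<Prod>c\<leftarrow>xs @ ys. if c < b then pair_sign deg b c else 1)" by simp
  also have "\<dots> = (\<Prod>c\<in>set (xs @ ys). if c < b then pair_sign deg b c else 1)"
    by (rule prod_list_distinct) (use assms in auto)
  also have "\<dots> = jump_sign deg (set xs \<union> set ys) b"
    unfolding jump_sign_def by (rule prod.mono_neutral_cong_right) auto
  finally have 2: "(\<Prod>c\<leftarrow>xs. if c < b then pair_sign deg b c else 1) * (\<Prod>c\<leftarrow>ys. if c < b then pair_sign deg b c else 1)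
      = jump_sign deg (set xs \<union> set ys) b" .
  have swap: "k * A * B * P = (A * P) * B * k" for k A B P :: complex by (simp add: mult_ac)
  show ?thesis
    unfolding koszul_remove[of deg xs b ys] by (rule trans[OF swap]) (simp only: 1 2)
qed

section \<open>Partitions into singletons and pairs\<close>

abbreviation SPP :: "'l set \<Rightarrow> 'l set set set" where "SPP \<equiv> singleton_pair_partitions"

lemma SPP_finite: "finite J \<Longrightarrow> finite (SPP J)"
  by (rule finite_subset[of _ "Pow (Pow J)"]) (auto simp: singleton_pair_partitions_def partition_on_def)

lemma SPP_empty: "SPP {} = {{}}"
  by (auto simp: singleton_pair_partitions_def partition_on_empty)

lemma SPP_insert:
  assumes "p \<inter> J = {}" "p \<noteq> {}" "card p = 1 \<or> card p = 2" "\<pi> \<in> SPP J"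
  shows "insert p \<pi> \<in> SPP (p \<union> J)" "p \<notin> \<pi>"
  using assms by (auto simp: singleton_pair_partitions_def partition_on_def disjoint_def)

lemma SPP_remove:
  assumes "\<pi> \<in> SPP J" "p \<in> \<pi>"
  shows "\<pi> - {p} \<in> SPP (J - p)"
  using assms by (auto simp: singleton_pair_partitions_def partition_on_def disjoint_def)

lemma SPP_step:
  assumes a: "a \<in> J"
  shows "SPP J = insert {a} ` SPP (J - {a})
    \<union> (\<Union>b\<in>J - {a}. insert {a, b} ` SPP (J - {a, b}))"
proof (intro equalityI subsetI)
  fix \<pi> assume \<pi>: "\<pi> \<in> SPP J"
  then obtain p where p: "p \<in> \<pi>" "a \<in> p" "p \<subseteq> J" "card p = 1 \<or> card p = 2"
    using a by (auto simp: singleton_pair_partitions_def partition_on_def)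
  have ins: "\<pi> = insert p (\<pi> - {p})" using p by auto
  note rem = SPP_remove[OF \<pi> p(1)]
  from p(4) show "\<pi> \<in> insert {a} ` SPP (J - {a})
    \<union> (\<Union>b\<in>J - {a}. insert {a, b} ` SPP (J - {a, b}))"
  proof
    assume "card p = 1"
    then have p': "p = {a}" using p(2) by (auto simp: card_1_singleton_iff)
    have "\<pi> \<in> insert {a} ` SPP (J - {a})"
      by (rule image_eqI) (rule ins[unfolded p'], rule rem[unfolded p'])
    then show ?thesis by blast
  next
    assume "card p = 2"
    then obtain b where p': "p = {a, b}" "b \<noteq> a" using p(2) by (auto simp: card_2_iff)
    have "\<pi> \<in> insert {a, b} ` SPP (J - {a, b})"
      by (rule image_eqI) (rule ins[unfolded p'(1)], rule rem[unfolded p'(1)])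
    moreover have "b \<in> J - {a}" using p(3) p' by auto
    ultimately show ?thesis by blast
  qed
next
  fix \<pi> assume "\<pi> \<in> insert {a} ` SPP (J - {a})
    \<union> (\<Union>b\<in>J - {a}. insert {a, b} ` SPP (J - {a, b}))"
  then show "\<pi> \<in> SPP J"
  proof
    assume "\<pi> \<in> insert {a} ` SPP (J - {a})"
    then obtain \<pi>' where "\<pi> = insert {a} \<pi>'" "\<pi>' \<in> SPP (J - {a})" by blast
    then show ?thesis using SPP_insert(1)[of "{a}" "J - {a}" \<pi>'] a by (auto simp: insert_absorb)
  next
    assume "\<pi> \<in> (\<Union>b\<in>J - {a}. insert {a, b} ` SPP (J - {a, b}))"
    then obtain b \<pi>' where b: "b \<in> J - {a}" and *: "\<pi> = insert {a, b} \<pi>'" "\<pi>' \<in> SPP (J - {a, b})"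
      by blast
    moreover have "{a, b} \<union> (J - {a, b}) = J" using a b by auto
    moreover have "card {a, b} = 2" using b by auto
    ultimately show ?thesis using SPP_insert(1)[of "{a, b}" "J - {a, b}" \<pi>'] by auto
  qed
qed

text \<open>The part containing \<open>a\<close> is determined by the partition and is either
  \<open>{a}\<close> or some \<open>{a, b}\<close>; removing it is inverse to inserting it.\<close>

lemma SPP_sum:
  fixes f :: "'l set set \<Rightarrow> complex"
  assumes a: "a \<in> J" and J: "finite J"
  shows "(\<Sum>\<pi>\<in>SPP J. f \<pi>) = (\<Sum>\<pi>\<in>SPP (J - {a}). f (insert {a} \<pi>))
    + (\<Sum>b\<in>J - {a}. \<Sum>\<pi>\<in>SPP (J - {a, b}). f (insert {a, b} \<pi>))"
proof -
  have notin: "p \<notin> \<pi>" if "\<pi> \<in> SPP (J - p')" "a \<in> p" "a \<in> p'" for p p' \<pi>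
    using that by (auto simp: singleton_pair_partitions_def partition_on_def)
  have inj: "inj_on (insert p) (SPP (J - p))" if "a \<in> p" for p
    using notin[OF _ that that] by (auto simp: inj_on_def) (metis insert_ident)+
  have part: "\<pi> = insert p \<pi>' \<Longrightarrow> \<pi>' \<in> SPP (J - p) \<Longrightarrow> a \<in> p \<Longrightarrow> a \<in> r \<Longrightarrow> r \<in> \<pi> \<Longrightarrow> r = p" for \<pi> \<pi>' p r
    using notin[of \<pi>' p r] by auto
  let ?I = "\<lambda>p. insert p ` SPP (J - p)"
  have disj: "?I p \<inter> ?I r = {}" if "a \<in> p" "a \<in> r" "p \<noteq> r" for p r
    using part that by blast
  have fin: "finite (?I p)" for p using J by (intro finite_imageI SPP_finite) auto
  have 1: "(\<Sum>\<pi>\<in>SPP J. f \<pi>) = (\<Sum>\<pi>\<in>?I {a}. f \<pi>) + (\<Sum>\<pi>\<in>(\<Union>b\<in>J - {a}. ?I {a, b}). f \<pi>)"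
    unfolding SPP_step[OF a]
  proof (rule sum.union_disjoint)
    show "?I {a} \<inter> (\<Union>b\<in>J - {a}. ?I {a, b}) = {}"
    proof (rule equals0I)
      fix \<pi> assume "\<pi> \<in> ?I {a} \<inter> (\<Union>b\<in>J - {a}. ?I {a, b})"
      then obtain b where "b \<noteq> a" "\<pi> \<in> ?I {a} \<inter> ?I {a, b}" by blast
      then show False using disj[of "{a}" "{a, b}"] by auto
    qed
  qed (use J fin in auto)
  have 2: "(\<Sum>\<pi>\<in>(\<Union>b\<in>J - {a}. ?I {a, b}). f \<pi>) = (\<Sum>b\<in>J - {a}. \<Sum>\<pi>\<in>?I {a, b}. f \<pi>)"
  proof (rule sum.UNION_disjoint)
    show "\<forall>b\<in>J - {a}. \<forall>c\<in>J - {a}. b \<noteq> c \<longrightarrow> ?I {a, b} \<inter> ?I {a, c} = {}"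
      using disj by (auto simp: doubleton_eq_iff)
  qed (use J fin in auto)
  have 3: "(\<Sum>\<pi>\<in>?I p. f \<pi>) = (\<Sum>\<pi>\<in>SPP (J - p). f (insert p \<pi>))" if "a \<in> p" for p
    by (rule sum.reindex_cong[OF inj[OF that]]) auto
  have 4: "(\<Sum>b\<in>J - {a}. \<Sum>\<pi>\<in>?I {a, b}. f \<pi>)
    = (\<Sum>b\<in>J - {a}. \<Sum>\<pi>\<in>SPP (J - {a, b}). f (insert {a, b} \<pi>))"
    by (rule sum.cong[OF refl 3]) simp
  have 5: "(\<Sum>\<pi>\<in>?I {a}. f \<pi>) = (\<Sum>\<pi>\<in>SPP (J - {a}). f (insert {a} \<pi>))"
    by (rule 3) simp
  show ?thesis
    unfolding 1 2 4 5 ..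
qed

lemma SPP_props:
  assumes "\<pi> \<in> SPP J" "finite J"
  shows "finite \<pi>" "\<And>p. p \<in> \<pi> \<Longrightarrow> finite p \<and> p \<noteq> {} \<and> p \<subseteq> J" "\<Union>\<pi> = J" "inj_on Min \<pi>"
proof -
  show 1: "\<And>p. p \<in> \<pi> \<Longrightarrow> finite p \<and> p \<noteq> {} \<and> p \<subseteq> J"
    using assms by (auto simp: singleton_pair_partitions_def partition_on_def intro: finite_subset)
  show "finite \<pi>" by (rule finite_subset[of _ "Pow J"]) (use 1 assms in auto)
  show "\<Union>\<pi> = J" using assms by (auto simp: singleton_pair_partitions_def partition_on_def)
  show "inj_on Min \<pi>"
  proof (rule inj_onI)
    fix p r assume pr: "p \<in> \<pi>" "r \<in> \<pi>" "Min p = Min r"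
    then have "Min p \<in> p \<inter> r" using 1 Min_in by (metis IntI)
    then show "p = r"
      using pr assms by (auto simp: singleton_pair_partitions_def partition_on_def disjoint_def)
  qed
qed

text \<open>Insertions of different elements commute only if their keys differ. \<open>Min\<close>
  is injective on the parts of a partition but not on all sets, so the folding is set up relative to
  a set.\<close>

lemma folding_on_insort_key: "inj_on f S \<Longrightarrow> folding_on S (insort_key f)"
  by unfold_locales (rule ext, rename_tac xs, induct_tac xs, auto simp: inj_on_def)

lemma sorted_key_list_of_set_empty: "sorted_key_list_of_set f {} = []"
  using folding_on.empty[OF folding_on_insort_key[of f "{}"]] by (simp add: sorted_key_list_of_set_def)

lemma sorted_key_list_of_set_insert:
  "inj_on f (insert x A) \<Longrightarrow> finite A \<Longrightarrow> x \<notin> A \<Longrightarrow>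
    sorted_key_list_of_set f (insert x A) = insort_key f x (sorted_key_list_of_set f A)"
  unfolding sorted_key_list_of_set_def by (rule folding_on.insert[OF folding_on_insort_key]) (assumption | rule subset_refl)+

lemma sorted_key_list_of_set_inj:
  "finite A \<Longrightarrow> inj_on f A \<Longrightarrow> set (sorted_key_list_of_set f A) = A \<and> distinct (sorted_key_list_of_set f A)"
proof (induction A rule: finite_induct)
  case empty
  show ?case by (simp add: sorted_key_list_of_set_empty)
next
  case (insert x A)
  have "inj_on f A" using insert.prems by (rule inj_on_subset) auto
  then have IH: "set (sorted_key_list_of_set f A) = A" "distinct (sorted_key_list_of_set f A)"
    using insert.IH by auto
  show ?case
    unfolding sorted_key_list_of_set_insert[OF insert.prems insert.hyps]
    by (simp add: set_insort_key distinct_insort IH insert.hyps)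
qed

lemmas set_sorted_key_list_of_set_inj = sorted_key_list_of_set_inj[THEN conjunct1]
  and distinct_sorted_key_list_of_set_inj = sorted_key_list_of_set_inj[THEN conjunct2]

lemma partition_list_insert:
  fixes \<pi> :: "'l::linorder set set"
  assumes \<pi>: "\<pi> \<in> SPP J" "finite J" and p: "finite p" "p \<noteq> {}" "p \<inter> J = {}" "card p = 1 \<or> card p = 2"
    and min: "\<And>c. c \<in> J \<Longrightarrow> Min p < c"
  shows "sorted_key_list_of_set Min (insert p \<pi>) = p # sorted_key_list_of_set Min \<pi>"
proof -
  have ins: "insert p \<pi> \<in> SPP (p \<union> J)" and np: "p \<notin> \<pi>"
    using SPP_insert[OF p(3,2,4) \<pi>(1)] by auto
  have fin: "finite \<pi>" by (rule SPP_props(1)[OF \<pi>])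
  have "inj_on Min (insert p \<pi>)" by (rule SPP_props(4)[OF ins]) (use \<pi> p in auto)
  then have "sorted_key_list_of_set Min (insert p \<pi>) = insort_key Min p (sorted_key_list_of_set Min \<pi>)"
    by (rule sorted_key_list_of_set_insert[OF _ fin np])
  also have "\<dots> = p # sorted_key_list_of_set Min \<pi>"
  proof (rule insort_is_Cons, rule ballI)
    fix r assume "r \<in> set (sorted_key_list_of_set Min \<pi>)"
    then have "r \<in> \<pi>" using set_sorted_key_list_of_set_inj[OF fin SPP_props(4)[OF \<pi>]] by simp
    then have "Min r \<in> J" using SPP_props(2)[OF \<pi>] Min_in by blast
    then show "Min p \<le> Min r" using min by (simp add: less_imp_le)
  qed
  finally show ?thesis .
qed

lemma partition_list_props:
  fixes \<pi> :: "'l::linorder set set"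
  assumes "\<pi> \<in> SPP J" "finite J"
  shows "set (concat (map sorted_list_of_set (sorted_key_list_of_set Min \<pi>))) = J"
    "distinct (concat (map sorted_list_of_set (sorted_key_list_of_set Min \<pi>)))"
proof -
  have fin: "finite \<pi>" by (rule SPP_props(1)[OF assms])
  note s = set_sorted_key_list_of_set_inj[OF fin SPP_props(4)[OF assms]]
  show "set (concat (map sorted_list_of_set (sorted_key_list_of_set Min \<pi>))) = J"
    using SPP_props(2,3)[OF assms] by (auto simp: s)
  have "distinct (sorted_key_list_of_set Min \<pi>)"
    by (rule distinct_sorted_key_list_of_set_inj[OF fin SPP_props(4)[OF assms]])
  moreover have "inj_on sorted_list_of_set \<pi>"
    by (rule inj_onI) (metis SPP_props(2)[OF assms] set_sorted_list_of_set)
  moreover have "disjoint \<pi>" using assms by (auto simp: singleton_pair_partitions_def partition_on_def)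
  ultimately show "distinct (concat (map sorted_list_of_set (sorted_key_list_of_set Min \<pi>)))"
  proof (intro distinct_concat)
    fix ys zs
    assume "ys \<in> set (map sorted_list_of_set (sorted_key_list_of_set Min \<pi>))"
      "zs \<in> set (map sorted_list_of_set (sorted_key_list_of_set Min \<pi>))" "ys \<noteq> zs"
    then obtain p r where "p \<in> \<pi>" "r \<in> \<pi>" "ys = sorted_list_of_set p" "zs = sorted_list_of_set r" "p \<noteq> r"
      by (auto simp: s)
    then show "set ys \<inter> set zs = {}"
      using SPP_props(2)[OF assms] \<open>disjoint \<pi>\<close> by (simp add: disjoint_def)
  qed (use SPP_props(2)[OF assms] in \<open>auto simp: distinct_map s\<close>)
qed

text \<open>The part of the least label \<open>a\<close> heads the list, and \<open>a\<close> is
  inverted with nothing. Its partner \<open>b\<close>, now second, is inverted exactly with the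
  remaining labels below it.\<close>

lemma partition_sign_insert:
  fixes a :: "'l::linorder"
  assumes J: "finite J" "a \<in> J" "\<And>c. c \<in> J \<Longrightarrow> a \<le> c"
  shows "\<pi> \<in> SPP (J - {a}) \<Longrightarrow> partition_sign deg (insert {a} \<pi>) = partition_sign deg \<pi>"
    and "b \<in> J - {a} \<Longrightarrow> \<pi> \<in> SPP (J - {a, b}) \<Longrightarrow>
      partition_sign deg (insert {a, b} \<pi>) = jump_sign deg (J - {a}) b * partition_sign deg \<pi>"
proof -
  define R where "R \<pi> = concat (map sorted_list_of_set (sorted_key_list_of_set Min \<pi>))" for \<pi> :: "'l set set"
  have one: "(\<Prod>c\<leftarrow>cs. if c < a then pair_sign deg a c else 1) = 1" if "set cs \<subseteq> J" for cs
    using that J(3) by (induction cs) (auto simp: not_less[symmetric])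
  {
    assume \<pi>: "\<pi> \<in> SPP (J - {a})"
    have "sorted_key_list_of_set Min (insert {a} \<pi>) = {a} # sorted_key_list_of_set Min \<pi>"
      by (rule partition_list_insert[OF \<pi>]) (use J in \<open>auto simp: less_le\<close>)
    then have "R (insert {a} \<pi>) = a # R \<pi>" by (simp add: R_def)
    moreover have "set (R \<pi>) \<subseteq> J" using partition_list_props(1)[OF \<pi>] J by (auto simp: R_def)
    ultimately show "partition_sign deg (insert {a} \<pi>) = partition_sign deg \<pi>"
      by (simp add: partition_sign_def R_def[symmetric] koszul_Cons one)
  }
  {
    assume b: "b \<in> J - {a}" and \<pi>: "\<pi> \<in> SPP (J - {a, b})"
    have ab: "a < b" using J(3)[of b] b by auto
    have "Min {a, b} = a" by (rule Min_eqI) (use ab in auto)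
    then have "sorted_key_list_of_set Min (insert {a, b} \<pi>) = {a, b} # sorted_key_list_of_set Min \<pi>"
      by (intro partition_list_insert[OF \<pi>]) (use J ab in \<open>auto simp: less_le\<close>)
    moreover have "sorted_list_of_set {a, b} = [a, b]" using ab less_imp_le[OF ab] by simp
    ultimately have Rab: "R (insert {a, b} \<pi>) = a # b # R \<pi>" by (simp add: R_def)
    have setR: "set (R \<pi>) = J - {a, b}" and dR: "distinct (R \<pi>)"
      using partition_list_props[OF \<pi>] J by (auto simp: R_def)
    have "(\<Prod>c\<leftarrow>R \<pi>. if c < b then pair_sign deg b c else 1) = jump_sign deg (J - {a, b}) b"
      unfolding prod_list_distinct[OF dR] setR jump_sign_def by (rule prod.mono_neutral_cong_right) (use J in auto)
    also have "jump_sign deg (J - {a, b}) b = jump_sign deg (J - {a}) b"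
      unfolding jump_sign_def by (intro prod.cong) auto
    finally show "partition_sign deg (insert {a, b} \<pi>) = jump_sign deg (J - {a}) b * partition_sign deg \<pi>"
      unfolding partition_sign_def R_def[symmetric] Rab koszul_Cons[of deg a] koszul_Cons[of deg b]
      using one[of "b # R \<pi>"] b setR by simp
  }
qed

text \<open>The right side of the theorem with both kinds of pair factors merged into one kernel
  \<open>K\<close>, so that its recursion need not know the blocks.\<close>

definition pairing_sum :: "('l::linorder \<Rightarrow> nat) \<Rightarrow> ('l \<Rightarrow> complex) \<Rightarrow> ('l \<Rightarrow> 'l \<Rightarrow> complex) \<Rightarrow> 'l set \<Rightarrow> complex" where
  "pairing_sum deg M K J = (\<Sum>\<pi>\<in>SPP J. partition_sign deg \<pi> *
    (\<Prod>p\<in>\<pi>. if card p = 1 then M (the_elem p) else K (Min p) (Max p)))"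

lemma pairing_sum_empty: "pairing_sum deg M K {} = 1"
  by (simp add: pairing_sum_def SPP_empty partition_sign_def koszul_Nil sorted_key_list_of_set_empty)

lemma pairing_sum_step:
  fixes a :: "'l::linorder"
  assumes J: "finite J" "a \<in> J" "\<And>c. c \<in> J \<Longrightarrow> a \<le> c"
  shows "pairing_sum deg M K J = M a * pairing_sum deg M K (J - {a})
    + (\<Sum>b\<in>J - {a}. jump_sign deg (J - {a}) b * K a b * pairing_sum deg M K (J - {a, b}))"
proof -
  define w where "w p = (if card p = 1 then M (the_elem p) else K (Min p) (Max p))" for p
  have ins: "(\<Prod>r\<in>insert p \<pi>. w r) = w p * (\<Prod>r\<in>\<pi>. w r)" if "\<pi> \<in> SPP (J - p)" "a \<in> p" for p \<pi>
  proof -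
    have "p \<notin> \<pi>" using that by (auto simp: singleton_pair_partitions_def partition_on_def)
    then show ?thesis using SPP_props(1)[OF that(1)] J by simp
  qed
  have 1: "(\<Sum>\<pi>\<in>SPP (J - {a}). partition_sign deg (insert {a} \<pi>) * (\<Prod>p\<in>insert {a} \<pi>. w p))
    = M a * pairing_sum deg M K (J - {a})"
    unfolding pairing_sum_def sum_distrib_left w_def[symmetric]
    by (intro sum.cong refl) (simp add: ins partition_sign_insert(1)[OF J], simp add: w_def)
  have 2: "(\<Sum>\<pi>\<in>SPP (J - {a, b}). partition_sign deg (insert {a, b} \<pi>) * (\<Prod>p\<in>insert {a, b} \<pi>. w p))
    = jump_sign deg (J - {a}) b * K a b * pairing_sum deg M K (J - {a, b})" if b: "b \<in> J - {a}" for b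
  proof -
    have ab: "a < b" using J(3)[of b] b by auto
    have "Min {a, b} = a" by (rule Min_eqI) (use ab in auto)
    moreover have "Max {a, b} = b" by (rule Max_eqI) (use ab in auto)
    ultimately have "w {a, b} = K a b" using ab by (simp add: w_def)
    then show ?thesis
      unfolding pairing_sum_def sum_distrib_left w_def[symmetric]
      by (intro sum.cong refl) (simp add: ins partition_sign_insert(2)[OF J b] mult_ac)
  qed
  have 3: "(\<Sum>b\<in>J - {a}. \<Sum>\<pi>\<in>SPP (J - {a, b}). partition_sign deg (insert {a, b} \<pi>) * (\<Prod>p\<in>insert {a, b} \<pi>. w p))
    = (\<Sum>b\<in>J - {a}. jump_sign deg (J - {a}) b * K a b * pairing_sum deg M K (J - {a, b}))"
    by (rule sum.cong[OF refl 2])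
  have "pairing_sum deg M K J = (\<Sum>\<pi>\<in>SPP J. partition_sign deg \<pi> * (\<Prod>p\<in>\<pi>. w p))"
    by (simp add: pairing_sum_def w_def)
  also have "\<dots> = M a * pairing_sum deg M K (J - {a})
    + (\<Sum>b\<in>J - {a}. jump_sign deg (J - {a}) b * K a b * pairing_sum deg M K (J - {a, b}))"
    unfolding SPP_sum[OF J(2,1)] 1 3 ..
  finally show ?thesis .
qed

lemma partition_weight_eq:
  assumes "\<pi> \<in> SPP J" "finite J"
  shows "partition_weight X \<alpha> d idx q x \<pi> = (\<Prod>p\<in>\<pi>. if card p = 1 then M_factor X \<alpha> d idx q x (the_elem p)
    else (if idx (Min p) = idx (Max p) then L_factor X \<alpha> d q (Min p) (Max p) else C_factor X \<alpha> d idx q x (Min p) (Max p)))"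
proof -
  have fin: "finite \<pi>" by (rule SPP_props(1)[OF assms])
  define A1 where "A1 = {p \<in> \<pi>. card p = 1}"
  define A2 where "A2 = {p \<in> \<pi>. card p = 2 \<and> idx (Min p) \<noteq> idx (Max p)}"
  define A3 where "A3 = {p \<in> \<pi>. card p = 2 \<and> idx (Min p) = idx (Max p)}"
  have un: "\<pi> = (A1 \<union> A2) \<union> A3" using assms(1) by (auto simp: A1_def A2_def A3_def singleton_pair_partitions_def)
  have fins: "finite A1" "finite A2" "finite A3" using fin by (auto simp: A1_def A2_def A3_def)
  define g where "g p = (if card p = 1 then M_factor X \<alpha> d idx q x (the_elem p)
    else (if idx (Min p) = idx (Max p) then L_factor X \<alpha> d q (Min p) (Max p) else C_factor X \<alpha> d idx q x (Min p) (Max p)))" for p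
  have "prod g \<pi> = prod g A1 * prod g A2 * prod g A3"
  proof -
    have "prod g \<pi> = prod g (A1 \<union> A2) * prod g A3"
      unfolding un using fins by (intro prod.union_disjoint) (auto simp: A1_def A2_def A3_def)
    also have "prod g (A1 \<union> A2) = prod g A1 * prod g A2"
      using fins by (intro prod.union_disjoint) (auto simp: A1_def A2_def A3_def)
    finally show ?thesis .
  qed
  also have "prod g A1 = (\<Prod>p\<in>A1. M_factor X \<alpha> d idx q x (the_elem p))"
    by (intro prod.cong) (auto simp: A1_def g_def)
  also have "prod g A2 = (\<Prod>p\<in>A2. C_factor X \<alpha> d idx q x (Min p) (Max p))"
    by (intro prod.cong) (auto simp: A2_def g_def)
  also have "prod g A3 = (\<Prod>p\<in>A3. L_factor X \<alpha> d q (Min p) (Max p))"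
    by (intro prod.cong) (auto simp: A3_def g_def)
  finally show ?thesis
    unfolding partition_weight_def A1_def A2_def A3_def g_def ..
qed


section \<open>Normal ordering\<close>

text \<open>
  The order in which the labels appear in the product of all normally ordered monomials.
\<close>

definition before :: "('l::linorder \<Rightarrow> int) \<Rightarrow> ('l \<Rightarrow> nat) \<Rightarrow> 'l \<Rightarrow> 'l \<Rightarrow> bool" where
  "before \<mu> idx a b \<longleftrightarrow> idx a < idx b \<or>
    (idx a = idx b \<and> (\<mu> a < 0 \<and> \<mu> b > 0 \<or> (\<mu> a < 0 \<longleftrightarrow> \<mu> b < 0) \<and> a < b))"

definition normal_list :: "nat \<Rightarrow> ('l::linorder \<Rightarrow> nat) \<Rightarrow> ('l \<Rightarrow> int) \<Rightarrow> 'l set \<Rightarrow> 'l list" where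
  "normal_list N idx \<mu> J = concat (map (\<lambda>i. normal_order \<mu> (sorted_list_of_set {c\<in>J. idx c = i})) [1..<Suc N])"

lemma set_normal_order: "set (normal_order \<mu> as) = {a \<in> set as. \<mu> a \<noteq> 0}"
  by (auto simp: normal_order_def)

lemma sorted_list_of_set_filter:
  "finite A \<Longrightarrow> sorted_list_of_set (A - {b}) = filter (\<lambda>c. c \<noteq> b) (sorted_list_of_set A)"
  by (simp add: sorted_list_of_set_remove distinct_remove1_removeAll removeAll_filter_not_eq neq_commute)

lemma filter_neq_id: "b \<notin> set xs \<Longrightarrow> filter (\<lambda>c. c \<noteq> b) xs = xs"
  by (induction xs) auto

lemma normal_list_remove:
  assumes "finite J"
  shows "normal_list N idx \<mu> (J - {b}) = filter (\<lambda>c. c \<noteq> b) (normal_list N idx \<mu> J)"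
proof -
  have "{c \<in> J - {b}. idx c = i} = {c \<in> J. idx c = i} - {b}" for i by auto
  then have "normal_order \<mu> (sorted_list_of_set {c \<in> J - {b}. idx c = i})
      = filter (\<lambda>c. c \<noteq> b) (normal_order \<mu> (sorted_list_of_set {c\<in>J. idx c = i}))" for i
    using assms by (simp add: sorted_list_of_set_filter normal_order_def conj_commute)
  then show ?thesis by (simp add: normal_list_def filter_concat o_def)
qed

lemma normal_list_cong:
  assumes "finite J" "\<And>a. a \<in> J \<Longrightarrow> \<mu> a = \<nu> a"
  shows "normal_list N idx \<mu> J = normal_list N idx \<nu> J"
proof -
  have "normal_order \<mu> (sorted_list_of_set {c\<in>J. idx c = i}) = normal_order \<nu> (sorted_list_of_set {c\<in>J. idx c = i})" for i
    unfolding normal_order_def using assms by (intro arg_cong2[where f = "(@)"] filter_cong) auto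
  then show ?thesis by (simp add: normal_list_def)
qed

lemma sorted_wrt_concat:
  assumes "\<And>xs. xs \<in> set xss \<Longrightarrow> sorted_wrt R xs"
    "sorted_wrt (\<lambda>xs ys. \<forall>x\<in>set xs. \<forall>y\<in>set ys. R x y) xss"
  shows "sorted_wrt R (concat xss)"
  using assms by (induction xss) (auto simp: sorted_wrt_append)

text \<open>Through this order relation the recursion sees which labels precede the least one,
  without unfolding the blockwise construction.\<close>

lemma normal_list_sorted:
  assumes "finite J"
  shows "sorted_wrt (before \<mu> idx) (normal_list N idx \<mu> J)"
  unfolding normal_list_def
proof (rule sorted_wrt_concat)
  fix xs assume "xs \<in> set (map (\<lambda>i. normal_order \<mu> (sorted_list_of_set {c\<in>J. idx c = i})) [1..<Suc N])"
  then obtain i where xs: "xs = normal_order \<mu> (sorted_list_of_set {c\<in>J. idx c = i})" by auto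
  define as where "as = sorted_list_of_set {c\<in>J. idx c = i}"
  have set: "set as \<subseteq> {c. idx c = i}" using assms by (auto simp: as_def)
  have sorted: "sorted_wrt (<) as" unfolding as_def by simp
  have "sorted_wrt (before \<mu> idx) (filter (\<lambda>a. \<mu> a < 0) as)"
    by (rule sorted_wrt_mono_rel[OF _ sorted_wrt_filter[OF sorted]]) (use set in \<open>auto simp: before_def\<close>)
  moreover have "sorted_wrt (before \<mu> idx) (filter (\<lambda>a. \<mu> a > 0) as)"
    by (rule sorted_wrt_mono_rel[OF _ sorted_wrt_filter[OF sorted]]) (use set in \<open>auto simp: before_def\<close>)
  ultimately show "sorted_wrt (before \<mu> idx) xs"
    unfolding xs as_def[symmetric] normal_order_def
    using set by (auto simp: sorted_wrt_append before_def)
next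
  have "sorted_wrt (<) [1..<Suc N]" by (rule sorted_wrt_upt)
  then show "sorted_wrt (\<lambda>xs ys. \<forall>x\<in>set xs. \<forall>y\<in>set ys. before \<mu> idx x y)
     (map (\<lambda>i. normal_order \<mu> (sorted_list_of_set {c\<in>J. idx c = i})) [1..<Suc N])"
    unfolding sorted_wrt_map
    by (rule sorted_wrt_mono_rel[rotated]) (use assms in \<open>auto simp: set_normal_order before_def\<close>)
qed

lemma normal_list_set:
  assumes "finite J" "\<And>a. a \<in> J \<Longrightarrow> \<mu> a \<noteq> 0 \<and> idx a \<in> {1..N}"
  shows "set (normal_list N idx \<mu> J) = J"
proof -
  have "set (normal_list N idx \<mu> J) = (\<Union>i\<in>{1..N}. {c\<in>J. idx c = i \<and> \<mu> c \<noteq> 0})"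
    using assms(1) by (auto simp: normal_list_def set_normal_order)
  also have "\<dots> = J" using assms(2) by auto
  finally show ?thesis .
qed

lemma sorted_wrt_irrefl_distinct: "sorted_wrt R xs \<Longrightarrow> (\<And>x. \<not> R x x) \<Longrightarrow> distinct xs"
  by (induction xs) auto

lemma koszul_append:
  "(\<And>x y. x \<in> set xs \<Longrightarrow> y \<in> set ys \<Longrightarrow> x < y) \<Longrightarrow> koszul deg (xs @ ys) = koszul deg xs * koszul deg ys"
proof (induction xs)
  case (Cons x xs)
  have "(\<Prod>b\<leftarrow>ys. if b < x then pair_sign deg x b else 1) = 1"
    using Cons.prems[of x] by (induction ys) (auto dest: less_asym)
  then show ?case using Cons by (simp add: koszul_Cons)
qed (simp add: koszul_Nil)

context nakajima_fock
begin

lemma move_sign_prod: "move_sign deg a as = (\<Prod>c\<leftarrow>as. pair_sign deg a c)"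
  by (induction as) (auto simp: move_sign_simps pair_sign_def)

lemma move_sign_parity:
  "(even (deg a) \<longleftrightarrow> even (deg b)) \<Longrightarrow> move_sign deg a as = move_sign deg b as"
proof -
  assume "even (deg a) \<longleftrightarrow> even (deg b)"
  then have "even (deg a * s) \<longleftrightarrow> even (deg b * s)" for s by simp
  then show ?thesis unfolding move_sign_def uminus_power_if by simp
qed

text \<open>
  For labels in one block this is the contraction after correction by normal ordering.
\<close>

definition mode_contraction :: "complex \<Rightarrow> ('l \<Rightarrow> nat) \<Rightarrow> ('l \<Rightarrow> 'h) \<Rightarrow> 'l \<Rightarrow> 'l \<Rightarrow> int \<Rightarrow> complex" where
  "mode_contraction q idx \<alpha> a b m = (if idx a = idx b then - of_int \<bar>m\<bar> * q ^ nat \<bar>m\<bar> / (1 - q ^ nat \<bar>m\<bar>)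
    else - of_int m / (1 - q powi m)) * of_rat (pairing X (\<alpha> a) (\<alpha> b))"

context
  fixes y :: complex
  assumes y: "y \<noteq> 0"
begin

definition mode_mean :: "complex \<Rightarrow> ('l \<Rightarrow> 'h) \<Rightarrow> 'l \<Rightarrow> int \<Rightarrow> complex" where
  "mode_mean q \<alpha> a m = - (q powi m / (1 - q powi m)) * (y powi m * of_rat (integral\<^sub>X X (\<alpha> a)))"

text \<open>The recursion of \<open>normalized_trace_Cons\<close> starts from the first letter. This
  brings a letter to the front from behind \<open>xs\<close>, at the price of plain contractions
  that \<open>contraction_correction\<close> accounts for.\<close>

lemma normalized_trace_prefix:
  assumes "\<mu> a \<noteq> 0" "\<alpha> a \<in> coh X (deg a)" "\<And>b. b \<in> set (xs @ ys) \<Longrightarrow> \<mu> b \<noteq> 0 \<and> \<alpha> b \<in> coh X (deg b)" "norm q < 1"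
  shows "normalized_trace y q \<mu> \<alpha> (a # xs @ ys) = move_sign deg a xs * normalized_trace y q \<mu> \<alpha> (xs @ a # ys)
    + (\<Sum>i<length xs. move_sign deg a (take i xs) * contraction \<mu> \<alpha> a (xs ! i) * normalized_trace y q \<mu> \<alpha> (remove_nth i xs @ ys))"
proof -
  note W = lin_vertex_op[OF y]
  have rw: "nak F (\<mu> a) (\<alpha> a) (nak_word \<mu> \<alpha> xs v) =
    sc (move_sign deg a xs) (nak_word \<mu> \<alpha> xs (nak F (\<mu> a) (\<alpha> a) v))
    + (\<Sum>i<length xs. sc (move_sign deg a (take i xs) * contraction \<mu> \<alpha> a (xs ! i)) (nak_word \<mu> \<alpha> (remove_nth i xs) v))" for v
    by (rule nak_past_word) (use assms in auto)
  have lev: "level_trace y \<mu> \<alpha> k (a # xs @ ys) = move_sign deg a xs * level_trace y \<mu> \<alpha> k (xs @ a # ys)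
    + (\<Sum>i<length xs. move_sign deg a (take i xs) * contraction \<mu> \<alpha> a (xs ! i) * level_trace y \<mu> \<alpha> k (remove_nth i xs @ ys))" for k
    unfolding level_trace_def[OF y] nak_word_simps rw
    by (simp add: lin_add[OF W] lin_scale[OF W] lin_sum[OF W] Str_add Str_scale Str_sum)
  have fps: "trace_fps y \<mu> \<alpha> (a # xs @ ys) = fps_const (move_sign deg a xs) * trace_fps y \<mu> \<alpha> (xs @ a # ys)
    + (\<Sum>i<length xs. fps_const (move_sign deg a (take i xs) * contraction \<mu> \<alpha> a (xs ! i)) * trace_fps y \<mu> \<alpha> (remove_nth i xs @ ys))"
    by (rule fps_ext) (simp add: trace_fps_def[OF y] fps_sum_nth lev)
  have r: "fps_conv_radius (trace_fps y \<mu> \<alpha> as) \<ge> 1" if "set as \<subseteq> insert a (set (xs @ ys))" for as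
    by (rule trace_fps_radius[OF y, where deg = deg]) (use that assms in auto)
  have r1: "fps_conv_radius (trace_fps y \<mu> \<alpha> (xs @ a # ys)) \<ge> 1" by (rule r) auto
  have r2: "fps_conv_radius (trace_fps y \<mu> \<alpha> (remove_nth i xs @ ys)) \<ge> 1" for i
    by (rule r) (use set_remove_nth[of i xs] in auto)
  have rc: "fps_conv_radius (fps_const d * f) \<ge> 1" if "fps_conv_radius f \<ge> 1" for d and f :: "complex fps"
    by (rule fps_conv_radius_ge_1_mult) (use that in auto)
  have ev: "eval_fps (fps_const d * f) q = d * eval_fps f q" if "fps_conv_radius f \<ge> 1" for d and f :: "complex fps"
    using less_fps_conv_radius[OF that assms(4)] by (simp add: eval_fps_mult)
  have "eval_fps (trace_fps y \<mu> \<alpha> (a # xs @ ys)) q = move_sign deg a xs * eval_fps (trace_fps y \<mu> \<alpha> (xs @ a # ys)) q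
    + (\<Sum>i<length xs. move_sign deg a (take i xs) * contraction \<mu> \<alpha> a (xs ! i) * eval_fps (trace_fps y \<mu> \<alpha> (remove_nth i xs @ ys)) q)"
    unfolding fps
    by (subst eval_fps_add; (intro less_fps_conv_radius fps_conv_radius_ge_1_sum rc r1 r2 assms(4))?)
       (simp add: ev r1 r2 rc eval_fps_sum_ge_1 assms(4))
  then show ?thesis
    by (simp add: normalized_trace_def[OF y] add_divide_distrib sum_divide_distrib)
qed

text \<open>\<open>s\<close> says that \<open>b\<close> precedes \<open>a\<close> in the normal
  order. For \<open>m > 0\<close> in one block the correction gives
  \<open>1 / (1 - q ^ m) - 1 = q ^ m / (1 - q ^ m)\<close>; for \<open>m = - n < 0\<close> the
  uncorrected value is \<open>- q ^ n / (1 - q ^ n)\<close>. Times \<open>- m\<close>, both are the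
  symmetric coefficient.\<close>

lemma contraction_correction:
  assumes m: "\<mu> a = - \<mu> b" "\<mu> a \<noteq> 0" and q: "norm q < 1" "q \<noteq> 0"
    and s: "s \<Longrightarrow> idx a = idx b \<and> \<mu> a > 0" "\<not> s \<Longrightarrow> idx a = idx b \<Longrightarrow> \<mu> a < 0"
  shows "contraction \<mu> \<alpha> a b * (1 / (1 - q powi \<mu> a) - (if s then 1 else 0)) = mode_contraction q idx \<alpha> a b (\<mu> a)"
proof -
  define n where "n = nat \<bar>\<mu> a\<bar>"
  have n: "n > 0" using m by (auto simp: n_def)
  have nz: "1 - q ^ n \<noteq> 0" "q ^ n \<noteq> 0" "q ^ n - 1 \<noteq> 0" using one_minus_power_nonzero[OF q(1) n] q by auto
  have con: "contraction \<mu> \<alpha> a b = - of_int (\<mu> a) * of_rat (pairing X (\<alpha> a) (\<alpha> b))"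
    using m(1) by (simp add: contraction_def)
  consider "s" | "\<not> s" "idx a = idx b" | "\<not> s" "idx a \<noteq> idx b" by blast
  then show ?thesis
  proof cases
    case 1
    have \<mu>: "\<mu> a = int n" using s(1)[OF 1] by (simp add: n_def)
    have "1 / (1 - q ^ n) - 1 = q ^ n / (1 - q ^ n)" using nz by (simp add: field_simps)
    then show ?thesis using 1 s(1)[OF 1] by (simp add: con mode_contraction_def \<mu>)
  next
    case 2
    have \<mu>: "\<mu> a = - int n" using s(2)[OF 2] by (simp add: n_def)
    have "1 / (1 - q powi (- int n)) = - (q ^ n / (1 - q ^ n))"
      using nz by (simp add: power_int_minus divide_simps)
    then show ?thesis using 2 by (simp add: con mode_contraction_def \<mu>)
  next
    case 3
    then show ?thesis by (simp add: con mode_contraction_def)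
  qed
qed

lemma remove_nth_filter:
  assumes "distinct L" "i < length L"
  shows "remove_nth i L = filter (\<lambda>c. c \<noteq> L ! i) L"
proof -
  have L: "L = take i L @ L ! i # drop (Suc i) L" by (rule id_take_nth_drop[OF assms(2)])
  have d: "distinct (take i L @ L ! i # drop (Suc i) L)" using L assms(1) by metis
  have "filter (\<lambda>c. c \<noteq> L ! i) (take i L @ L ! i # drop (Suc i) L) = take i L @ drop (Suc i) L"
    using d by (simp add: filter_neq_id)
  then show ?thesis using L by (metis remove_nth_def)
qed

lemma normal_ordered_recursion:
  fixes \<mu> :: "'l::linorder \<Rightarrow> int"
  assumes L: "sorted_wrt (before \<mu> idx) L" "set L = J"
    and a: "a \<in> J" "\<And>c. c \<in> J \<Longrightarrow> a \<le> c \<and> idx a \<le> idx c"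
    and J: "\<And>b. b \<in> J \<Longrightarrow> \<mu> b \<noteq> 0 \<and> \<alpha> b \<in> coh X (deg b)"
    and q: "norm q < 1" "q \<noteq> 0"
  defines "L' \<equiv> filter (\<lambda>c. c \<noteq> a) L"
  shows "koszul deg L * normalized_trace y q \<mu> \<alpha> L = mode_mean q \<alpha> a (\<mu> a) * (koszul deg L' * normalized_trace y q \<mu> \<alpha> L')
    + (\<Sum>b\<in>J - {a}. jump_sign deg (J - {a}) b * (if \<mu> a = - \<mu> b then mode_contraction q idx \<alpha> a b (\<mu> a) else 0)
      * (koszul deg (filter (\<lambda>c. c \<noteq> b) L') * normalized_trace y q \<mu> \<alpha> (filter (\<lambda>c. c \<noteq> b) L')))"
proof -
  define T where "T = normalized_trace y q \<mu> \<alpha>"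
  have dist: "distinct L" by (rule sorted_wrt_irrefl_distinct[OF L(1)]) (auto simp: before_def)
  obtain xs ys where xy: "L = xs @ a # ys" using a(1) L(2) by (metis split_list)
  have L'_eq: "L' = xs @ ys" using dist unfolding L'_def xy by (simp add: filter_neq_id)
  have setL': "set L' = J - {a}" using L(2) by (auto simp: L'_def)
  have distL': "distinct L'" using dist by (simp add: L'_def)
  have bxs: "before \<mu> idx c a" if "c \<in> set xs" for c using L(1) that by (simp add: xy sorted_wrt_append)
  have bys: "before \<mu> idx a c" if "c \<in> set ys" for c using L(1) that by (simp add: xy sorted_wrt_append)
  have memxs: "c \<in> J \<and> c \<noteq> a" if "c \<in> set xs" for c using that L(2) dist by (auto simp: xy)
  have memys: "c \<in> J \<and> c \<noteq> a" if "c \<in> set ys" for c using that L(2) dist by (auto simp: xy)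
  \<comment> \<open>A label standing before the least one can only be a negative mode of the same
    block that has overtaken the positive mode of \<open>a\<close>.\<close>
  have xs_props: "idx c = idx a" "\<mu> c < 0" "\<mu> a > 0" "a < c" if "c \<in> set xs" for c
    using bxs[OF that] a(2)[of c] memxs[OF that] by (auto simp: before_def)
  have ys_props: "idx a = idx c \<Longrightarrow> \<mu> a = - \<mu> c \<Longrightarrow> \<mu> a < 0" if "c \<in> set ys" for c
    using bys[OF that] J[OF a(1)] by (auto simp: before_def)
  have kos: "koszul deg L = koszul deg L' * move_sign deg a xs"
  proof -
    have "(\<Prod>c\<leftarrow>xs. if a < c then pair_sign deg a c else 1) = move_sign deg a xs"
      unfolding move_sign_prod using xs_props(4) by (intro arg_cong[where f = prod_list] map_cong) auto
    moreover have "(\<Prod>c\<leftarrow>ys. if c < a then pair_sign deg a c else 1) = 1"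
    proof -
      have "\<forall>c\<in>set ys. \<not> c < a" using a(2) memys leD by blast
      then show ?thesis by (induction ys) auto
    qed
    ultimately show ?thesis unfolding xy L'_eq koszul_remove by simp
  qed
  have J': "\<mu> b \<noteq> 0 \<and> \<alpha> b \<in> coh X (deg b)" if "b \<in> set L'" for b using that J setL' by auto
  have Cons: "T (a # L') = mode_mean q \<alpha> a (\<mu> a) * T L'
      + (\<Sum>i<length L'. move_sign deg a (take i L') * (contraction \<mu> \<alpha> a (L' ! i) / (1 - q powi \<mu> a)) * T (remove_nth i L'))"
    unfolding T_def mode_mean_def by (rule normalized_trace_Cons[OF y]) (use J J' a q in auto)
  have "T (a # xs @ ys) = move_sign deg a xs * T (xs @ a # ys)
    + (\<Sum>i<length xs. move_sign deg a (take i xs) * contraction \<mu> \<alpha> a (xs ! i) * T (remove_nth i xs @ ys))"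
    unfolding T_def by (rule normalized_trace_prefix) (use J J' a q L'_eq in auto)
  also have "(\<Sum>i<length xs. move_sign deg a (take i xs) * contraction \<mu> \<alpha> a (xs ! i) * T (remove_nth i xs @ ys))
      = (\<Sum>i<length L'. if i < length xs then move_sign deg a (take i L') * contraction \<mu> \<alpha> a (L' ! i) * T (remove_nth i L') else 0)"
    unfolding L'_eq by (rule sum.mono_neutral_cong_left) (auto simp: nth_append remove_nth_def)
  finally have pre: "move_sign deg a xs * T L = T (a # L')
      - (\<Sum>i<length L'. if i < length xs then move_sign deg a (take i L') * contraction \<mu> \<alpha> a (L' ! i) * T (remove_nth i L') else 0)"
    by (simp add: xy L'_eq)
  \<comment> \<open>The subtracted 1 is the plain contraction picked up from the labels in
    \<open>xs\<close>, which \<open>a\<close> passes on its way to the front.\<close>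
  define D where "D i = contraction \<mu> \<alpha> a (L' ! i) * (1 / (1 - q powi \<mu> a) - (if i < length xs then 1 else 0))" for i
  define E where "E i = move_sign deg a (take i L') * D i * T (remove_nth i L')" for i
  have ms: "move_sign deg a xs * T L = mode_mean q \<alpha> a (\<mu> a) * T L'
      + (\<Sum>i<length L'. E i)"
    unfolding pre Cons E_def D_def add_diff_eq[symmetric] sum_subtractf[symmetric]
    by (intro arg_cong2[where f = "(+)"] refl sum.cong) (auto simp: algebra_simps)
  define G where "G b = jump_sign deg (J - {a}) b * (if \<mu> a = - \<mu> b then mode_contraction q idx \<alpha> a b (\<mu> a) else 0)
    * (koszul deg (filter (\<lambda>c. c \<noteq> b) L') * T (filter (\<lambda>c. c \<noteq> b) L'))" for b
  have one: "koszul deg L' * E i = G (L' ! i)"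
    if i: "i < length L'" for i
  proof -
    define b where "b = L' ! i"
    have b: "b \<in> set L'" using i by (simp add: b_def)
    show ?thesis
    proof (cases "contraction \<mu> \<alpha> a b = 0")
      case True
      then have D0: "D i = 0" by (simp add: D_def b_def)
      have "(if \<mu> a = - \<mu> b then mode_contraction q idx \<alpha> a b (\<mu> a) else 0) = 0"
        using True J[OF a(1)] by (auto simp: contraction_def mode_contraction_def)
      then show ?thesis unfolding b_def[symmetric] E_def D0 G_def by simp
    next
      case False
      then have mm: "\<mu> a = - \<mu> b" by (auto simp: contraction_def split: if_splits)
      \<comment> \<open>Contracted labels have equal parity, so the sign of moving \<open>a\<close>
        up to \<open>b\<close> is that of moving \<open>b\<close> to the front, which
        \<open>koszul_remove_jump\<close> converts into \<open>jump_sign\<close>.\<close>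
      have par: "even (deg a) \<longleftrightarrow> even (deg b)"
        by (rule contraction_parity[where \<alpha> = \<alpha> and a = a and deg = deg and b = b and \<mu> = \<mu>]) (use J[OF a(1)] J'[OF b] False in auto)
      have Di: "D i = mode_contraction q idx \<alpha> a b (\<mu> a)"
        unfolding D_def b_def[symmetric]
      proof (rule contraction_correction)
        show "\<mu> a \<noteq> 0" using J[OF a(1)] by simp
        show "idx a = idx b \<and> 0 < \<mu> a" if "i < length xs"
        proof -
          have "b \<in> set xs" using that by (simp add: b_def L'_eq nth_append)
          then show ?thesis using xs_props by metis
        qed
        show "\<mu> a < 0" if "\<not> i < length xs" "idx a = idx b"
        proof -
          have "b \<in> set ys" using that(1) i by (auto simp: b_def L'_eq nth_append)
          then show ?thesis using ys_props that(2) mm by blast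
        qed
      qed (fact mm q)+
      have split: "L' = take i L' @ b # drop (Suc i) L'" unfolding b_def by (rule id_take_nth_drop[OF i])
      have sets: "set (take i L') \<union> set (drop (Suc i) L') = J - {a} - {b}"
      proof -
        have "insert b (set (take i L') \<union> set (drop (Suc i) L')) = J - {a}"
          using arg_cong[OF split, of set] setL' by auto
        moreover have "b \<notin> set (take i L') \<union> set (drop (Suc i) L')"
          using distL' by (subst (asm) split) auto
        ultimately show ?thesis by blast
      qed
      have "koszul deg L' * move_sign deg a (take i L') = koszul deg (take i L' @ b # drop (Suc i) L') * (\<Prod>c\<leftarrow>take i L'. pair_sign deg b c)"
        unfolding split[symmetric] move_sign_prod[symmetric] move_sign_parity[of deg a b, OF par] ..
      also have "\<dots> = jump_sign deg (J - {a} - {b}) b * koszul deg (take i L' @ drop (Suc i) L')"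
        unfolding sets[symmetric] by (rule koszul_remove_jump) (use distL' split in metis)
      also have "jump_sign deg (J - {a} - {b}) b = jump_sign deg (J - {a}) b"
        unfolding jump_sign_def by (intro prod.cong) auto
      also have "take i L' @ drop (Suc i) L' = filter (\<lambda>c. c \<noteq> b) L'"
        using remove_nth_filter[OF distL' i] by (simp add: remove_nth_def b_def)
      finally have "koszul deg L' * move_sign deg a (take i L') = jump_sign deg (J - {a}) b * koszul deg (filter (\<lambda>c. c \<noteq> b) L')" .
      note kms = this
      have alg: "A * (B * c * t) = j * c * (k * t)" if "A * B = j * k" for A B c t j k :: complex
        using arg_cong[OF that, of "\<lambda>z. z * c * t"] by (simp add: mult_ac)
      show ?thesis
        unfolding E_def G_def remove_nth_filter[OF distL' i] Di b_def[symmetric] if_P[OF mm] by (rule alg[OF kms])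
    qed
  qed
  have "koszul deg L * T L = koszul deg L' * (move_sign deg a xs * T L)" by (simp add: kos)
  also have "\<dots> = mode_mean q \<alpha> a (\<mu> a) * (koszul deg L' * T L')
      + (\<Sum>i<length L'. koszul deg L' * E i)"
    unfolding ms distrib_left sum_distrib_left by (simp add: mult_ac)
  also have "(\<Sum>i<length L'. koszul deg L' * E i)
    = (\<Sum>b\<in>J - {a}. G b)"
  proof -
    have "(\<Sum>i<length L'. koszul deg L' * E i)
        = (\<Sum>i<length L'. G (L' ! i))"
      by (rule sum.cong[OF refl one]) simp
    also have "\<dots> = (\<Sum>b\<in>J - {a}. G b)"
      by (rule sum.reindex_bij_betw[OF bij_betw_nth[OF distL' refl setL'[symmetric]]])
    finally show ?thesis .
  qed
  finally show ?thesis by (simp only: T_def G_def)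
qed

end

end


section \<open>Absolutely convergent sums\<close>

text \<open>Value and absolute summability travel together because the theorem asserts both and
  because products of sums are rearranged.\<close>

definition has_abs_sum :: "('a \<Rightarrow> complex) \<Rightarrow> 'a set \<Rightarrow> complex \<Rightarrow> bool" where
  "has_abs_sum f A s \<longleftrightarrow> (f has_sum s) A \<and> (\<lambda>x. norm (f x)) summable_on A"

lemma has_abs_sum_cong: "(\<And>x. x \<in> A \<Longrightarrow> f x = g x) \<Longrightarrow> has_abs_sum f A s \<longleftrightarrow> has_abs_sum g A s"
  unfolding has_abs_sum_def by (intro conj_cong has_sum_cong summable_on_cong) auto

lemma has_abs_sum_add:
  assumes "has_abs_sum f A s" "has_abs_sum g A t"
  shows "has_abs_sum (\<lambda>x. f x + g x) A (s + t)"
proof -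
  have "(\<lambda>x. norm (f x) + norm (g x)) summable_on A"
    using assms by (intro summable_on_add) (auto simp: has_abs_sum_def)
  then have "(\<lambda>x. norm (f x + g x)) summable_on A"
    by (rule Infinite_Sum.abs_summable_on_comparison_test') (auto intro: norm_triangle_ineq)
  then show ?thesis using assms by (auto simp: has_abs_sum_def intro: has_sum_add)
qed

lemma has_abs_sum_cmult: "has_abs_sum f A s \<Longrightarrow> has_abs_sum (\<lambda>x. c * f x) A (c * s)"
  unfolding has_abs_sum_def norm_mult by (auto intro: has_sum_cmult_right summable_on_cmult_right)

lemma has_abs_sum_0: "has_abs_sum (\<lambda>x. 0) A 0"
  by (simp add: has_abs_sum_def)

lemma has_abs_sum_sum:
  "finite I \<Longrightarrow> (\<And>i. i \<in> I \<Longrightarrow> has_abs_sum (f i) A (s i)) \<Longrightarrow> has_abs_sum (\<lambda>x. \<Sum>i\<in>I. f i x) A (\<Sum>i\<in>I. s i)"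
  by (induction I rule: finite_induct) (auto intro: has_abs_sum_0 has_abs_sum_add)

lemma has_abs_sum_product:
  assumes f: "has_abs_sum f A s" and g: "has_abs_sum g B t"
  shows "has_abs_sum (\<lambda>(x, y). f x * g y) (A \<times> B) (s * t)"
proof -
  have ab: "(\<lambda>p. norm ((\<lambda>(x, y). f x * g y) p)) summable_on (A \<times> B)"
    unfolding Infinite_Sum.abs_summable_on_Sigma_iff
  proof (intro conjI ballI)
    show "(\<lambda>y. norm (case (x, y) of (x, y) \<Rightarrow> f x * g y)) summable_on B" for x
      using g by (auto simp: has_abs_sum_def norm_mult intro: summable_on_cmult_right)
    have "(\<lambda>x. norm (f x) * (\<Sum>\<^sub>\<infinity>y\<in>B. norm (g y))) summable_on A"
      using f by (auto simp: has_abs_sum_def intro: summable_on_cmult_left)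
    then show "(\<lambda>x. norm (\<Sum>\<^sub>\<infinity>y\<in>B. norm (case (x, y) of (x, y) \<Rightarrow> f x * g y))) summable_on A"
      by (simp add: norm_mult infsum_cmult_right' abs_mult infsum_nonneg)
  qed
  then have sm: "(\<lambda>(x, y). f x * g y) summable_on (A \<times> B)" by (rule abs_summable_summable)
  have "infsum (\<lambda>(x, y). f x * g y) (A \<times> B) = (\<Sum>\<^sub>\<infinity>x\<in>A. \<Sum>\<^sub>\<infinity>y\<in>B. f x * g y)"
    using infsum_Sigma'_banach[OF sm] by simp
  also have "\<dots> = s * t"
  proof -
    have "infsum f A = s" "infsum g B = t" using f g by (auto simp: has_abs_sum_def intro: infsumI)
    then show ?thesis by (simp add: infsum_cmult_right' infsum_cmult_left')
  qed
  finally have "((\<lambda>(x, y). f x * g y) has_sum (s * t)) (A \<times> B)"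
    using sm by (metis has_sum_infsum)
  with ab show ?thesis by (simp add: has_abs_sum_def)
qed

lemma has_abs_sum_reindex_bij_witness:
  assumes "\<And>a. a \<in> S \<Longrightarrow> i (j a) = a" "\<And>a. a \<in> S \<Longrightarrow> j a \<in> T" "\<And>b. b \<in> T \<Longrightarrow> j (i b) = b"
    "\<And>b. b \<in> T \<Longrightarrow> i b \<in> S" "\<And>a. a \<in> S \<Longrightarrow> h (j a) = g a"
  shows "has_abs_sum g S s \<longleftrightarrow> has_abs_sum h T s"
  unfolding has_abs_sum_def
  using has_sum_reindex_bij_witness[of S i j T h g s s] summable_on_reindex_bij_witness[of S i j T "\<lambda>x. norm (h x)" "\<lambda>x. norm (g x)"] assms
  by auto

lemma has_abs_sum_PiE_insert:
  assumes a: "a \<notin> J" and f: "has_abs_sum f S s" and g: "has_abs_sum g (J \<rightarrow>\<^sub>E S) t"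
    and h: "\<And>\<mu>. \<mu> \<in> insert a J \<rightarrow>\<^sub>E S \<Longrightarrow> h \<mu> = f (\<mu> a) * g (restrict \<mu> J)"
  shows "has_abs_sum h (insert a J \<rightarrow>\<^sub>E S) (s * t)"
proof -
  have "has_abs_sum h (insert a J \<rightarrow>\<^sub>E S) (s * t) \<longleftrightarrow> has_abs_sum (\<lambda>(x, y). f x * g y) (S \<times> (J \<rightarrow>\<^sub>E S)) (s * t)"
    by (rule has_abs_sum_reindex_bij_witness[where i = "\<lambda>(m, \<mu>). \<mu>(a := m)" and j = "\<lambda>\<mu>. (\<mu> a, restrict \<mu> J)"])
       (use a h in \<open>auto simp: PiE_def extensional_def fun_eq_iff restrict_def\<close>)
  then show ?thesis using has_abs_sum_product[OF f g] by simp
qed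

text \<open>A contracted pair has two modes but only one free summation variable, since the
  contraction forces them to be opposite.\<close>

lemma has_abs_sum_antidiagonal:
  fixes f :: "int \<Rightarrow> complex"
  assumes "has_abs_sum f (UNIV - {0}) s"
  shows "has_abs_sum (\<lambda>(m, m'). if m = - m' then f m else 0) ((UNIV - {0}) \<times> (UNIV - {0})) s"
proof -
  let ?S = "UNIV - {0 :: int}"
  let ?D = "(\<lambda>m. (m, - m)) ` ?S"
  let ?g = "\<lambda>(m, m'). if m = - m' then f m else 0"
  have "has_abs_sum f ?S s \<longleftrightarrow> has_abs_sum ?g ?D s"
    by (rule has_abs_sum_reindex_bij_witness[where i = fst and j = "\<lambda>m. (m, - m)"]) auto
  then have D: "has_abs_sum ?g ?D s" using assms by simp
  have "(?g has_sum s) (?S \<times> ?S) \<longleftrightarrow> (?g has_sum s) ?D"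
    by (rule has_sum_cong_neutral) (auto simp: image_iff)
  moreover have "(\<lambda>p. norm (?g p)) summable_on (?S \<times> ?S) \<longleftrightarrow> (\<lambda>p. norm (?g p)) summable_on ?D"
    by (rule summable_on_cong_neutral) (auto simp: image_iff)
  ultimately show ?thesis using D by (simp add: has_abs_sum_def)
qed

lemma has_abs_sum_PiE_insert2:
  fixes f :: "int \<Rightarrow> complex"
  assumes ab: "a \<notin> J" "b \<notin> J" "a \<noteq> b" and f: "has_abs_sum f (UNIV - {0}) s"
    and g: "has_abs_sum g (J \<rightarrow>\<^sub>E UNIV - {0}) t"
    and h: "\<And>\<mu>. \<mu> \<in> insert a (insert b J) \<rightarrow>\<^sub>E UNIV - {0} \<Longrightarrow> h \<mu> = (if \<mu> a = - \<mu> b then f (\<mu> a) else 0) * g (restrict \<mu> J)"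
  shows "has_abs_sum h (insert a (insert b J) \<rightarrow>\<^sub>E UNIV - {0}) (s * t)"
proof -
  let ?S = "UNIV - {0 :: int}"
  have "has_abs_sum h (insert a (insert b J) \<rightarrow>\<^sub>E ?S) (s * t) \<longleftrightarrow>
     has_abs_sum (\<lambda>(x, y). (\<lambda>(m, m'). if m = - m' then f m else 0) x * g y) ((?S \<times> ?S) \<times> (J \<rightarrow>\<^sub>E ?S)) (s * t)"
    by (rule has_abs_sum_reindex_bij_witness[where i = "\<lambda>((m, m'), \<mu>). \<mu>(a := m, b := m')" and j = "\<lambda>\<mu>. ((\<mu> a, \<mu> b), restrict \<mu> J)"])
       (use ab h in \<open>auto simp: PiE_iff extensional_def fun_eq_iff restrict_def fun_upd_def split: if_splits\<close>)
  then show ?thesis using has_abs_sum_product[OF has_abs_sum_antidiagonal[OF f] g] by simp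
qed

lemma has_abs_sum_nonzero_int:
  fixes f :: "int \<Rightarrow> complex"
  assumes "has_abs_sum (\<lambda>n. f (- int n)) {1..} A" "has_abs_sum (\<lambda>n. f (int n)) {1..} B"
  shows "has_abs_sum f (UNIV - {0}) (A + B)"
  using assms has_sum_nonzero_int[of f A B] summable_on_nonzero_int[of "\<lambda>m. norm (f m)"]
  by (simp add: has_abs_sum_def)

lemma Lambert_has_abs_sum:
  "norm q < 1 \<Longrightarrow> norm w < 1 \<Longrightarrow> has_abs_sum (\<lambda>n. of_nat n ^ k * w ^ n / (1 - q ^ n)) {1..} (eval_fps (Lambert k q) w)"
  unfolding has_abs_sum_def using Lambert_has_sum by blast

lemma has_abs_sum_Lambert_pair:
  fixes f :: "int \<Rightarrow> complex"
  assumes q: "norm q < 1" and w: "norm w < 1" "norm w' < 1"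
    and f: "\<And>n. n > 0 \<Longrightarrow> f (- int n) = c * (of_nat n ^ k * w ^ n / (1 - q ^ n))"
      "\<And>n. n > 0 \<Longrightarrow> f (int n) = c' * (of_nat n ^ k * w' ^ n / (1 - q ^ n))"
  shows "has_abs_sum f (UNIV - {0}) (c * eval_fps (Lambert k q) w + c' * eval_fps (Lambert k q) w')"
proof (rule has_abs_sum_nonzero_int)
  show "has_abs_sum (\<lambda>n. f (- int n)) {1..} (c * eval_fps (Lambert k q) w)"
    by (rule has_abs_sum_cong[THEN iffD2, OF _ has_abs_sum_cmult[OF Lambert_has_abs_sum[OF q w(1)]]]) (simp add: f)
  show "has_abs_sum (\<lambda>n. f (int n)) {1..} (c' * eval_fps (Lambert k q) w')"
    by (rule has_abs_sum_cong[THEN iffD2, OF _ has_abs_sum_cmult[OF Lambert_has_abs_sum[OF q w(2)]]]) (simp add: f)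
qed

lemma inverse_one_minus_power_neg:
  assumes "norm q < 1" "q \<noteq> 0" "n > 0"
  shows "1 / (1 - q powi (- int n)) = - (q ^ n / (1 - q ^ n) :: complex)"
    and "q powi (- int n) / (1 - q powi (- int n)) = - (1 / (1 - q ^ n) :: complex)"
  using one_minus_power_nonzero[OF assms(1,3)] assms(2)
  by (auto simp: power_int_minus divide_simps) (simp_all add: algebra_simps)

section \<open>Scalar functions\<close>

lemma Zhat_eq:
  assumes "norm q < norm u" "norm u < 1"
  shows "Zhat q u = eval_fps (Lambert 0 q) u + (-1) * eval_fps (Lambert 0 q) (q / u)"
proof -
  have q: "norm q < 1" and qu: "norm (q / u) < 1" using assms by (auto simp: norm_divide divide_less_eq)
  have "((\<lambda>n. of_nat n ^ 0 * u ^ n / (1 - q ^ n) + (-1) * (of_nat n ^ 0 * (q / u) ^ n / (1 - q ^ n))) has_sum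
    eval_fps (Lambert 0 q) u + (-1) * eval_fps (Lambert 0 q) (q / u)) {1..}"
    by (intro has_sum_add has_sum_cmult_right Lambert_has_sum q qu assms(2))
  then show ?thesis
    unfolding Zhat_def by (intro infsumI) (simp add: divide_inverse power_mult_distrib power_inverse mult_ac)
qed

lemma Pfun_eq:
  assumes "norm q < norm u" "norm u < 1"
  shows "Pfun q u = eval_fps (Lambert 1 q) u + 1 * eval_fps (Lambert 1 q) (q / u)"
proof -
  have q: "norm q < 1" and qu: "norm (q / u) < 1" using assms by (auto simp: norm_divide divide_less_eq)
  have "((\<lambda>n. of_nat n ^ 1 * u ^ n / (1 - q ^ n) + of_nat n ^ 1 * (q / u) ^ n / (1 - q ^ n)) has_sum
    eval_fps (Lambert 1 q) u + eval_fps (Lambert 1 q) (q / u)) {1..}"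
    by (intro has_sum_add Lambert_has_sum q qu assms(2))
  then have "((\<lambda>n. of_nat n * (u ^ n / (1 - q ^ n) + q ^ n * inverse u ^ n / (1 - q ^ n))) has_sum
    eval_fps (Lambert 1 q) u + eval_fps (Lambert 1 q) (q / u)) {1..}"
    by (simp add: divide_inverse power_mult_distrib power_inverse algebra_simps)
  then show ?thesis unfolding Pfun_def by (simp add: infsumI)
qed

lemma Tfun_eq:
  assumes "norm q < 1"
  shows "Tfun (D + 2) q = eval_fps (Lambert (Suc D) q) q"
  using Lambert_has_sum(1)[OF assms assms, of "Suc D"] unfolding Tfun_def by (intro infsumI) simp

lemma even_power_minus_int: "even d \<Longrightarrow> (- of_int m :: complex) ^ d = of_int m ^ d"
  by (simp add: power_minus_even)

context nakajima_fock
begin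

text \<open>With \<open>u = x / y\<close>, the modes \<open>m = - n\<close> give
  \<open>u ^ n / (1 - q ^ n)\<close> and the modes \<open>m = n\<close> give
  \<open>- (q / u) ^ n / (1 - q ^ n)\<close>, the two parts of \<open>Zhat\<close>.\<close>

lemma mode_mean_sum:
  assumes q: "norm q < 1" "q \<noteq> 0" and u: "norm q < norm (x / y)" "norm (x / y) < 1" and d: "even d"
  shows "has_abs_sum (\<lambda>m. (- of_int m) ^ d * x powi (- m) * mode_mean y q \<alpha> a m) (UNIV - {0})
    (of_rat (integral\<^sub>X X (\<alpha> a)) * (Dlog ^^ d) (Zhat q) (x / y))"
proof -
  let ?u = "x / y" and ?c = "of_rat (integral\<^sub>X X (\<alpha> a)) :: complex"
  have u0: "x \<noteq> 0" "y \<noteq> 0" using u q by auto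
  have qu: "norm (q / ?u) < 1" using u by (simp add: norm_divide divide_less_eq del: divide_divide_eq_right)
  have Z: "(Dlog ^^ d) (Zhat q) ?u = eval_fps (Lambert d q) ?u + (-1) * eval_fps (Lambert d q) (q / ?u)"
    using Dlog_pow_Lambert[OF q(1), of "Zhat q" 0 "-1" ?u d] Zhat_eq u d by simp
  have "has_abs_sum (\<lambda>m. (- of_int m) ^ d * x powi (- m) * mode_mean y q \<alpha> a m) (UNIV - {0})
    (?c * eval_fps (Lambert d q) ?u + (- ?c) * eval_fps (Lambert d q) (q / ?u))"
  proof (rule has_abs_sum_Lambert_pair[OF q(1) u(2) qu])
    fix n :: nat assume n: "n > 0"
    show "(- of_int (- int n)) ^ d * x powi (- (- int n)) * mode_mean y q \<alpha> a (- int n) = ?c * (of_nat n ^ d * ?u ^ n / (1 - q ^ n))"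
      unfolding mode_mean_def[OF u0(2)] inverse_one_minus_power_neg(2)[OF q n]
      by (simp add: power_int_minus power_divide divide_inverse power_mult_distrib power_inverse mult_ac)
    show "(- of_int (int n)) ^ d * x powi (- int n) * mode_mean y q \<alpha> a (int n) = - ?c * (of_nat n ^ d * (q / ?u) ^ n / (1 - q ^ n))"
      unfolding mode_mean_def[OF u0(2)] even_power_minus_int[OF d]
      by (simp add: power_int_minus power_divide power_mult_distrib divide_inverse mult_ac power_inverse)
  qed
  then show ?thesis unfolding Z by (simp add: algebra_simps)
qed

text \<open>With \<open>u = x' / x\<close>, positive modes at the first label give
  \<open>u ^ n\<close> and negative ones \<open>(q / u) ^ n\<close>, the two parts of
  \<open>Pfun\<close>. The signs left by differentiation are even powers of -1.\<close>

lemma mode_contraction_sum_distinct: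
  assumes q: "norm q < 1" "q \<noteq> 0" and u: "norm q < norm (x' / x)" "norm (x' / x) < 1" and d: "even d" "even d'"
    and idx: "idx a \<noteq> idx b"
  shows "has_abs_sum (\<lambda>m. ((- of_int m) ^ d * x powi (- m)) * ((- of_int (- m)) ^ d' * x' powi (- (- m))) * mode_contraction q idx \<alpha> a b m) (UNIV - {0})
    (- of_rat (pairing X (\<alpha> a) (\<alpha> b)) * (Dlog ^^ (d + d')) (Pfun q) (x' / x))"
proof -
  let ?u = "x' / x" and ?c = "- of_rat (pairing X (\<alpha> a) (\<alpha> b)) :: complex"
  have u0: "x \<noteq> 0" "x' \<noteq> 0" using u q by auto
  have qu: "norm (q / ?u) < 1" using u by (simp add: norm_divide divide_less_eq del: divide_divide_eq_right)
  have P: "(Dlog ^^ (d + d')) (Pfun q) ?u = eval_fps (Lambert (Suc (d + d')) q) ?u + eval_fps (Lambert (Suc (d + d')) q) (q / ?u)"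
    using Dlog_pow_Lambert[OF q(1), of "Pfun q" 1 1 ?u "d + d'"] Pfun_eq u d by simp
  let ?f = "\<lambda>m. ((- of_int m) ^ d * x powi (- m)) * ((- of_int (- m)) ^ d' * x' powi (- (- m))) * mode_contraction q idx \<alpha> a b m"
  have "has_abs_sum ?f (UNIV - {0})
    (?c * eval_fps (Lambert (Suc (d + d')) q) (q / ?u) + ?c * eval_fps (Lambert (Suc (d + d')) q) ?u)"
  proof (rule has_abs_sum_Lambert_pair[OF q(1) qu u(2)])
    fix n :: nat assume n: "n > 0"
    have mc: "mode_contraction q idx \<alpha> a b (- int n) = ?c * (of_nat n * q ^ n / (1 - q ^ n))"
      "mode_contraction q idx \<alpha> a b (int n) = ?c * (of_nat n / (1 - q ^ n))"
      using idx inverse_one_minus_power_neg(1)[OF q n] by (simp_all add: mode_contraction_def divide_inverse mult_ac)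
    show "?f (- int n) = ?c * (of_nat n ^ Suc (d + d') * (q / ?u) ^ n / (1 - q ^ n))"
      "?f (int n) = ?c * (of_nat n ^ Suc (d + d') * ?u ^ n / (1 - q ^ n))"
      unfolding mc even_power_minus_int[OF d(1)] even_power_minus_int[OF d(2)] using d
      by (simp_all add: power_int_minus power_divide power_mult_distrib power_add divide_inverse mult_ac power_inverse)
  qed
  then show ?thesis unfolding P by (simp add: algebra_simps)
qed

text \<open>The powers of \<open>x\<close> cancel and the rest depends only on \<open>|m|\<close>,
  so \<open>m\<close> and \<open>- m\<close> contribute equally; this is the factor 2. The factor
  \<open>|m|\<close> of the contraction adds one to the exponent \<open>d + d'\<close>, as in
  \<open>Tfun (d + d' + 2)\<close>.\<close>

lemma mode_contraction_sum_same:
  assumes q: "norm q < 1" "q \<noteq> 0" and x: "x \<noteq> 0" and d: "even d" "even d'"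
    and idx: "idx a = idx b"
  shows "has_abs_sum (\<lambda>m. ((- of_int m) ^ d * x powi (- m)) * ((- of_int (- m)) ^ d' * x powi (- (- m))) * mode_contraction q idx \<alpha> a b m) (UNIV - {0})
    (- 2 * of_rat (pairing X (\<alpha> a) (\<alpha> b)) * Tfun (d + d' + 2) q)"
proof -
  let ?c = "- of_rat (pairing X (\<alpha> a) (\<alpha> b)) :: complex"
  let ?f = "\<lambda>m. ((- of_int m) ^ d * x powi (- m)) * ((- of_int (- m)) ^ d' * x powi (- (- m))) * mode_contraction q idx \<alpha> a b m"
  have xx: "x powi (- m) * x powi (- (- m)) = 1" for m using x by (simp add: power_int_minus)
  have f: "?f m = of_int m ^ (d + d') * mode_contraction q idx \<alpha> a b m" for m
    using xx[of m] d by (simp add: power_add mult_ac)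
  have abs: "(of_int m :: complex) ^ (d + d') = of_int \<bar>m\<bar> ^ (d + d')" for m
    using d by (cases "m < 0") auto
  have pm: "?c * (of_nat n ^ Suc (d + d') * q ^ n / (1 - q ^ n)) = ?f m" if "\<bar>m\<bar> = int n" for m n
  proof -
    have "?f m = of_int \<bar>m\<bar> ^ (d + d') * mode_contraction q idx \<alpha> a b m"
      by (rule trans[OF f arg_cong[where f = "\<lambda>z. z * _", OF abs]])
    also have "\<dots> = ?c * (of_nat n ^ Suc (d + d') * q ^ n / (1 - q ^ n))"
      unfolding that mode_contraction_def using idx by (simp add: divide_inverse mult_ac)
    finally show ?thesis by (rule sym)
  qed
  have "has_abs_sum ?f (UNIV - {0}) (?c * eval_fps (Lambert (Suc (d + d')) q) q + ?c * eval_fps (Lambert (Suc (d + d')) q) q)"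
    by (rule has_abs_sum_Lambert_pair[OF q(1) q(1) q(1)]) (rule pm[symmetric], simp)+
  then show ?thesis unfolding Tfun_eq[OF q(1)] by (simp add: algebra_simps)
qed

section \<open>Summation over mode assignments\<close>

text \<open>Strong induction on the number of labels, as the recursion removes one label or a
  contracted pair. The weights enter only through the one-variable sums \<open>M\<close> and
  \<open>K\<close>, which keeps the chamber and the derivatives out of the combinatorics.\<close>

lemma normal_ordered_sum:
  fixes idx :: "'l::linorder \<Rightarrow> nat"
  assumes y: "y \<noteq> 0" and q: "norm q < 1" "q \<noteq> 0" and J: "finite J"
    and homog: "\<And>a. a \<in> J \<Longrightarrow> \<alpha> a \<in> coh X (deg a)" and idx: "\<And>a. a \<in> J \<Longrightarrow> idx a \<in> {1..N}"
    and mono: "\<And>a b. a \<in> J \<Longrightarrow> b \<in> J \<Longrightarrow> a < b \<Longrightarrow> idx a \<le> idx b"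
    and M: "\<And>a. a \<in> J \<Longrightarrow> has_abs_sum (\<lambda>m. e a m * mode_mean y q \<alpha> a m) (UNIV - {0}) (M a)"
    and K: "\<And>a b. a \<in> J \<Longrightarrow> b \<in> J \<Longrightarrow> a < b \<Longrightarrow>
      has_abs_sum (\<lambda>m. e a m * e b (- m) * mode_contraction q idx \<alpha> a b m) (UNIV - {0}) (K a b)"
  shows "has_abs_sum (\<lambda>\<mu>. (\<Prod>a\<in>J. e a (\<mu> a)) *
      (koszul deg (normal_list N idx \<mu> J) * normalized_trace y q \<mu> \<alpha> (normal_list N idx \<mu> J)))
    (J \<rightarrow>\<^sub>E UNIV - {0}) (pairing_sum deg M K J)"
  using J homog idx mono M K
proof (induction "card J" arbitrary: J rule: less_induct)
  case less
  define w where "w J \<mu> = koszul deg (normal_list N idx \<mu> J) * normalized_trace y q \<mu> \<alpha> (normal_list N idx \<mu> J)" for J \<mu>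
  define tm where "tm J \<mu> = (\<Prod>a\<in>J. e a (\<mu> a)) * w J \<mu>" for J \<mu>
  show ?case
  proof (cases "J = {}")
    case True
    have "normal_list N idx \<mu> {} = []" for \<mu>
      by (auto simp: normal_list_def normal_order_def concat_eq_Nil_conv)
    then have "tm {} \<mu> = 1" for \<mu>
      by (simp add: tm_def w_def koszul_Nil normalized_trace_Nil[OF y q(1)])
    then have "has_abs_sum (tm {}) ({} \<rightarrow>\<^sub>E UNIV - {0}) 1"
      by (simp add: has_abs_sum_def PiE_empty_domain has_sum_finite_iff)
    then show ?thesis by (simp add: True tm_def[abs_def] w_def pairing_sum_empty)
  next
    case False
    define a where "a = Min J"
    have a: "a \<in> J" and a_le: "\<And>c. c \<in> J \<Longrightarrow> a \<le> c" using False less.prems(1) by (auto simp: a_def)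
    have IH: "has_abs_sum (tm J') (J' \<rightarrow>\<^sub>E UNIV - {0}) (pairing_sum deg M K J')" if "J' \<subset> J" for J'
    proof -
      have "card J' < card J" using that less.prems(1) by (rule psubset_card_mono[rotated])
      moreover have "finite J'" using that less.prems(1) finite_subset by blast
      ultimately show ?thesis
        unfolding tm_def w_def
      proof (rule less.hyps)
        have sub: "c \<in> J" if "c \<in> J'" for c using that \<open>J' \<subset> J\<close> by auto
        show "\<alpha> a \<in> coh X (deg a)" if "a \<in> J'" for a by (rule less.prems(2)[OF sub[OF that]])
        show "idx a \<in> {1..N}" if "a \<in> J'" for a by (rule less.prems(3)[OF sub[OF that]])
        show "idx a \<le> idx b" if "a \<in> J'" "b \<in> J'" "a < b" for a b
          by (rule less.prems(4)[OF sub[OF that(1)] sub[OF that(2)] that(3)])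
        show "has_abs_sum (\<lambda>m. e a m * mode_mean y q \<alpha> a m) (UNIV - {0}) (M a)" if "a \<in> J'" for a
          by (rule less.prems(5)[OF sub[OF that]])
        show "has_abs_sum (\<lambda>m. e a m * e b (- m) * mode_contraction q idx \<alpha> a b m) (UNIV - {0}) (K a b)"
          if "a \<in> J'" "b \<in> J'" "a < b" for a b
          by (rule less.prems(6)[OF sub[OF that(1)] sub[OF that(2)] that(3)])
      qed
    qed
    \<comment> \<open>A term for fewer labels sees only the modes of those labels; this lets the sum
      over assignments split into a product.\<close>
    have tm_restrict: "tm J' (restrict \<mu> J') = tm J' \<mu>" if "J' \<subseteq> J" for J' \<mu>
    proof -
      have fin: "finite J'" using that less.prems(1) finite_subset by blast
      have nl: "normal_list N idx (restrict \<mu> J') J' = normal_list N idx \<mu> J'" by (rule normal_list_cong[OF fin]) simp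
      have sub: "set (normal_list N idx \<mu> J') \<subseteq> J'" using fin by (auto simp: normal_list_def set_normal_order)
      have "nak_word (restrict \<mu> J') \<alpha> L v = nak_word \<mu> \<alpha> L v" if "set L \<subseteq> J'" for L v
        using that by (induction L) auto
      then have "normalized_trace y q (restrict \<mu> J') \<alpha> (normal_list N idx \<mu> J') = normalized_trace y q \<mu> \<alpha> (normal_list N idx \<mu> J')"
        using sub by (simp add: normalized_trace_def[OF y] trace_fps_def[OF y] level_trace_def[OF y])
      then show ?thesis by (simp add: tm_def w_def nl)
    qed
    define m1 where "m1 \<mu> = e a (\<mu> a) * mode_mean y q \<alpha> a (\<mu> a)" for \<mu>
    define c where "c b \<mu> = (if \<mu> a = - \<mu> b then mode_contraction q idx \<alpha> a b (\<mu> a) else 0)" for b \<mu>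
    \<comment> \<open>Writing \<open>e b (- \<mu> a)\<close> for \<open>e b (\<mu> b)\<close> makes
      the contracted factor a function of the single mode \<open>\<mu> a\<close>, as
      \<open>has_abs_sum_PiE_insert2\<close> requires.\<close>
    define k where "k b \<mu> = (if \<mu> a = - \<mu> b then e a (\<mu> a) * e b (- \<mu> a) * mode_contraction q idx \<alpha> a b (\<mu> a) else 0)" for b \<mu>
    have rec: "tm J \<mu> = m1 \<mu> * tm (J - {a}) \<mu>
        + (\<Sum>b\<in>J - {a}. jump_sign deg (J - {a}) b * (k b \<mu> * tm (J - {a, b}) \<mu>))"
      if \<mu>: "\<mu> \<in> J \<rightarrow>\<^sub>E UNIV - {0}" for \<mu>
    proof -
      have nz: "\<mu> b \<noteq> 0" if "b \<in> J" for b using \<mu> that by (auto simp: PiE_def Pi_def)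
      have "w J \<mu> = mode_mean y q \<alpha> a (\<mu> a) * w (J - {a}) \<mu>
        + (\<Sum>b\<in>J - {a}. jump_sign deg (J - {a}) b * c b \<mu> * w (J - {a} - {b}) \<mu>)"
      proof -
        have S: "sorted_wrt (before \<mu> idx) (normal_list N idx \<mu> J)" by (rule normal_list_sorted) fact
        have set: "set (normal_list N idx \<mu> J) = J"
          by (rule normal_list_set) (use less.prems(1,3) nz in auto)
        have min: "a \<le> c \<and> idx a \<le> idx c" if "c \<in> J" for c
          using a_le[OF that] less.prems(4)[OF a that] by (cases "a = c") auto
        have fin': "finite (J - {a})" using less.prems(1) by simp
        show ?thesis
          unfolding w_def c_def normal_list_remove[OF fin'] normal_list_remove[OF less.prems(1)]
          by (rule normal_ordered_recursion[OF y S set a min _ q]) (use nz less.prems(2) in auto)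
      qed
      then have "tm J \<mu> = (\<Prod>c\<in>J. e c (\<mu> c)) * (mode_mean y q \<alpha> a (\<mu> a) * w (J - {a}) \<mu>)
        + (\<Sum>b\<in>J - {a}. (\<Prod>c\<in>J. e c (\<mu> c)) * (jump_sign deg (J - {a}) b * c b \<mu> * w (J - {a} - {b}) \<mu>))"
        by (simp add: tm_def distrib_left sum_distrib_left)
      also have "(\<Prod>c\<in>J. e c (\<mu> c)) * (mode_mean y q \<alpha> a (\<mu> a) * w (J - {a}) \<mu>) = m1 \<mu> * tm (J - {a}) \<mu>"
        unfolding tm_def m1_def prod.remove[OF less.prems(1) a] by (simp add: mult_ac)
      also have "(\<Sum>b\<in>J - {a}. (\<Prod>c\<in>J. e c (\<mu> c)) * (jump_sign deg (J - {a}) b * c b \<mu> * w (J - {a} - {b}) \<mu>))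
        = (\<Sum>b\<in>J - {a}. jump_sign deg (J - {a}) b * (k b \<mu> * tm (J - {a, b}) \<mu>))"
      proof (rule sum.cong[OF refl])
        fix b assume b: "b \<in> J - {a}"
        have JJ: "J - {a} - {b} = J - {a, b}" by auto
        have p: "(\<Prod>c\<in>J. e c (\<mu> c)) = e a (\<mu> a) * (e b (\<mu> b) * (\<Prod>c\<in>J - {a, b}. e c (\<mu> c)))"
          using less.prems(1) b unfolding prod.remove[OF less.prems(1) a] JJ[symmetric] by (subst prod.remove[of "J - {a}" b]) auto
        show "(\<Prod>c\<in>J. e c (\<mu> c)) * (jump_sign deg (J - {a}) b * c b \<mu> * w (J - {a} - {b}) \<mu>)
          = jump_sign deg (J - {a}) b * (k b \<mu> * tm (J - {a, b}) \<mu>)"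
          unfolding p JJ tm_def k_def c_def by (simp add: mult_ac)
      qed
      finally show ?thesis .
    qed
    have s1: "has_abs_sum (\<lambda>\<mu>. m1 \<mu> * tm (J - {a}) \<mu>) (J \<rightarrow>\<^sub>E UNIV - {0}) (M a * pairing_sum deg M K (J - {a}))"
    proof -
      have ins: "J = insert a (J - {a})" using a by auto
      show ?thesis
        by (subst ins, rule has_abs_sum_PiE_insert[OF _ less.prems(5)[OF a] IH[of "J - {a}"]]) (use a in \<open>auto simp: tm_restrict m1_def\<close>)
    qed
    have s2: "has_abs_sum (\<lambda>\<mu>. k b \<mu> * tm (J - {a, b}) \<mu>)
        (J \<rightarrow>\<^sub>E UNIV - {0}) (K a b * pairing_sum deg M K (J - {a, b}))" if b: "b \<in> J - {a}" for b
    proof -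
      have ins: "J = insert a (insert b (J - {a, b}))" using a b by auto
      have ab: "a < b" using a_le[of b] b by auto
      show ?thesis
        by (subst ins, rule has_abs_sum_PiE_insert2[OF _ _ _ less.prems(6)[OF a _ ab] IH[of "J - {a, b}"]]) (use a b in \<open>auto simp: tm_restrict k_def\<close>)
    qed
    have "has_abs_sum (\<lambda>\<mu>. m1 \<mu> * tm (J - {a}) \<mu>
        + (\<Sum>b\<in>J - {a}. jump_sign deg (J - {a}) b * (k b \<mu> * tm (J - {a, b}) \<mu>)))
      (J \<rightarrow>\<^sub>E UNIV - {0}) (M a * pairing_sum deg M K (J - {a}) + (\<Sum>b\<in>J - {a}. jump_sign deg (J - {a}) b * (K a b * pairing_sum deg M K (J - {a, b}))))"
      by (intro has_abs_sum_add s1 has_abs_sum_sum has_abs_sum_cmult s2) (use less.prems(1) in auto)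
    then have "has_abs_sum (tm J) (J \<rightarrow>\<^sub>E UNIV - {0}) (M a * pairing_sum deg M K (J - {a}) + (\<Sum>b\<in>J - {a}. jump_sign deg (J - {a}) b * (K a b * pairing_sum deg M K (J - {a, b}))))"
      by (rule has_abs_sum_cong[THEN iffD2, rotated]) (rule rec)
    moreover have "pairing_sum deg M K J = M a * pairing_sum deg M K (J - {a})
        + (\<Sum>b\<in>J - {a}. jump_sign deg (J - {a}) b * (K a b * pairing_sum deg M K (J - {a, b})))"
      unfolding mult.assoc[symmetric] by (rule pairing_sum_step) (use less.prems(1) a a_le in auto)
    ultimately show ?thesis by (simp add: tm_def[abs_def] w_def)
  qed
qed

lemma nak_word_scale: "(\<And>a. a \<in> set as \<Longrightarrow> \<mu> a \<noteq> 0) \<Longrightarrow> nak_word \<mu> \<alpha> as (sc c v) = sc c (nak_word \<mu> \<alpha> as v)"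
  by (rule lin_scale[OF lin_nak_word])

text \<open>Labels increase from block to block, so no inversion joins two blocks, and the blockwise
  Koszul signs multiply to the sign of the concatenated list.\<close>

lemma foldr_block_monomial:
  fixes H :: "nat \<Rightarrow> 'l::linorder set"
  assumes "sorted_wrt (<) is" "\<And>i. i \<in> set is \<Longrightarrow> finite (H i)" "\<And>i a. i \<in> set is \<Longrightarrow> a \<in> H i \<Longrightarrow> \<mu> a \<noteq> 0"
    and less: "\<And>i j a b. i \<in> set is \<Longrightarrow> j \<in> set is \<Longrightarrow> i < j \<Longrightarrow> a \<in> H i \<Longrightarrow> b \<in> H j \<Longrightarrow> a < b"
  shows "foldr (\<lambda>i. block_monomial F \<alpha> deg \<mu> (H i)) is v =
    sc (koszul deg (concat (map (\<lambda>i. normal_order \<mu> (sorted_list_of_set (H i))) is)))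
      (nak_word \<mu> \<alpha> (concat (map (\<lambda>i. normal_order \<mu> (sorted_list_of_set (H i))) is)) v)"
  using assms
proof (induction "is")
  case Nil
  show ?case by (simp add: koszul_Nil)
next
  case (Cons i js)
  define A where "A = normal_order \<mu> (sorted_list_of_set (H i))"
  define B where "B = concat (map (\<lambda>i. normal_order \<mu> (sorted_list_of_set (H i))) js)"
  have IH: "foldr (\<lambda>i. block_monomial F \<alpha> deg \<mu> (H i)) js v = sc (koszul deg B) (nak_word \<mu> \<alpha> B v)"
    unfolding B_def
  proof (rule Cons.IH)
    show "a < b" if "k \<in> set js" "j \<in> set js" "k < j" "a \<in> H k" "b \<in> H j" for k j a b
      by (rule Cons.prems(4)[of k j]) (use that in auto)
  qed (use Cons.prems(1-3) in auto)
  have setA: "set A \<subseteq> H i" using Cons.prems(2)[of i] by (auto simp: A_def set_normal_order)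
  have setB: "\<exists>j\<in>set js. b \<in> H j" if "b \<in> set B" for b
    using that Cons.prems(2) by (auto simp: B_def set_normal_order)
  have kos: "koszul deg (A @ B) = koszul deg A * koszul deg B"
  proof (rule koszul_append)
    fix a b assume ab: "a \<in> set A" "b \<in> set B"
    obtain j where j: "j \<in> set js" "b \<in> H j" using setB[OF ab(2)] by blast
    show "a < b" by (rule Cons.prems(4)[of i j]) (use j ab setA Cons.prems(1) in auto)
  qed
  have "block_monomial F \<alpha> deg \<mu> (H i) w = sc (koszul deg A) (nak_word \<mu> \<alpha> A w)" for w
    by (simp add: block_monomial_def A_def nak_word_def Let_def)
  moreover have "nak_word \<mu> \<alpha> A (sc c w) = sc c (nak_word \<mu> \<alpha> A w)" for c w
    by (rule nak_word_scale) (use setA Cons.prems(3)[of i] in auto)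
  ultimately show ?case
    by (simp add: IH A_def[symmetric] B_def[symmetric] kos)
qed

end

section \<open>The chamber and the product of the blocks\<close>

lemma block_index_eq:
  fixes H :: "nat \<Rightarrow> 'l::linorder set"
  assumes "concatenated N H" "i \<in> {1..N}" "a \<in> H i"
  shows "block_index N H a = i"
  unfolding block_index_def
proof (rule the_equality)
  fix j assume j: "j \<in> {1..N} \<and> a \<in> H j"
  show "j = i"
    using assms j unfolding concatenated_def by (metis less_irrefl linorder_neqE_nat)
qed (use assms in auto)

text \<open>Since \<open>norm (x i) = exp (- 2 * pi * Im (z i))\<close>, both bounds together say
  \<open>0 < Im (z j) - Im (z i) < Im \<tau>\<close>. The index \<open>i = 0\<close> covers the
  ratios with \<open>y\<close>.\<close>

lemma chamber_ratios:
  fixes z x :: "nat \<Rightarrow> complex"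
  assumes q: "q = exp (2 * of_real pi * \<i> * \<tau>)"
    and x: "\<And>i. i \<le> N \<Longrightarrow> x i = exp (2 * of_real pi * \<i> * z i)"
    and z: "0 \<le> Im (z 0)" "\<And>i. i < N \<Longrightarrow> Im (z i) < Im (z (Suc i))" "Im (z N) < Im \<tau>"
    and ij: "i < j" "j \<le> N"
  shows "norm q < norm (x j / x i)" "norm (x j / x i) < 1"
proof -
  have mono: "i < j \<Longrightarrow> j \<le> N \<Longrightarrow> Im (z i) < Im (z j)" for i j
  proof (induction j)
    case (Suc j)
    then show ?case using z(2)[of j] by (cases "i = j") auto
  qed simp
  have nq: "norm q = exp (- 2 * pi * Im \<tau>)" by (simp add: q norm_exp_eq_Re)
  have nx: "norm (x k) = exp (- 2 * pi * Im (z k))" if "k \<le> N" for k using x[OF that] by (simp add: norm_exp_eq_Re)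
  have ratio: "norm (x j / x i) = exp (- 2 * pi * (Im (z j) - Im (z i)))"
    using ij by (simp add: norm_divide nx exp_diff[symmetric] algebra_simps)
  have lt: "Im (z i) < Im (z j)" by (rule mono[OF ij])
  have "0 \<le> Im (z i)" using mono[of 0 i] z(1) ij by (cases "i = 0") auto
  moreover have "Im (z j) < Im \<tau>" using mono[of j N] z(3) ij by (cases "j = N") auto
  ultimately have "Im (z j) - Im (z i) < Im \<tau>" by simp
  then show "norm q < norm (x j / x i)" unfolding ratio nq by simp
  show "norm (x j / x i) < 1" unfolding ratio using lt by (simp add: mult_less_0_iff)
qed

theorem theorem3p8:
  fixes X :: "'h::ab_group_add surface"
    and F :: "('h, 'f::ab_group_add) fock"
    and N :: nat
    and H :: "nat \<Rightarrow> 'l::linorder set"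
    and \<alpha> :: "'l \<Rightarrow> 'h"
    and deg d :: "'l \<Rightarrow> nat"
    and \<tau> q :: complex
    and z x :: "nat \<Rightarrow> complex"
  assumes "nakajima_fock X F"
    and "numerically_trivial_canonical X"
    and "\<And>i. i \<in> {1..N} \<Longrightarrow> finite (H i)"
    and "concatenated N H"
    and "\<And>a. a \<in> labels N H \<Longrightarrow> \<alpha> a \<in> coh X (deg a)"
    and "\<And>a. a \<in> labels N H \<Longrightarrow> even (d a)"
    and "Im \<tau> > 0"
    and "q = exp (2 * of_real pi * \<i> * \<tau>)"
    and "\<And>i. i \<le> N \<Longrightarrow> x i = exp (2 * of_real pi * \<i> * z i)"
    and "0 \<le> Im (z 0)"
    and "\<And>i. i < N \<Longrightarrow> Im (z i) < Im (z (Suc i))"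
    and "Im (z N) < Im \<tau>"
  shows "Omega_blocks_converges X F N H \<alpha> deg d q x \<and>
    Omega_blocks X F N H \<alpha> deg d q x =
      (\<Sum>\<pi>\<in>singleton_pair_partitions (labels N H).
        partition_sign deg \<pi> * partition_weight X \<alpha> d (block_index N H) q x \<pi>)"
proof -
  interpret nakajima_fock X F by fact
  define J where "J = labels N H"
  define idx where "idx = block_index N H"
  define e where "e a m = (- of_int m) ^ d a * x (idx a) powi (- m)" for a m
  define L where "L \<mu> = normal_list N idx \<mu> J" for \<mu>
  have y: "x 0 \<noteq> 0" using assms(9)[of 0] by simp
  have q: "norm q < 1" "q \<noteq> 0" using assms(7) by (simp_all add: assms(8) norm_exp_eq_Re)
  note ratio = chamber_ratios[OF assms(8-12)]
  have x0: "x i \<noteq> 0" if "i \<le> N" for i using assms(9)[OF that] by simp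
  have J: "finite J" unfolding J_def labels_def using assms(3) by auto
  have idx_eq: "idx a = i" if "i \<in> {1..N}" "a \<in> H i" for a i
    unfolding idx_def by (rule block_index_eq[OF assms(4) that])
  have idx: "idx a \<in> {1..N} \<and> a \<in> H (idx a)" if "a \<in> J" for a
    using that idx_eq by (auto simp: J_def labels_def)
  have less: "a < b" if "i \<in> {1..N}" "j \<in> {1..N}" "i < j" "a \<in> H i" "b \<in> H j" for i j a b
    using assms(4) that unfolding concatenated_def by blast
  have mono: "idx a \<le> idx b" if "a \<in> J" "b \<in> J" "a < b" for a b
    using less[of "idx b" "idx a" b a] idx that by (meson less_asym not_le)
  have block: "{c \<in> J. idx c = i} = H i" if "i \<in> {1..N}" for i
    using that idx idx_eq by (auto simp: J_def labels_def)
  have homog: "\<alpha> a \<in> coh X (deg a)" and even: "even (d a)" if "a \<in> J" for a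
    using assms(5,6) that by (auto simp: J_def)
  have M: "has_abs_sum (\<lambda>m. e a m * mode_mean (x 0) q \<alpha> a m) (UNIV - {0}) (M_factor X \<alpha> d idx q x a)" if a: "a \<in> J" for a
    unfolding e_def M_factor_def
    by (rule mode_mean_sum) (use q idx[OF a] even[OF a] ratio[of 0 "idx a"] in auto)
  have K: "has_abs_sum (\<lambda>m. e a m * e b (- m) * mode_contraction q idx \<alpha> a b m) (UNIV - {0})
      (if idx a = idx b then L_factor X \<alpha> d q a b else C_factor X \<alpha> d idx q x a b)" if ab: "a \<in> J" "b \<in> J" "a < b" for a b
  proof (cases "idx a = idx b")
    case True
    then show ?thesis
      unfolding e_def L_factor_def
      using mode_contraction_sum_same[where x = "x (idx a)" and d = "d a" and d' = "d b" and idx = idx and a = a and b = b and \<alpha> = \<alpha>,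
          OF q _ even[OF ab(1)] even[OF ab(2)] True] x0[of "idx a"] idx[OF ab(1)] True by simp
  next
    case False
    have "idx a < idx b" using mono[OF ab] False by simp
    then show ?thesis
      unfolding e_def C_factor_def
      using mode_contraction_sum_distinct[where x = "x (idx a)" and x' = "x (idx b)" and d = "d a" and d' = "d b" and idx = idx
          and a = a and b = b and \<alpha> = \<alpha>, OF q _ _ even[OF ab(1)] even[OF ab(2)] False] ratio[of "idx a" "idx b"] idx[OF ab(2)] False
      by simp
  qed
  have main: "has_abs_sum (\<lambda>\<mu>. (\<Prod>a\<in>J. e a (\<mu> a)) * (koszul deg (L \<mu>) * normalized_trace (x 0) q \<mu> \<alpha> (L \<mu>)))
    (J \<rightarrow>\<^sub>E UNIV - {0}) (pairing_sum deg (M_factor X \<alpha> d idx q x)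
      (\<lambda>a b. if idx a = idx b then L_factor X \<alpha> d q a b else C_factor X \<alpha> d idx q x a b) J)"
    unfolding L_def by (rule normal_ordered_sum[OF y q J homog _ mono M K]) (use idx in auto)
  \<comment> \<open>Assignments take no zero modes, so \<open>normal_order\<close>, which would
    discard them, keeps every label.\<close>
  have good: "\<mu> b \<noteq> 0 \<and> \<alpha> b \<in> coh X (deg b)" if "\<mu> \<in> J \<rightarrow>\<^sub>E UNIV - {0}" "b \<in> set (L \<mu>)" for \<mu> b
  proof -
    have nz: "\<mu> a \<noteq> 0" if "a \<in> J" for a using \<open>\<mu> \<in> J \<rightarrow>\<^sub>E UNIV - {0}\<close> that by (auto simp: PiE_iff)
    have "set (L \<mu>) = J" unfolding L_def by (rule normal_list_set[OF J]) (use nz idx in auto)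
    then show ?thesis using that(2) nz homog by auto
  qed
  have mono_prod: "monomial_product F N H \<alpha> deg \<mu> = (\<lambda>v. sc (koszul deg (L \<mu>)) (nak_word \<mu> \<alpha> (L \<mu>) v))"
    if \<mu>: "\<mu> \<in> J \<rightarrow>\<^sub>E UNIV - {0}" for \<mu>
  proof
    fix v
    have nz: "\<mu> a \<noteq> 0" if "a \<in> J" for a using \<mu> that by (auto simp: PiE_iff)
    have L: "L \<mu> = concat (map (\<lambda>i. normal_order \<mu> (sorted_list_of_set (H i))) [1..<Suc N])"
      unfolding L_def normal_list_def by (intro arg_cong[where f = concat] map_cong refl) (use block in auto)
    show "monomial_product F N H \<alpha> deg \<mu> v = sc (koszul deg (L \<mu>)) (nak_word \<mu> \<alpha> (L \<mu>) v)"
      unfolding monomial_product_def L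
    proof (rule foldr_block_monomial)
      show "\<mu> a \<noteq> 0" if "i \<in> set [1..<Suc N]" "a \<in> H i" for i a
        using that by (intro nz) (auto simp: J_def labels_def)
      show "a < b" if "i \<in> set [1..<Suc N]" "j \<in> set [1..<Suc N]" "i < j" "a \<in> H i" "b \<in> H j" for i j a b
        by (rule less[of i j]) (use that in auto)
      show "sorted_wrt (<) [1..<Suc N]" by (rule sorted_wrt_upt)
    qed (use assms(3) in auto)
  qed
  have modes: "mode_assignments N H = J \<rightarrow>\<^sub>E UNIV - {0}" by (simp add: mode_assignments_def J_def)
  have tm: "Omega_term X F N H \<alpha> deg d q x \<mu> = (\<Prod>a\<in>J. e a (\<mu> a)) * (koszul deg (L \<mu>) * normalized_trace (x 0) q \<mu> \<alpha> (L \<mu>))"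
    if \<mu>: "\<mu> \<in> mode_assignments N H" for \<mu>
  proof -
    have \<mu>': "\<mu> \<in> J \<rightarrow>\<^sub>E UNIV - {0}" using \<mu> by (simp add: modes)
    have "Omega X F q (x 0) (monomial_product F N H \<alpha> deg \<mu>) = koszul deg (L \<mu>) * normalized_trace (x 0) q \<mu> \<alpha> (L \<mu>)"
      unfolding mono_prod[OF \<mu>'] by (rule Omega_word[OF y good[OF \<mu>'] q(1)])
    then show ?thesis
      by (simp add: Omega_term_def mode_coeff_def e_def J_def idx_def)
  qed
  have sums: "has_abs_sum (Omega_term X F N H \<alpha> deg d q x) (mode_assignments N H) (pairing_sum deg (M_factor X \<alpha> d idx q x)
      (\<lambda>a b. if idx a = idx b then L_factor X \<alpha> d q a b else C_factor X \<alpha> d idx q x a b) J)"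
    unfolding modes using main by (rule has_abs_sum_cong[THEN iffD2, rotated]) (rule tm, simp add: modes)
  have "Omega_blocks_converges X F N H \<alpha> deg d q x"
    unfolding Omega_blocks_converges_def
  proof (intro conjI ballI)
    show "hilb_supertrace F (weighted_op X F q (x 0) (\<lambda>v. v)) summable_on UNIV"
      using supertrace_identity[OF y q(1)] by (rule has_sum_imp_summable)
    show "supertrace F (weighted_op X F q (x 0) (\<lambda>v. v)) \<noteq> 0"
      unfolding supertrace_def infsumI[OF supertrace_identity[OF y q(1)]] by (rule eval_vac_fps_nonzero[OF y q(1)])
    fix \<mu> assume "\<mu> \<in> mode_assignments N H"
    then have \<mu>: "\<mu> \<in> J \<rightarrow>\<^sub>E UNIV - {0}" by (simp add: modes)
    show "hilb_supertrace F (weighted_op X F q (x 0) (monomial_product F N H \<alpha> deg \<mu>)) summable_on UNIV"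
      unfolding mono_prod[OF \<mu>] by (rule has_sum_imp_summable[OF supertrace_word[OF y good[OF \<mu>] q(1)]])
  next
    show "(\<lambda>\<mu>. norm (Omega_term X F N H \<alpha> deg d q x \<mu>)) summable_on mode_assignments N H"
      using sums by (simp add: has_abs_sum_def)
  qed
  moreover have "Omega_blocks X F N H \<alpha> deg d q x = (\<Sum>\<pi>\<in>singleton_pair_partitions J. partition_sign deg \<pi> * partition_weight X \<alpha> d idx q x \<pi>)"
  proof -
    have "Omega_blocks X F N H \<alpha> deg d q x = pairing_sum deg (M_factor X \<alpha> d idx q x)
      (\<lambda>a b. if idx a = idx b then L_factor X \<alpha> d q a b else C_factor X \<alpha> d idx q x a b) J"
      unfolding Omega_blocks_def using sums by (intro infsumI) (simp add: has_abs_sum_def)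
    also have "\<dots> = (\<Sum>\<pi>\<in>singleton_pair_partitions J. partition_sign deg \<pi> * partition_weight X \<alpha> d idx q x \<pi>)"
      unfolding pairing_sum_def by (intro sum.cong refl) (simp add: partition_weight_eq[OF _ J])
    finally show ?thesis .
  qed
  ultimately show ?thesis by (simp add: J_def idx_def)
qed

end
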